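(* Assume the weak Mertens hypothesis, i.e. $\int_1^X \big(M(x)/x\big)^2\,dx \ll \log X$ as $X\to\infty$. Then $$\int_1^X F(x)^2\,dx = A\log X+O(1)$$ as $X\to\infty$, where $$A=\tfrac12\sum_{\gamma>0}|a(\gamma)|^2.$$
   Context: $\mu$ is the Möbius function, $M(x)=\sum_{n\le x}\mu(n)$, and for $x>0$, $$F(x)=\sum_{n=1}^\infty \frac{\mu(n)}{n}e^{-(x/n)^2}.$$ $\zeta$ is the Riemann zeta function and $\Gamma$ the Gamma function. The weak Mertens hypothesis implies the Riemann hypothesis and that all nontrivial zeros of $\zeta$ are simple; so under this hypothesis the nontrivial zeros are $\rho=\tfrac12+i\gamma$ with $\gamma$ real and $\zeta'(\rho)\neq 0$. Sums over $\gamma>0$ run over the positive ordinates of the nontrivial zeros, and $$a(\gamma)=\frac{\Gamma\left(\tfrac14-i\tfrac{\gamma}{2}\right)}{\zeta'\left(\tfrac12+i\gamma\right)}.$$ *)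

theory Defs
  imports
    "HOL-Complex_Analysis.Complex_Analysis"
    "HOL-Library.Landau_Symbols"
    "HOL-Computational_Algebra.Squarefree"
begin

section \<open>The Moebius function and its summatory function\<close>

definition moebius :: "nat \<Rightarrow> real" where
  "moebius n = (if squarefree n then (-1) ^ card (prime_factors n) else 0)"

definition mertens :: "real \<Rightarrow> real" where
  "mertens x = (\<Sum>n = 1..nat \<lfloor>x\<rfloor>. moebius n)"

definition weak_mertens_hypothesis :: bool where
  "weak_mertens_hypothesis \<longleftrightarrow>
     (\<lambda>X. integral {1..X} (\<lambda>x. (mertens x / x)\<^sup>2)) \<in> O[at_top](\<lambda>X. ln X)"

definition gauss_F :: "real \<Rightarrow> real" where
  "gauss_F x = (\<Sum>n. moebius (Suc n) / real (Suc n) * exp (- ((x / real (Suc n))\<^sup>2)))"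


section \<open>The Riemann zeta function\<close>

text \<open>
  The zeta function is the analytic continuation of the Dirichlet series to the plane without the
  point 1. Lemmas \<open>zeta_exists\<close> and \<open>zeta_unique\<close> below show that the continuation exists and
  is unique away from 1. The value at 1 is left unspecified.
\<close>

definition is_zeta :: "(complex \<Rightarrow> complex) \<Rightarrow> bool" where
  "is_zeta f \<longleftrightarrow> f holomorphic_on (UNIV - {1}) \<and>
     (\<forall>s. Re s > 1 \<longrightarrow> (\<lambda>n. 1 / of_nat (Suc n) powr s) sums f s)"

definition zeta :: "complex \<Rightarrow> complex" where
  "zeta = (SOME f. is_zeta f)"

lemma holomorphic_suminf:
  fixes f :: "nat \<Rightarrow> complex \<Rightarrow> complex"
  assumes S: "open S" and hol: "\<And>n. f n holomorphic_on S"
    and bound: "\<And>x. x \<in> S \<Longrightarrow> \<exists>d>0. \<exists>M. cball x d \<subseteq> S \<and> summable M \<and>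
                  (\<forall>n. \<forall>y\<in>cball x d. norm (f n y) \<le> M n)"
  shows "(\<lambda>s. \<Sum>n. f n s) holomorphic_on S"
proof (rule holomorphic_uniform_sequence[OF S, where f = "\<lambda>n s. \<Sum>i<n. f i s"])
  show "(\<lambda>s. \<Sum>i<n. f i s) holomorphic_on S" for n
    by (intro holomorphic_intros hol)
next
  fix x assume "x \<in> S"
  from bound[OF this] obtain d M where dM: "d > 0" "cball x d \<subseteq> S" "summable M"
    "\<And>n y. y \<in> cball x d \<Longrightarrow> norm (f n y) \<le> M n"
    by blast
  have "uniform_limit (cball x d) (\<lambda>n s. \<Sum>i<n. f i s) (\<lambda>s. \<Sum>n. f n s) sequentially"
    by (rule Weierstrass_m_test[OF dM(4) dM(3)])
  with dM show "\<exists>d>0. cball x d \<subseteq> S \<and>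
      uniform_limit (cball x d) (\<lambda>n s. \<Sum>i<n. f i s) (\<lambda>s. \<Sum>n. f n s) sequentially"
    by blast
qed

text \<open>
  With \<open>D s = zeta s - 1\<close>, expand \<open>(w - 1) powr (1 - s) - w powr (1 - s)\<close> in powers of \<open>1 / w\<close>
  and sum over \<open>w = 2, 3, ...\<close>; the left-hand side telescopes to 1. This expresses \<open>(s - 1) * D s\<close>
  through its values at \<open>s + 1, s + 2, ...\<close> and a series of Taylor remainders that converges in a
  larger half-plane, so the continuation is obtained one unit strip at a time.
\<close>

context
  fixes w :: "nat \<Rightarrow> complex" and D :: "complex \<Rightarrow> complex"
  defines "w \<equiv> (\<lambda>j. of_nat (j + 2))"
  defines "D \<equiv> (\<lambda>s. \<Sum>j. w j powr (- s))"
begin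

lemma w_simps: "w j \<in> \<real>" "Re (w j) = real (j + 2)" "w j \<noteq> 0" "norm (w j) = real (j + 2)"
  "w j = of_real (real (j + 2))" "w j - 1 = of_nat (j + 1)"
proof -
  show "w j = of_real (real (j + 2))" "w j \<in> \<real>" "Re (w j) = real (j + 2)" "w j - 1 = of_nat (j + 1)"
    by (simp_all add: w_def)
  show n: "norm (w j) = real (j + 2)" unfolding w_def by (rule norm_of_nat)
  then show "w j \<noteq> 0" by auto
qed

lemma norm_w_powr: "norm (w j powr s) = real (j + 2) powr Re s"
  using norm_powr_real_powr[of "w j" s] by (simp add: w_simps)

lemma summable_shift_powr:
  assumes "a < -1" shows "summable (\<lambda>j. real (j + 2) powr a)"
proof -
  have "summable (\<lambda>n. real n powr a)" using assms by (simp add: summable_real_powr_iff)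
  then show ?thesis by (rule summable_ignore_initial_segment[where k = 2])
qed

lemma sums_D:
  assumes "Re s > 1" shows "(\<lambda>j. w j powr (- s)) sums D s"
proof -
  have "summable (\<lambda>j. w j powr (- s))"
    by (rule summable_norm_cancel) (use assms summable_shift_powr[of "- Re s"] in \<open>simp add: norm_w_powr\<close>)
  then show ?thesis unfolding D_def by (rule summable_sums)
qed

lemma taylor_remainder:
  fixes s0 :: complex and d :: real
  obtains B where "B \<ge> 0" "\<And>s z. s \<in> cball s0 d \<Longrightarrow> norm z \<le> 1/2 \<Longrightarrow>
    norm ((1 - z) powr (1 - s) - (\<Sum>i\<le>n. pochhammer (s - 1) i / fact i * z ^ i)) \<le> B * norm z ^ Suc n"
proof -
  define f where "f = (\<lambda>s i z. pochhammer (s - 1) i * (1 - z) powr (1 - s - of_nat i) :: complex)"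
  have Re: "Re z \<le> 1/2" if "norm z \<le> 1/2" for z
    using complex_Re_le_cmod[of z] that by linarith
  have Re': "Re z \<le> 1" if "norm z * 2 \<le> 1" for z
    using complex_Re_le_cmod[of z] that norm_ge_zero[of z] by linarith
  have "compact ((\<lambda>p. f (fst p) (Suc n) (snd p)) ` (cball s0 d \<times> cball 0 (1/2)))"
    unfolding f_def
    by (intro compact_continuous_image compact_Times compact_cball continuous_intros)
       (auto dest: Re')
  from compact_imp_bounded[OF this]
  obtain B where B: "\<And>p. p \<in> cball s0 d \<times> cball 0 (1/2) \<Longrightarrow> norm (f (fst p) (Suc n) (snd p)) \<le> B"
    unfolding bounded_iff by blast
  define B' where "B' = max B 0"
  have "norm ((1 - z) powr (1 - s) - (\<Sum>i\<le>n. pochhammer (s - 1) i / fact i * z ^ i))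
          \<le> B' * norm z ^ Suc n" if s: "s \<in> cball s0 d" and z: "norm z \<le> 1/2" for s z
  proof -
    have "norm (f s 0 z - (\<Sum>i\<le>n. f s i 0 * (z - 0) ^ i / fact i)) \<le> B' * norm (z - 0) ^ Suc n / fact n"
    proof (rule complex_Taylor[where S = "cball 0 (1/2)"])
      fix i x assume x: "x \<in> cball (0 :: complex) (1/2)"
      then have *: "1 - x \<notin> \<real>\<^sub>\<le>\<^sub>0" using Re[of x] by (auto simp: complex_nonpos_Reals_iff)
      have "((\<lambda>z. (1 - z) powr (1 - s - of_nat i)) has_field_derivative
              ((1 - s - of_nat i) * (1 - x) powr (1 - s - of_nat i - 1)) * (0 - 1)) (at x within cball 0 (1/2))"
        by (rule DERIV_chain'[where f = "\<lambda>z. 1 - z" and g = "\<lambda>z. z powr (1 - s - of_nat i)", OF _ has_field_derivative_powr[OF *]])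
           (auto intro!: derivative_eq_intros)
      from DERIV_cmult[OF this, of "pochhammer (s - 1) i"]
      show "(f s i has_field_derivative f s (Suc i) x) (at x within cball 0 (1/2))"
        unfolding f_def by (simp add: pochhammer_Suc algebra_simps)
    next
      fix x assume "x \<in> cball (0 :: complex) (1/2)"
      then show "norm (f s (Suc n) x) \<le> B'" using B[of "(s, x)"] s by (auto simp: B'_def)
    qed (use z in auto)
    also have "\<dots> \<le> B' * norm z ^ Suc n"
    proof -
      have "(1::real) \<le> fact n" by (rule fact_ge_1)
      moreover have "0 \<le> B' * norm z ^ Suc n" by (simp add: B'_def)
      ultimately show ?thesis
        using frac_le[of "B' * norm z ^ Suc n" "B' * norm z ^ Suc n" 1 "fact n"] by simp
    qed
    finally show ?thesis by (simp add: f_def)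
  qed
  with that[of B'] show ?thesis by (simp add: B'_def)
qed

definition zeta_remainder :: "nat \<Rightarrow> nat \<Rightarrow> complex \<Rightarrow> complex" where
  "zeta_remainder n j s = (w j - 1) powr (1 - s) -
               (\<Sum>i\<le>n. pochhammer (s - 1) i / fact i * w j powr (1 - s - of_nat i))"

lemma zeta_remainder_eq: "zeta_remainder n j s = w j powr (1 - s) *
    ((1 - 1 / w j) powr (1 - s) - (\<Sum>i\<le>n. pochhammer (s - 1) i / fact i * (1 / w j) ^ i))"
proof -
  have *: "1 - 1 / w j = of_real (1 - 1 / real (j + 2))"
    by (simp add: w_simps(5))
  have "(w j * (1 - 1 / w j)) powr (1 - s) = w j powr (1 - s) * (1 - 1 / w j) powr (1 - s)"
    by (intro powr_times_real_left) (auto simp: w_simps)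
  moreover have "w j * (1 - 1 / w j) = w j - 1"
    using w_simps(3)[of j] by (simp add: field_simps)
  moreover have "w j powr (1 - s - of_nat i) = w j powr (1 - s) * (1 / w j) ^ i" for i
    using w_simps(3)[of j] by (simp add: powr_diff power_divide)
  ultimately show ?thesis
    unfolding zeta_remainder_def by (simp add: right_diff_distrib sum_distrib_left mult_ac)
qed

lemma holomorphic_R: "(\<lambda>s. \<Sum>j. zeta_remainder n j s) holomorphic_on {s. Re s > 1 - real n}"
proof (rule holomorphic_suminf)
  show "open {s. Re s > 1 - real n}" by (rule open_halfspace_Re_gt)
  show "zeta_remainder n j holomorphic_on {s. Re s > 1 - real n}" for j
    unfolding zeta_remainder_def by (intro holomorphic_intros) auto
  fix x assume x: "x \<in> {s. Re s > 1 - real n}"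
  define d where "d = (Re x - 1 + real n) / 2"
  have d: "d > 0" using x by (simp add: d_def)
  obtain B where B: "B \<ge> 0" "\<And>s z. s \<in> cball x d \<Longrightarrow> norm z \<le> 1/2 \<Longrightarrow>
    norm ((1 - z) powr (1 - s) - (\<Sum>i\<le>n. pochhammer (s - 1) i / fact i * z ^ i)) \<le> B * norm z ^ Suc n"
    using taylor_remainder[of x d n] by blast
  define M where "M = (\<lambda>j. B * real (j + 2) powr (- 1 - d))"
  have Re: "Re y \<ge> Re x - d" if "y \<in> cball x d" for y
    using abs_Re_le_cmod[of "x - y"] that by (auto simp: dist_norm)
  have "norm (zeta_remainder n j y) \<le> M j" if y: "y \<in> cball x d" for j y
  proof -
    have "norm (zeta_remainder n j y) = real (j + 2) powr (1 - Re y) *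
       norm ((1 - 1 / w j) powr (1 - y) - (\<Sum>i\<le>n. pochhammer (y - 1) i / fact i * (1 / w j) ^ i))"
      unfolding zeta_remainder_eq norm_mult norm_w_powr by simp
    also have "\<dots> \<le> real (j + 2) powr (1 - Re y) * (B * norm (1 / w j) ^ Suc n)"
      by (intro mult_left_mono B y) (auto simp: norm_divide w_simps(4))
    also have "norm (1 / w j) ^ Suc n = real (j + 2) powr (- real (Suc n))"
      unfolding norm_divide w_simps(4)
      by (simp add: powr_minus powr_realpow divide_inverse power_inverse
               del: of_nat_Suc of_nat_add power_Suc)
    also have "real (j + 2) powr (1 - Re y) * (B * real (j + 2) powr (- real (Suc n)))
                 = B * real (j + 2) powr (1 - Re y - real (Suc n))"
      by (simp add: diff_conv_add_uminus powr_add mult_ac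
               del: of_nat_Suc of_nat_add add_uminus_conv_diff)
    also have "\<dots> \<le> M j"
      unfolding M_def
      by (intro mult_left_mono B powr_mono) (use Re[OF y] in \<open>auto simp: d_def field_simps\<close>)
    finally show ?thesis .
  qed
  moreover have "summable M"
    unfolding M_def using d by (intro summable_mult summable_shift_powr) auto
  moreover have "cball x d \<subseteq> {s. Re s > 1 - real n}"
    using Re d unfolding d_def by (force simp: field_simps)
  ultimately show "\<exists>d>0. \<exists>M. cball x d \<subseteq> {s. Re s > 1 - real n} \<and> summable M \<and>
                  (\<forall>j. \<forall>y\<in>cball x d. norm (zeta_remainder n j y) \<le> M j)"
    using d by blast
qed

lemma D_recursion:
  assumes s: "Re s > 1"
  shows "(s - 1) * D s = 1 - (\<Sum>j. zeta_remainder (Suc n) j s) -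
    (\<Sum>m<n. pochhammer (s - 1) (Suc m) / fact (m + 2) * ((s + of_nat (Suc m) - 1) * D (s + of_nat (Suc m))))"
proof -
  have "(\<lambda>j. of_nat (j + 1) powr (1 - s) - of_nat (Suc j + 1) powr (1 - s)) sums (of_nat (0 + 1) powr (1 - s) - 0 :: complex)"
    by (rule telescope_sums'[where f = "\<lambda>j. of_nat (j + 1) powr (1 - s)"])
       (intro tendsto_neg_powr_complex_of_nat filterlim_subseq, use s in \<open>auto simp: strict_mono_def\<close>)
  then have tele: "(\<lambda>j. (w j - 1) powr (1 - s) - w j powr (1 - s)) sums 1"
    unfolding w_simps by (simp add: w_def)
  have S: "(\<lambda>j. \<Sum>m<Suc n. pochhammer (s - 1) (Suc m) / fact (Suc m) * w j powr (- (s + of_nat m)))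
      sums (\<Sum>m<Suc n. pochhammer (s - 1) (Suc m) / fact (Suc m) * D (s + of_nat m))"
    by (intro sums_sum sums_mult sums_D) (use s in auto)
  have "zeta_remainder (Suc n) j s = (w j - 1) powr (1 - s) - w j powr (1 - s) -
      (\<Sum>m<Suc n. pochhammer (s - 1) (Suc m) / fact (Suc m) * w j powr (- (s + of_nat m)))" for j
  proof -
    have "1 - s - of_nat (Suc m) = - (s + of_nat m)" for m
      by simp
    then have "(\<Sum>i\<le>Suc n. pochhammer (s - 1) i / fact i * w j powr (1 - s - of_nat i))
       = w j powr (1 - s) + (\<Sum>m<Suc n. pochhammer (s - 1) (Suc m) / fact (Suc m) * w j powr (- (s + of_nat m)))"
      unfolding sum.atMost_Suc_shift lessThan_Suc_atMost by (simp only:) simp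
    then show ?thesis
      unfolding zeta_remainder_def by (simp only: diff_diff_eq)
  qed
  then have "(\<lambda>j. zeta_remainder (Suc n) j s) sums
      (1 - (\<Sum>m<Suc n. pochhammer (s - 1) (Suc m) / fact (Suc m) * D (s + of_nat m)))"
    using sums_diff[OF tele S] by (simp only:)
  then have R: "(\<Sum>j. zeta_remainder (Suc n) j s) =
      1 - (\<Sum>m<Suc n. pochhammer (s - 1) (Suc m) / fact (Suc m) * D (s + of_nat m))"
    by (rule sums_unique[symmetric])
  have "(\<Sum>m<Suc n. pochhammer (s - 1) (Suc m) / fact (Suc m) * D (s + of_nat m)) =
      (s - 1) * D s + (\<Sum>m<n. pochhammer (s - 1) (Suc (Suc m)) / fact (m + 2) * D (s + of_nat (Suc m)))"
    by (subst sum.lessThan_Suc_shift) (simp add: numeral_2_eq_2)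
  also have "(\<Sum>m<n. pochhammer (s - 1) (Suc (Suc m)) / fact (m + 2) * D (s + of_nat (Suc m))) =
     (\<Sum>m<n. pochhammer (s - 1) (Suc m) / fact (m + 2) * ((s + of_nat (Suc m) - 1) * D (s + of_nat (Suc m))))"
    by (intro sum.cong refl, subst pochhammer_Suc[of _ "Suc _"]) (simp add: algebra_simps)
  finally show ?thesis unfolding R by simp
qed

lemma continuation_halfplane:
  "\<exists>E. E holomorphic_on {s. Re s > 1 - real K} \<and> (\<forall>s. Re s > 1 \<longrightarrow> E s = (s - 1) * D s)"
proof (induction K)
  case 0
  have "D holomorphic_on {s. Re s > 1}"
    unfolding D_def
  proof (rule holomorphic_suminf)
    show "open {s. Re s > 1}" by (rule open_halfspace_Re_gt)
    show "(\<lambda>s. w j powr (- s)) holomorphic_on {s. Re s > 1}" for j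
      by (intro holomorphic_intros)
    fix x assume x: "x \<in> {s. Re s > 1}"
    define d where "d = (Re x - 1) / 2"
    have d: "d > 0" using x by (simp add: d_def)
    have Re: "Re y \<ge> 1 + d" if "y \<in> cball x d" for y
      using abs_Re_le_cmod[of "x - y"] that by (auto simp: dist_norm d_def field_simps)
    have "norm (w j powr (- y)) \<le> real (j + 2) powr (- 1 - d)" if "y \<in> cball x d" for j y
      unfolding norm_w_powr by (rule powr_mono) (use Re[OF that] in auto)
    moreover have "summable (\<lambda>j. real (j + 2) powr (- 1 - d))"
      using d by (intro summable_shift_powr) auto
    moreover have "cball x d \<subseteq> {s. Re s > 1}"
      using Re d by force
    ultimately show "\<exists>d>0. \<exists>M. cball x d \<subseteq> {s. Re s > 1} \<and> summable M \<and>
                  (\<forall>j. \<forall>y\<in>cball x d. norm (w j powr (- y)) \<le> M j)"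
      using d by blast
  qed
  then have "(\<lambda>s. (s - 1) * D s) holomorphic_on {s. Re s > 1}"
    by (intro holomorphic_intros)
  then show ?case by auto
next
  case (Suc K)
  then obtain E where E: "E holomorphic_on {s. Re s > 1 - real K}"
    "\<And>s. Re s > 1 \<Longrightarrow> E s = (s - 1) * D s" by blast
  define E' where "E' = (\<lambda>s. 1 - (\<Sum>j. zeta_remainder (Suc K) j s) -
    (\<Sum>m<K. pochhammer (s - 1) (Suc m) / fact (m + 2) * E (s + of_nat (Suc m))))"
  have shift: "(\<lambda>s. E (s + of_nat (Suc m))) holomorphic_on {s. Re s > 1 - real (Suc K)}" for m
  proof -
    have "(\<lambda>s. s + of_nat (Suc m)) holomorphic_on {s. Re s > 1 - real (Suc K)}"
      by (intro holomorphic_intros)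
    moreover have "(\<lambda>s. s + of_nat (Suc m)) ` {s. Re s > 1 - real (Suc K)} \<subseteq> {s. Re s > 1 - real K}"
      by auto
    ultimately show ?thesis
      using holomorphic_on_compose_gen[OF _ E(1)] unfolding o_def by blast
  qed
  have "E' holomorphic_on {s. Re s > 1 - real (Suc K)}"
    unfolding E'_def by (intro holomorphic_intros holomorphic_R shift) auto
  moreover have "E' s = (s - 1) * D s" if "Re s > 1" for s
    unfolding E'_def D_recursion[OF that, of K] using that by (subst E(2)) auto
  ultimately show ?case by blast
qed

lemma zeta_exists: "\<exists>f. is_zeta f"
proof -
  have "\<exists>E. \<forall>K. E K holomorphic_on {s. Re s > 1 - real K} \<and> (\<forall>s. Re s > 1 \<longrightarrow> E K s = (s - 1) * D s)"
    using continuation_halfplane by metis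
  then obtain E where E: "\<And>K. E K holomorphic_on {s. Re s > 1 - real K}"
    "\<And>K s. Re s > 1 \<Longrightarrow> E K s = (s - 1) * D s" by blast
  have conn: "connected {s. Re s > c}" for c
    by (intro convex_connected convex_halfspace_Re_gt)
  have agree: "E K s = E L s" if "K \<le> L" "Re s > 1 - real K" for K L s
  proof (rule analytic_continuation_open[where s = "{s. Re s > 1}" and s' = "{s. Re s > 1 - real K}" and f = "E K" and g = "E L"])
    have "2 \<in> {s :: complex. Re s > 1}" by simp
    then show "{s :: complex. Re s > 1} \<noteq> {}" by blast
    show "E L holomorphic_on {s. Re s > 1 - real K}"
      by (rule holomorphic_on_subset[OF E(1)[of L]]) (use that in auto)
  qed (use that E conn in \<open>auto intro: open_halfspace_Re_gt\<close>)
  define G where "G = (\<lambda>s. E (nat \<lceil>2 - Re s\<rceil>) s)"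
  have G: "G s = E K s" if "Re s > 1 - real K" for K s
  proof -
    have *: "Re s > 1 - real (nat \<lceil>2 - Re s\<rceil>)" by linarith
    show ?thesis unfolding G_def
      using agree[OF _ *, of K] agree[OF _ that, of "nat \<lceil>2 - Re s\<rceil>"] 
      by (metis nle_le)
  qed
  have "G field_differentiable (at x)" for x
  proof -
    obtain K :: nat where "1 - Re x < real K" using reals_Archimedean2 by blast
    then have K: "Re x > 1 - real K" by linarith
    have "G holomorphic_on {s. Re s > 1 - real K}"
      by (rule holomorphic_transform[OF E(1)[of K]]) (simp add: G)
    then show ?thesis
      by (rule holomorphic_on_imp_differentiable_at) (use K in \<open>auto intro: open_halfspace_Re_gt\<close>)
  qed
  then have holG: "G holomorphic_on A" for A
    by (simp add: holomorphic_on_def field_differentiable_at_within)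
  define f where "f = (\<lambda>s. 1 + G s / (s - 1))"
  have "f holomorphic_on (UNIV - {1})"
    unfolding f_def by (intro holomorphic_intros holG) auto
  moreover have "(\<lambda>n. 1 / of_nat (Suc n) powr s) sums f s" if s: "Re s > 1" for s
  proof -
    have "s \<noteq> 1" using s by auto
    then have f: "f s = D s + 1" using s G[of 0 s] E(2)[of s 0] by (simp add: f_def)
    have "(\<lambda>n. 1 / of_nat (Suc (Suc n)) powr s) sums D s"
      using sums_D[OF s] by (simp add: w_def powr_minus field_simps)
    then show ?thesis
      unfolding f using sums_Suc[of "\<lambda>n. 1 / of_nat (Suc n) powr s" "D s"] by simp
  qed
  ultimately show ?thesis unfolding is_zeta_def by blast
qed

end

lemma is_zeta_zeta: "is_zeta zeta"
  unfolding zeta_def by (rule someI_ex[OF zeta_exists])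

lemma zeta_unique:
  assumes "is_zeta f" "is_zeta g" "s \<noteq> 1"
  shows "f s = g s"
proof (rule analytic_continuation_open[where s = "{s. Re s > 1}" and s' = "UNIV - {1}" and f = f and g = g])
  have "2 \<in> {s :: complex. Re s > 1}" by simp
  then show "{s :: complex. Re s > 1} \<noteq> {}" by blast
  show "connected (UNIV - {1 :: complex})"
    using connected_punctured_universe[of "1 :: complex"] by (simp add: Compl_eq_Diff_UNIV)
  show "f z = g z" if "z \<in> {s. Re s > 1}" for z
    using assms that unfolding is_zeta_def by (blast intro: sums_unique2)
qed (use assms in \<open>auto simp: is_zeta_def intro: open_halfspace_Re_gt\<close>)

definition nontrivial_zeros :: "complex set" where
  "nontrivial_zeros = {\<rho>. zeta \<rho> = 0 \<and> 0 < Re \<rho> \<and> Re \<rho> < 1}"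

definition positive_ordinates :: "real set" where
  "positive_ordinates = {\<gamma>. \<gamma> > 0 \<and> (\<exists>\<rho>\<in>nontrivial_zeros. Im \<rho> = \<gamma>)}"


section \<open>The coefficients of the mean square\<close>

text \<open>
  The weak Mertens hypothesis implies that all zeros in the critical strip are simple and lie on the
  critical line. Hence the sum in \<open>mean_square_const\<close> may run over the set of ordinates without
  multiplicities, and the denominator of \<open>zero_coeff\<close> does not vanish there.
\<close>

definition zero_coeff :: "real \<Rightarrow> complex" where
  "zero_coeff \<gamma> = Gamma (1/4 - \<i> * of_real \<gamma> / 2) / deriv zeta (1/2 + \<i> * of_real \<gamma>)"

definition mean_square_const :: real where
  "mean_square_const = 1/2 * (\<Sum>\<^sub>\<infinity>\<gamma>\<in>positive_ordinates. (cmod (zero_coeff \<gamma>))\<^sup>2)"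

end

theory Submission
  imports Defs
begin

text \<open>
  Mellin inversion of \<open>exp (- y)\<close> turns \<open>F(x)\<close> into an integral of \<open>\<Gamma>((1 - s)/2) x\<^bsup>s - 1\<^esup> / \<zeta>(s)\<close> over the line
  \<open>Re s = 3/4\<close>. By Abel summation and the inequality \<open>2ab \<le> a\<^sup>2 + b\<^sup>2\<close>, the weak Mertens hypothesis gives
  \<open>1 / \<zeta>(s) \<lless> \<bar>s\<bar> / (Re s - 1/2)\<close> near the critical line, and hence the Riemann hypothesis and
  \<open>\<bar>\<zeta>'(\<rho>)\<bar> \<ggreater> 1 / \<bar>\<rho>\<bar>\<close>. As \<open>\<zeta>\<close> grows at most polynomially, the latter forces gaps of polynomial size
  between the zeros, which in turn bounds their number. The functional equation carries the bound
  for \<open>1 / \<zeta>\<close> to the left of the critical line, so the integral can be moved to \<open>Re s = 1/4\<close>, and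
  \<open>x\<^bsup>1/2\<^esup> F(x) = 1/2 \<Sum>\<^sub>\<gamma> a(\<gamma>) x\<^bsup>i\<gamma>\<^esup> + O(x\<^bsup>- 1/4\<^esup>)\<close> with \<open>\<gamma>\<close> running over the ordinates of both signs. In the
  mean square the diagonal terms give \<open>A log X\<close>. The off-diagonal terms are bounded, because \<open>a(\<gamma>)\<close>
  decays exponentially while the gaps are only polynomially small.
\<close>

section \<open>Contour shifts across a vertical strip\<close>

text \<open>The hypothesis bounds 1/zeta only to the right of the critical line, by a quantity that
  blows up like 1/(Re s - 1/2). Two obstacles follow. The horizontal sides of the contour cross the
  line, where the bound is void; heights at polynomial distance from all zeros and a maximum modulus
  argument on small discs carry it across. And the Dirichlet series of 1/zeta is not known to
  converge absolutely on Re s = 3/4, so sum and integral are interchanged only after Abel summation,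
  and M(N) = o(N) is needed to return to F. To avoid the pole at 1, zeta enters as
  \<open>zeta_reg\<close>, that is (s - 1) zeta(s). Gamma decays exponentially while all losses
  (gaps, 1/|zeta'|, the factor |s|) are polynomial, so crude decay rates do. The mean square of
  x^(1/2) F(x) in the variable u = log x is 1/4 of the sum of |a(gamma)|^2 over both signs, which
  gives the 1/2 in A.\<close>

lemma tendsto_integral_symmetric_interval:
  fixes g :: "real \<Rightarrow> complex" and T :: "nat \<Rightarrow> real"
  assumes g: "integrable lborel g" and T: "filterlim T at_top sequentially"
  shows "(\<lambda>n. integral {- T n..T n} g) \<longlonglongrightarrow> (LINT t|lborel. g t)"
proof -
  have si: "set_integrable lborel {- T n..T n} g" for n
    using integrable_mult_indicator[OF _ g, of "{- T n..T n}"] by (simp add: set_integrable_def)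
  have "(\<lambda>n. LINT t|lborel. indicator {- T n..T n} t *\<^sub>R g t) \<longlonglongrightarrow> (LINT t|lborel. g t)"
  proof (rule integral_dominated_convergence[where w = "\<lambda>t. norm (g t)"])
    show "AE t in lborel. (\<lambda>n. indicator {- T n..T n} t *\<^sub>R g t) \<longlonglongrightarrow> g t"
    proof (rule AE_I2)
      fix t
      have "\<forall>\<^sub>F n in sequentially. T n \<ge> \<bar>t\<bar>"
        using T by (auto simp: filterlim_at_top)
      then have "\<forall>\<^sub>F n in sequentially. indicator {- T n..T n} t *\<^sub>R g t = g t"
        by eventually_elim (auto simp: indicator_def)
      then show "(\<lambda>n. indicator {- T n..T n} t *\<^sub>R g t) \<longlonglongrightarrow> g t"
        by (rule tendsto_eventually)
    qed
    show "AE t in lborel. norm (indicator {- T n..T n} t *\<^sub>R g t) \<le> norm (g t)" for n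
      by (auto simp: indicator_def)
  qed (use g in auto)
  moreover have "(LINT t|lborel. indicator {- T n..T n} t *\<^sub>R g t) = integral {- T n..T n} g" for n
    using set_borel_integral_eq_integral(2)[OF si[of n]] by (simp add: set_lebesgue_integral_def)
  ultimately show ?thesis by simp
qed

text \<open>The vertical sides become integrals over t, as the limit needs them; the horizontal
  sides stay contour integrals because they are only estimated.\<close>

lemma contour_integral_rectpath:
  assumes "a < b" "0 < T" and c: "continuous_on (path_image (rectpath (Complex a (-T)) (Complex b T))) f"
  shows "contour_integral (rectpath (Complex a (-T)) (Complex b T)) f =
     contour_integral (linepath (Complex a (-T)) (Complex b (-T))) f
     + contour_integral (linepath (Complex b T) (Complex a T)) f
     + \<i> * (integral {-T..T} (\<lambda>t. f (Complex b t)) - integral {-T..T} (\<lambda>t. f (Complex a t)))"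
proof -
  define p q r s where "p = Complex a (-T)" "q = Complex b (-T)" "r = Complex b T" "s = Complex a T"
  have R: "rectpath (Complex a (-T)) (Complex b T) = linepath p q +++ linepath q r +++ linepath r s +++ linepath s p"
    by (simp add: rectpath_def p_q_r_s_def Let_def)
  have "continuous_on (closed_segment p q) f" "continuous_on (closed_segment q r) f"
    "continuous_on (closed_segment r s) f" "continuous_on (closed_segment s p) f"
    by (rule continuous_on_subset[OF c]; simp add: R path_image_join; blast)+
  then have i: "f contour_integrable_on linepath p q" "f contour_integrable_on linepath q r"
     "f contour_integrable_on linepath r s" "f contour_integrable_on linepath s p"
    by (auto intro: contour_integrable_continuous_linepath)
  have "contour_integral (rectpath (Complex a (-T)) (Complex b T)) f =
    contour_integral (linepath p q) f + (contour_integral (linepath q r) f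
     + (contour_integral (linepath r s) f + contour_integral (linepath s p) f))"
    unfolding R using i by (simp add: contour_integrable_joinI)
  moreover have "contour_integral (linepath q r) f = \<i> * integral {-T..T} (\<lambda>t. f (Complex b t))"
    by (rule contour_integral_linepath_same_Re) (use assms in \<open>auto simp: p_q_r_s_def\<close>)
  moreover have "contour_integral (linepath p s) f = \<i> * integral {-T..T} (\<lambda>t. f (Complex a t))"
    by (rule contour_integral_linepath_same_Re) (use assms in \<open>auto simp: p_q_r_s_def\<close>)
  moreover have "contour_integral (linepath s p) f = - contour_integral (linepath p s) f"
    using contour_integral_reversepath[of "linepath p s" f] by simp
  ultimately show ?thesis by (simp add: p_q_r_s_def algebra_simps)
qed

text \<open>Rectangles of heights \<open>T n\<close> exhaust the strip. The heights form a sequence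
  instead of a real parameter so that they can dodge infinitely many poles; \<open>e n\<close>
  bounds the integrand on the horizontal sides, whose length is fixed. The margin \<eta> leaves an
  open neighbourhood of the closed strip for the residue theorem.\<close>

lemma strip_residue_theorem:
  fixes f :: "complex \<Rightarrow> complex" and T :: "nat \<Rightarrow> real"
  assumes ab: "a < b" and eta: "\<eta> > 0"
    and hol: "f holomorphic_on {z. a - \<eta> < Re z \<and> Re z < b + \<eta>} - P"
    and P: "P \<subseteq> {z. a < Re z \<and> Re z < b}"
    and fin: "\<And>T. finite {p \<in> P. \<bar>Im p\<bar> < T}"
    and T: "filterlim T at_top sequentially"
    and avoid: "\<forall>\<^sub>F n in sequentially. \<forall>p\<in>P. \<bar>Im p\<bar> \<noteq> T n"
    and bound: "\<forall>\<^sub>F n in sequentially. \<forall>x\<in>{a..b}.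
        norm (f (Complex x (T n))) \<le> e n \<and> norm (f (Complex x (- T n))) \<le> e n"
    and e: "e \<longlonglongrightarrow> 0"
    and int: "integrable lborel (\<lambda>t. f (Complex a t))" "integrable lborel (\<lambda>t. f (Complex b t))"
  shows "(\<lambda>n. 2 * pi * (\<Sum>p\<in>{p \<in> P. \<bar>Im p\<bar> < T n}. residue f p)) \<longlonglongrightarrow>
     (LINT t|lborel. f (Complex b t)) - (LINT t|lborel. f (Complex a t))"
proof -
  define I where "I = (\<lambda>c T. integral {-T..T} (\<lambda>t. f (Complex c t)))"
  define H where "H = (\<lambda>T. contour_integral (linepath (Complex a (-T)) (Complex b (-T))) f
     + contour_integral (linepath (Complex b T) (Complex a T)) f)"
  have ev: "\<forall>\<^sub>F n in sequentially. T n > 0" using T by (simp add: filterlim_at_top_dense)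
  have "\<forall>\<^sub>F n in sequentially. 2 * pi * (\<Sum>p\<in>{p \<in> P. \<bar>Im p\<bar> < T n}. residue f p) =
        (I b (T n) - I a (T n)) - \<i> * H (T n) \<and> norm (H (T n)) \<le> 2 * ((b - a) * e n)"
    using ev avoid bound
  proof eventually_elim
    case (elim n)
    define t where "t = T n"
    \<comment> \<open>\<open>S\<close> overshoots the rectangle by 1 in height to be an open set
      around it. Poles between the heights t and t + 1 thereby enter \<open>pts\<close>, but their
      winding number is 0.\<close>
    define S where "S = {z. a - \<eta> < Re z \<and> Re z < b + \<eta> \<and> - (t + 1) < Im z \<and> Im z < t + 1}"
    define pts where "pts = {p \<in> P. \<bar>Im p\<bar> < t + 1}"
    define g where "g = rectpath (Complex a (-t)) (Complex b t)"
    have t: "t > 0" using elim by (simp add: t_def)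
    have img: "path_image g \<subseteq> S - P"
    proof
      fix z assume z: "z \<in> path_image g"
      then have "a = Re z \<and> \<bar>Im z\<bar> \<le> t \<or> b = Re z \<and> \<bar>Im z\<bar> \<le> t \<or> \<bar>Im z\<bar> = t \<and> a \<le> Re z \<and> Re z \<le> b"
        using ab t unfolding g_def by (subst (asm) path_image_rectpath) auto
      then show "z \<in> S - P" using P elim(2) ab eta t unfolding S_def t_def by fastforce
    qed
    have Seq: "S = {z. Re z > a - \<eta>} \<inter> {z. Re z < b + \<eta>} \<inter> {z. Im z > - (t + 1)} \<inter> {z. Im z < t + 1}"
      by (auto simp: S_def)
    have "open S" unfolding Seq
      by (intro open_Int open_halfspace_Re_gt open_halfspace_Re_lt open_halfspace_Im_gt open_halfspace_Im_lt)
    moreover have "connected S" unfolding Seq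
      by (intro convex_connected convex_Int convex_halfspace_Re_gt convex_halfspace_Re_lt
          convex_halfspace_Im_gt convex_halfspace_Im_lt)
    moreover have holS: "f holomorphic_on S - pts"
      by (rule holomorphic_on_subset[OF hol]) (auto simp: S_def pts_def)
    moreover have "winding_number g z = 0" if "z \<notin> S" for z
      unfolding g_def using that ab eta t
      by (intro winding_number_rectpath_outside) (auto simp: S_def in_cbox_complex_iff)
    ultimately have "contour_integral g f = 2 * pi * \<i> * (\<Sum>p\<in>pts. winding_number g p * residue f p)"
      by (intro Residue_theorem) (use img fin in \<open>auto simp: pts_def g_def\<close>)
    also have "(\<Sum>p\<in>pts. winding_number g p * residue f p) = (\<Sum>p\<in>{p \<in> P. \<bar>Im p\<bar> < t}. residue f p)"
    proof (rule sum.mono_neutral_cong_right)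
      show "finite pts" using fin by (simp add: pts_def)
      show "{p \<in> P. \<bar>Im p\<bar> < t} \<subseteq> pts" by (auto simp: pts_def)
      show "\<forall>p\<in>pts - {p \<in> P. \<bar>Im p\<bar> < t}. winding_number g p * residue f p = 0"
      proof
        fix p assume p: "p \<in> pts - {p \<in> P. \<bar>Im p\<bar> < t}"
        then have "\<bar>Im p\<bar> > t" using elim(2) by (force simp: pts_def t_def)
        then have "winding_number g p = 0" unfolding g_def
          using ab t by (intro winding_number_rectpath_outside) (auto simp: in_cbox_complex_iff)
        then show "winding_number g p * residue f p = 0" by simp
      qed
      show "winding_number g p * residue f p = residue f p" if "p \<in> {p \<in> P. \<bar>Im p\<bar> < t}" for p
      proof -
        have "winding_number g p = 1" unfolding g_def
          by (rule winding_number_rectpath) (use that P in \<open>auto simp: in_box_complex_iff\<close>)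
        then show ?thesis by simp
      qed
    qed
    finally have 1: "contour_integral g f = 2 * pi * \<i> * (\<Sum>p\<in>{p \<in> P. \<bar>Im p\<bar> < t}. residue f p)" .
    have c: "continuous_on (path_image g) f"
      by (rule continuous_on_subset[OF holomorphic_on_imp_continuous_on[OF holS]])
         (use img in \<open>auto simp: pts_def\<close>)
    have "contour_integral g f = H t + \<i> * (I b t - I a t)"
      using contour_integral_rectpath[OF ab t c[unfolded g_def]] by (simp add: g_def H_def I_def)
    with 1 have "\<i> * (2 * pi * (\<Sum>p\<in>{p \<in> P. \<bar>Im p\<bar> < t}. residue f p)) = \<i> * ((I b t - I a t) - \<i> * H t)"
      by (simp add: algebra_simps)
    then have A: "2 * pi * (\<Sum>p\<in>{p \<in> P. \<bar>Im p\<bar> < t}. residue f p) = (I b t - I a t) - \<i> * H t"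
      using complex_i_not_zero mult_left_cancel by blast
    have e0: "e n \<ge> 0" using elim(3) ab norm_ge_zero order_trans by (metis atLeastAtMost_iff less_imp_le order_refl)
    have seg: "closed_segment (Complex a y) (Complex b y) = {z. Im z = y \<and> a \<le> Re z \<and> Re z \<le> b}" for y
      using ab by (subst closed_segment_same_Im) (auto simp: closed_segment_eq_real_ivl)
    have seg': "closed_segment (Complex b y) (Complex a y) = {z. Im z = y \<and> a \<le> Re z \<and> Re z \<le> b}" for y
      using seg by (simp add: closed_segment_commute)
    have cs: "continuous_on (closed_segment (Complex a y) (Complex b y)) f" if "\<bar>y\<bar> = t" for y
      by (rule continuous_on_subset[OF c])
         (use that ab t in \<open>auto simp: seg g_def path_image_rectpath\<close>)
    have len: "cmod (Complex b y - Complex a y) = b - a" "cmod (Complex a y - Complex b y) = b - a" for y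
      using ab by (auto simp: cmod_def)
    have "norm (contour_integral (linepath (Complex a (-t)) (Complex b (-t))) f) \<le> e n * cmod (Complex b (-t) - Complex a (-t))"
    proof (rule contour_integral_bound_linepath[OF contour_integrable_continuous_linepath[OF cs] e0])
      fix x assume "x \<in> closed_segment (Complex a (-t)) (Complex b (-t))"
      then have "Im x = -t" "Re x \<in> {a..b}" by (auto simp: seg)
      then show "norm (f x) \<le> e n" using elim(3) unfolding t_def by (metis complex_surj)
    qed (use t in auto)
    moreover have "norm (contour_integral (linepath (Complex b t) (Complex a t)) f) \<le> e n * cmod (Complex a t - Complex b t)"
    proof (rule contour_integral_bound_linepath[OF contour_integrable_continuous_linepath e0])
      show "continuous_on (closed_segment (Complex b t) (Complex a t)) f"
        using cs[of t] t by (simp add: closed_segment_commute)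
      fix x assume "x \<in> closed_segment (Complex b t) (Complex a t)"
      then have "Im x = t" "Re x \<in> {a..b}" by (auto simp: seg')
      then show "norm (f x) \<le> e n" using elim(3) unfolding t_def by (metis complex_surj)
    qed
    ultimately have "norm (H t) \<le> 2 * ((b - a) * e n)"
      unfolding H_def len by (intro norm_triangle_le) (simp add: algebra_simps)
    with A show ?case by (simp add: t_def)
  qed
  then have ev2: "\<forall>\<^sub>F n in sequentially. (I b (T n) - I a (T n)) - \<i> * H (T n) =
      2 * pi * (\<Sum>p\<in>{p \<in> P. \<bar>Im p\<bar> < T n}. residue f p)"
    and ev3: "\<forall>\<^sub>F n in sequentially. norm (H (T n)) \<le> 2 * ((b - a) * e n)"
    by (auto elim: eventually_mono)
  have "(\<lambda>n. 2 * ((b - a) * e n)) \<longlonglongrightarrow> 2 * ((b - a) * 0)" by (intro tendsto_intros e)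
  then have "(\<lambda>n. H (T n)) \<longlonglongrightarrow> 0"
    by (intro Lim_null_comparison[OF ev3]) simp
  moreover have "(\<lambda>n. I c (T n)) \<longlonglongrightarrow> (LINT t|lborel. f (Complex c t))" if "c \<in> {a, b}" for c
    unfolding I_def by (rule tendsto_integral_symmetric_interval[OF _ T]) (use int that in auto)
  ultimately have "(\<lambda>n. (I b (T n) - I a (T n)) - \<i> * H (T n)) \<longlonglongrightarrow>
      ((LINT t|lborel. f (Complex b t)) - (LINT t|lborel. f (Complex a t))) - \<i> * 0"
    by (intro tendsto_diff tendsto_mult tendsto_const) auto
  then show ?thesis
    using tendsto_cong[OF ev2] by simp
qed

text \<open>Exponential decay makes every height admissible, so the heights n + 1 are taken. The
  function need not be singular at \<open>p\<close>: a shift that meets no pole is the case of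
  residue 0.\<close>

lemma strip_single_pole:
  fixes f :: "complex \<Rightarrow> complex"
  assumes ab: "a < b" and eta: "\<eta> > 0" and p: "a < p" "p < b"
    and hol: "f holomorphic_on {z. a - \<eta> < Re z \<and> Re z < b + \<eta>} - {of_real p}"
    and c: "c > 0" and bound: "\<And>x t. x \<in> {a..b} \<Longrightarrow> 1 \<le> \<bar>t\<bar> \<Longrightarrow> norm (f (Complex x t)) \<le> C * exp (- c * \<bar>t\<bar>)"
    and int: "integrable lborel (\<lambda>t. f (Complex a t))" "integrable lborel (\<lambda>t. f (Complex b t))"
  shows "(LINT t|lborel. f (Complex b t)) - (LINT t|lborel. f (Complex a t)) = 2 * of_real pi * residue f (of_real p)"
proof -
  define T where "T = (\<lambda>n. real (Suc n))"
  have "(\<lambda>n. 2 * pi * (\<Sum>p\<in>{q \<in> {of_real p}. \<bar>Im q\<bar> < T n}. residue f p)) \<longlonglongrightarrow>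
      (LINT t|lborel. f (Complex b t)) - (LINT t|lborel. f (Complex a t))"
  proof (rule strip_residue_theorem[OF ab eta hol, where e = "\<lambda>n. C * exp (- c * T n)"])
    show "filterlim T at_top sequentially" unfolding T_def
      by (intro filterlim_compose[OF filterlim_real_sequentially] filterlim_Suc)
    show "(\<lambda>n. C * exp (- c * T n)) \<longlonglongrightarrow> 0"
      unfolding T_def using c by (intro tendsto_mult_right_zero) real_asymp
    show "\<forall>\<^sub>F n in sequentially. \<forall>x\<in>{a..b}.
        norm (f (Complex x (T n))) \<le> C * exp (- c * T n) \<and> norm (f (Complex x (- T n))) \<le> C * exp (- c * T n)"
    proof (intro always_eventually allI ballI)
      fix n x assume x: "x \<in> {a..b}"
      have "1 \<le> T n" by (simp add: T_def)
      then show "norm (f (Complex x (T n))) \<le> C * exp (- c * T n) \<and> norm (f (Complex x (- T n))) \<le> C * exp (- c * T n)"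
        using bound[OF x, of "T n"] bound[OF x, of "- T n"] by simp
    qed
  qed (use p int in \<open>auto simp: T_def\<close>)
  moreover have "{q \<in> {complex_of_real p}. \<bar>Im q\<bar> < T n} = {of_real p}" for n
    by (auto simp: T_def)
  ultimately have "(\<lambda>n::nat. 2 * of_real pi * residue f (of_real p)) \<longlonglongrightarrow>
      (LINT t|lborel. f (Complex b t)) - (LINT t|lborel. f (Complex a t))"
    by simp
  then show ?thesis by (rule LIMSEQ_unique[symmetric, OF tendsto_const])
qed

section \<open>The Gamma function and the Mellin inversion of the exponential\<close>

lemma integrable_exp_neg_abs:
  fixes c :: real
  assumes "c > 0"
  shows "integrable lborel (\<lambda>t. exp (- c * \<bar>t\<bar>))"
proof -
  define h where "h = (\<lambda>t::real. indicator {0..} t *\<^sub>R exp (- c * t))"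
  have "set_integrable lebesgue {0..} (\<lambda>t. exp (- c * t))"
    by (rule nonnegative_absolutely_integrable_1[OF integrable_on_exp_minus_to_infinity[OF assms]]) auto
  then have h: "integrable lborel h"
    unfolding h_def set_integrable_def by (subst (asm) integrable_completion) auto
  from lborel_integrable_real_affine[OF this, of "-1" 0]
  have h': "integrable lborel (\<lambda>t. h (- t))" by simp
  show ?thesis
    by (rule Bochner_Integration.integrable_bound[OF Bochner_Integration.integrable_add[OF h h']])
       (auto simp: h_def indicator_def abs_if)
qed

lemma integrable_exp_decay:
  fixes g :: "real \<Rightarrow> complex"
  assumes "continuous_on UNIV g" "c > 0" "\<And>t. norm (g t) \<le> C * exp (- c * \<bar>t\<bar>)"
  shows "integrable lborel g"
proof (rule Bochner_Integration.integrable_bound[where f = "\<lambda>t. C * exp (- c * \<bar>t\<bar>)"])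
  show "integrable lborel (\<lambda>t. C * exp (- c * \<bar>t\<bar>))"
    by (intro integrable_mult_right integrable_exp_neg_abs assms)
  show "g \<in> borel_measurable lborel"
    using borel_measurable_continuous_onI[OF assms(1)] by simp
  show "AE t in lborel. norm (g t) \<le> norm (C * exp (- c * \<bar>t\<bar>))"
    using assms(3) by (intro AE_I2) (metis abs_ge_self order_trans real_norm_def)
qed

lemma continuous_on_Complex_line [continuous_intros]: "continuous_on A (\<lambda>t. Complex c t)"
  unfolding Complex_eq by (intro continuous_intros)

lemma continuous_on_vertical_line:
  assumes "f holomorphic_on A" "\<And>t. Complex c t \<in> A"
  shows "continuous_on UNIV (\<lambda>t. f (Complex c t))"
  by (rule continuous_on_compose2[OF holomorphic_on_imp_continuous_on[OF assms(1)]])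
     (auto intro: continuous_on_Complex_line simp: assms)

section \<open>Exponential decay of the Gamma function in vertical strips\<close>

lemma not_nonpos_Int_if_Re_pos: "Re z > 0 \<Longrightarrow> z \<notin> \<int>\<^sub>\<le>\<^sub>0"
  by (auto elim!: nonpos_Ints_cases)

text \<open>The ratio of |Gamma(x + iy)| to Gamma(x) increases with x: in
  \<open>Gamma_series\<close> it is the product of the factors (x + k) / |x + k + iy|, and each of
  them increases with x.\<close>

lemma Gamma_series_norm_le:
  assumes "0 < x" "x \<le> x'"
  shows "norm (Gamma_series (Complex x y) n) * Gamma_series x' n
           \<le> Gamma_series x n * norm (Gamma_series (Complex x' y) n)"
proof -
  define p where "p = (\<lambda>z::complex. norm (pochhammer z (n + 1)))"
  define q where "q = (\<lambda>x::real. pochhammer x (n + 1))"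
  have q: "q x > 0" "q x' > 0" using assms by (auto simp: q_def intro: pochhammer_pos)
  have add: "Complex r y + of_nat i = Complex (r + real i) y" for r i
    by (simp add: complex_eq_iff)
  have pq: "p (Complex r y) = (\<Prod>i\<in>{0..<n + 1}. norm (Complex (r + real i) y))"
    "q r = (\<Prod>i\<in>{0..<n + 1}. r + real i)" for r
    unfolding p_def q_def pochhammer_prod prod_norm[symmetric] add by (rule refl)+
  have p: "p (Complex r y) > 0" if "r > 0" for r
    unfolding pq by (rule prod_pos) (use that in \<open>auto simp: complex_eq_iff\<close>)
  have "q x * p (Complex x' y) \<le> p (Complex x y) * q x'"
    unfolding pq prod.distrib[symmetric]
  proof (rule prod_mono, safe)
    fix i :: nat
    show "0 \<le> (x + real i) * norm (Complex (x' + real i) y)" using assms by simp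
    have "(x + real i)\<^sup>2 \<le> (x' + real i)\<^sup>2" using assms by (intro power_mono) auto
    then have "(x + real i)\<^sup>2 * y\<^sup>2 \<le> (x' + real i)\<^sup>2 * y\<^sup>2" by (intro mult_right_mono) auto
    then have "((x + real i) * norm (Complex (x' + real i) y))\<^sup>2 \<le> (norm (Complex (x + real i) y) * (x' + real i))\<^sup>2"
      by (simp add: power_mult_distrib cmod_power2) (simp add: algebra_simps)
    then show "(x + real i) * norm (Complex (x' + real i) y) \<le> norm (Complex (x + real i) y) * (x' + real i)"
      by (rule power2_le_imp_le) (use assms in auto)
  qed
  then have "inverse (p (Complex x y)) * inverse (q x') \<le> inverse (q x) * inverse (p (Complex x' y))"
    using p[of x] p[of x'] q assms by (simp add: field_simps)
  then have "(exp (x * ln n) * exp (x' * ln n) * (fact n)\<^sup>2) * (inverse (p (Complex x y)) * inverse (q x'))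
     \<le> (exp (x * ln n) * exp (x' * ln n) * (fact n)\<^sup>2) * (inverse (q x) * inverse (p (Complex x' y)))"
    by (rule mult_left_mono) auto
  then show ?thesis
    unfolding Gamma_series_def norm_mult norm_divide norm_fact norm_exp_eq_Re p_def q_def
    by (simp add: power2_eq_square field_simps)
qed

text \<open>In this form, decay of Gamma on one vertical line passes to all lines between it and the
  imaginary axis.\<close>

lemma norm_Gamma_le:
  assumes "0 < x" "x \<le> x'"
  shows "norm (Gamma (Complex x y)) * Gamma x' \<le> Gamma x * norm (Gamma (Complex x' y))"
  by (rule LIMSEQ_le[OF tendsto_mult[OF tendsto_norm[OF Gamma_series_LIMSEQ] Gamma_series_LIMSEQ]
        tendsto_mult[OF Gamma_series_LIMSEQ tendsto_norm[OF Gamma_series_LIMSEQ]]])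
     (use Gamma_series_norm_le[OF assms] in auto)

lemma norm_Gamma_one_le: "norm (Gamma (Complex 1 y)) \<le> 1"
proof -
  have "norm (Gamma_series (Complex 1 y) n) \<le> Gamma_series 1 n" for n
  proof -
    have "norm (Complex 1 y + of_nat i) \<ge> 1 + real i" for i
      using complex_Re_le_cmod[of "Complex 1 y + of_nat i"] by simp
    then have "(pochhammer 1 (n + 1) :: real) \<le> norm (pochhammer (Complex 1 y) (n + 1))"
      unfolding pochhammer_prod prod_norm[symmetric] by (intro prod_mono) auto
    then show ?thesis
      unfolding Gamma_series_def norm_divide norm_mult norm_exp_eq_Re
      by (intro frac_le) (auto intro: pochhammer_pos)
  qed
  then have "norm (Gamma (Complex 1 y)) \<le> Gamma 1"
    by (intro LIMSEQ_le[OF tendsto_norm[OF Gamma_series_LIMSEQ] Gamma_series_LIMSEQ]) auto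
  then show ?thesis by simp
qed

text \<open>The reflection formula gives |Gamma(1 + iy)|^2 = pi |y| / sinh(pi |y|). The surplus of
  pi over 2 in the exponent absorbs the factor |y|; for |y| < 1 the trivial bound 1
  suffices.\<close>

lemma norm_Gamma_one_line: "norm (Gamma (Complex 1 y)) \<le> 4 * exp (- \<bar>y\<bar>)"
proof (cases "\<bar>y\<bar> \<ge> 1")
  case False
  have "1 = exp \<bar>y\<bar> * exp (- \<bar>y\<bar>)" by (simp add: exp_minus)
  also have "\<dots> \<le> 3 * exp (- \<bar>y\<bar>)"
    using False exp_le exp_le_cancel_iff[of "\<bar>y\<bar>" 1]
    by (intro mult_right_mono) (linarith, simp)
  finally show ?thesis
    using norm_Gamma_one_le[of y] exp_ge_zero[of "- \<bar>y\<bar>"] by linarith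
next
  case y: True
  define z where "z = \<i> * complex_of_real y"
  have eq: "Complex 1 y = 1 + z" "cnj (1 + z) = 1 - z" by (auto simp: z_def complex_eq_iff)
  have "norm (Gamma (1 - z)) = norm (Gamma (1 + z))"
    using complex_mod_cnj cnj_Gamma eq(2) by metis
  then have "norm (Gamma (Complex 1 y))^2 = norm (Gamma (1 + z) * Gamma (1 - z))"
    by (simp add: norm_mult eq power2_eq_square)
  also have "Gamma (1 + z) = z * Gamma z"
  proof -
    have "z \<notin> \<int>\<^sub>\<le>\<^sub>0"
    proof
      assume "z \<in> \<int>\<^sub>\<le>\<^sub>0"
      then obtain n where "z = of_int n" by (rule nonpos_Ints_cases)
      then have "Im z = 0" by simp
      then show False using y by (simp add: z_def)
    qed
    then show ?thesis using Gamma_plus1[of z] by (simp add: add.commute)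
  qed
  also have "z * Gamma z * Gamma (1 - z) = z * (pi / sin (pi * z))"
    using Gamma_reflection_complex[of z] by (simp add: mult.assoc)
  also have "norm \<dots> = \<bar>y\<bar> * pi / norm (sin (pi * z))"
    by (simp add: norm_mult norm_divide z_def)
  also have "sin (pi * z) = \<i> * sinh (of_real (pi * y))"
  proof -
    have "pi * z = \<i> * of_real (pi * y)" by (simp add: z_def)
    then show ?thesis by (simp only: sinh_conv_sin) simp
  qed
  also have "norm (\<i> * sinh (complex_of_real (pi * y))) = sinh (pi * \<bar>y\<bar>)"
  proof -
    have "sinh (complex_of_real (pi * y)) = of_real (sinh (pi * y))"
      by (simp add: sinh_field_def flip: exp_of_real)
    moreover have "\<bar>sinh (pi * y)\<bar> = sinh \<bar>pi * y\<bar>" by (rule sinh_real_abs[symmetric])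
    ultimately show ?thesis by (simp only: norm_mult norm_of_real) (simp add: abs_mult)
  qed
  finally have 1: "norm (Gamma (Complex 1 y))^2 = \<bar>y\<bar> * pi / sinh (pi * \<bar>y\<bar>)" .
  have pi: "pi > 3" "pi < 4" using pi_gt3 pi_less_4 by auto
  have "exp (pi * \<bar>y\<bar>) * (1/2) \<le> exp (pi * \<bar>y\<bar>) - exp (- (pi * \<bar>y\<bar>))"
  proof -
    have "pi * \<bar>y\<bar> \<ge> 3 * 1" using pi y by (intro mult_mono) auto
    then have "exp (pi * \<bar>y\<bar>) \<ge> 1 + 3" using exp_ge_add_one_self[of "pi * \<bar>y\<bar>"] by linarith
    moreover have "exp (- (pi * \<bar>y\<bar>)) \<le> 1" using pi by simp
    ultimately show ?thesis by linarith
  qed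
  then have s: "sinh (pi * \<bar>y\<bar>) \<ge> exp (pi * \<bar>y\<bar>) / 4" by (simp add: sinh_field_def)
  have "\<bar>y\<bar> * pi / sinh (pi * \<bar>y\<bar>) \<le> \<bar>y\<bar> * 4 / (exp (pi * \<bar>y\<bar>) / 4)"
    using pi s by (intro frac_le mult_left_mono) auto
  also have "\<dots> = 16 * (\<bar>y\<bar> * exp (- (pi * \<bar>y\<bar>)))" by (simp add: exp_minus field_simps)
  also have "\<dots> \<le> 16 * (exp \<bar>y\<bar> * exp (- (3 * \<bar>y\<bar>)))"
  proof -
    have "\<bar>y\<bar> \<le> exp \<bar>y\<bar>" using exp_ge_add_one_self[of "\<bar>y\<bar>"] by linarith
    moreover have "exp (- (pi * \<bar>y\<bar>)) \<le> exp (- (3 * \<bar>y\<bar>))"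
      using pi by (simp add: mult_right_mono)
    ultimately show ?thesis by (intro mult_left_mono mult_mono) auto
  qed
  also have "\<dots> = (4 * exp (- \<bar>y\<bar>))^2"
    by (simp add: power2_eq_square flip: exp_add)
  finally have "norm (Gamma (Complex 1 y))^2 \<le> (4 * exp (- \<bar>y\<bar>))^2" using 1 by simp
  then show ?thesis by (rule power2_le_imp_le) auto
qed

text \<open>On Re z = 2 the recurrence costs a factor |1 + iy|, paid for with half of the decay
  exp(- |y|). \<open>norm_Gamma_le\<close> then moves to the left, where Gamma(x) is bounded on
  [\<delta>, 2].\<close>

lemma Gamma_strip_decay:
  assumes "\<delta> > 0"
  obtains C where "C > 0" "\<And>x y. x \<in> {\<delta>..2} \<Longrightarrow> norm (Gamma (Complex x y)) \<le> C * exp (- (1/2) * \<bar>y\<bar>)"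
proof -
  have "bounded (Gamma ` {\<delta>..2::real})"
    by (intro compact_imp_bounded compact_continuous_image continuous_intros)
       (use assms in \<open>auto elim!: nonpos_Ints_cases\<close>)
  then obtain B where B: "\<And>x. x \<in> {\<delta>..2} \<Longrightarrow> norm (Gamma x) \<le> B" unfolding bounded_iff by blast
  have "norm (Gamma (Complex x y)) \<le> (max 1 B * 8) * exp (- (1/2) * \<bar>y\<bar>)" if x: "x \<in> {\<delta>..2}" for x y
  proof -
    have z: "Complex 2 y = Complex 1 y + 1" "Complex 1 y \<notin> \<int>\<^sub>\<le>\<^sub>0"
      by (auto simp: complex_eq_iff intro!: not_nonpos_Int_if_Re_pos)
    have "norm (Complex 1 y) \<le> 1 + \<bar>y\<bar>" using cmod_le[of "Complex 1 y"] by simp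
    also have "\<dots> \<le> 2 * (1 + \<bar>y\<bar> / 2)" by simp
    also have "\<dots> \<le> 2 * exp (\<bar>y\<bar> / 2)"
      using exp_ge_add_one_self[of "\<bar>y\<bar> / 2"] by (intro mult_left_mono) auto
    finally have n: "norm (Complex 1 y) \<le> 2 * exp (\<bar>y\<bar> / 2)" .
    have G2: "Gamma (2::real) = 1" using Gamma_fact[of 1, where ?'a = real] by simp
    have "norm (Gamma (Complex 2 y)) = norm (Complex 1 y) * norm (Gamma (Complex 1 y))"
      unfolding z(1) Gamma_plus1[OF z(2)] by (simp add: norm_mult)
    also have "\<dots> \<le> (2 * exp (\<bar>y\<bar> / 2)) * (4 * exp (- \<bar>y\<bar>))"
      by (intro mult_mono n norm_Gamma_one_line) auto
    also have "\<dots> = 8 * exp (- (1/2) * \<bar>y\<bar>)" by (simp flip: exp_add)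
    finally have "norm (Gamma (Complex 2 y)) \<le> 8 * exp (- (1/2) * \<bar>y\<bar>)" .
    then have "Gamma x * norm (Gamma (Complex 2 y)) \<le> max 1 B * (8 * exp (- (1/2) * \<bar>y\<bar>))"
      using B[OF x] by (intro mult_mono) auto
    then show ?thesis
      using norm_Gamma_le[of x 2 y] x assms G2 by simp
  qed
  then show thesis by (intro that[of "max 1 B * 8"]) auto
qed

section \<open>Mellin inversion of exp(- y) by shifting the line to the left\<close>

lemma norm_exp_line: "norm (exp (- (Complex c t) * of_real l)) = exp (- c * l)"
  by (simp add: norm_exp_eq_Re)

text \<open>By the recurrence this is Gamma(z) exp(- z l) for every \<open>k\<close>. The poles 0,
  -1, ..., -(k - 1) are explicit in the denominator, and for Re z > - k the Gamma function is
  evaluated only in the right half-plane.\<close>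

definition mellin_exp :: "nat \<Rightarrow> real \<Rightarrow> complex \<Rightarrow> complex" where
  "mellin_exp k l z = Gamma (z + of_nat k) / pochhammer z k * exp (- z * of_real l)"

lemma mellin_exp_Suc:
  assumes "z + of_nat k \<notin> \<int>\<^sub>\<le>\<^sub>0"
  shows "mellin_exp (Suc k) l z = mellin_exp k l z"
proof -
  have "Gamma (z + of_nat (Suc k)) = (z + of_nat k) * Gamma (z + of_nat k)"
    using Gamma_plus1[OF assms] by (simp add: add_ac)
  moreover have "z + of_nat k \<noteq> 0" using assms by auto
  ultimately show ?thesis
    by (simp add: mellin_exp_def pochhammer_Suc)
qed

lemma holomorphic_mellin_exp:
  assumes "\<And>z. z \<in> A \<Longrightarrow> Re z > - real k" "\<And>z j. z \<in> A \<Longrightarrow> j < k \<Longrightarrow> z \<noteq> - of_nat j"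
  shows "mellin_exp k l holomorphic_on A"
proof -
  have 1: "z + of_nat k \<notin> \<int>\<^sub>\<le>\<^sub>0" if "z \<in> A" for z
    using assms(1)[OF that] by (intro not_nonpos_Int_if_Re_pos) simp
  have "z + of_nat i \<noteq> 0" if "z \<in> A" "i < k" for z i
    using assms(2)[OF that] by (metis add_eq_0_iff2)
  then have 2: "(\<Prod>i = 0..<k. z + of_nat i) \<noteq> 0" if "z \<in> A" for z
    using that by simp
  show ?thesis
    unfolding mellin_exp_def pochhammer_prod
    by (intro holomorphic_intros 1 2) auto
qed

lemma norm_mellin_exp_le:
  assumes C: "\<And>x y. x \<in> {1/16..2} \<Longrightarrow> norm (Gamma (Complex x y)) \<le> C * exp (- (1/2) * \<bar>y\<bar>)"
    and x: "x + real k \<in> {1/16..2}" and P: "norm (pochhammer (Complex x t) k) \<ge> P" "P > 0"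
  shows "norm (mellin_exp k l (Complex x t)) \<le> C / P * exp (- x * l) * exp (- (1/2) * \<bar>t\<bar>)"
proof -
  have "Complex x t + of_nat k = Complex (x + real k) t" by (simp add: complex_eq_iff)
  then have "norm (Gamma (Complex x t + of_nat k)) \<le> C * exp (- (1/2) * \<bar>t\<bar>)"
    using C[OF x] by simp
  moreover from this have "0 \<le> C * exp (- (1/2) * \<bar>t\<bar>)" by (rule order_trans[OF norm_ge_zero])
  ultimately have "norm (Gamma (Complex x t + of_nat k) / pochhammer (Complex x t) k) \<le> C * exp (- (1/2) * \<bar>t\<bar>) / P"
    unfolding norm_divide using P by (intro frac_le) auto
  then have "norm (mellin_exp k l (Complex x t)) \<le> C * exp (- (1/2) * \<bar>t\<bar>) / P * exp (- x * l)"
    unfolding mellin_exp_def norm_mult norm_exp_line by (rule mult_right_mono) auto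
  then show ?thesis by (simp add: mult_ac)
qed

text \<open>The i-th factor has a real part of absolute value k - i - 1/8, which is at least (k - i)
  / 2. The resulting factorial makes the integrals over lines further and further left tend to
  0.\<close>

lemma norm_pochhammer_line_ge: "norm (pochhammer (Complex (1/8 - real k) t) k) \<ge> fact k / 2 ^ k"
proof -
  have "(\<Prod>i=0..<k. real (k - i) / 2) \<le> (\<Prod>i=0..<k. norm (Complex (1/8 - real k) t + of_nat i))"
  proof (rule prod_mono, safe)
    fix i assume "i \<in> {0..<k}"
    then have "real (k - i) / 2 \<le> \<bar>Re (Complex (1/8 - real k) t + of_nat i)\<bar>"
      by (simp add: of_nat_diff)
    then show "real (k - i) / 2 \<le> norm (Complex (1/8 - real k) t + of_nat i)"
      using abs_Re_le_cmod order_trans by blast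
  qed auto
  moreover have "(\<Prod>i=0..<k. real (k - i) / 2) = fact k / 2 ^ k"
    by (simp add: prod_dividef fact_prod_rev)
  ultimately show ?thesis by (simp add: pochhammer_prod prod_norm)
qed

lemma mellin_exp_integrable:
  shows "integrable lborel (\<lambda>t. mellin_exp k l (Complex (1/8 - real k) t))" (is ?I)
  and "\<exists>C>0. \<forall>k. norm (LINT t|lborel. mellin_exp k l (Complex (1/8 - real k) t)) \<le> C * ((2 * exp l) ^ k / fact k)" (is ?B)
proof -
  obtain C where C: "C > 0" "\<And>x y. x \<in> {1/16..2} \<Longrightarrow> norm (Gamma (Complex x y)) \<le> C * exp (- (1/2) * \<bar>y\<bar>)"
    using Gamma_strip_decay[of "1/16"] by auto
  have B: "norm (mellin_exp k l (Complex (1/8 - real k) t)) \<le>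
      C / (fact k / 2 ^ k) * exp (- (1/8 - real k) * l) * exp (- (1/2) * \<bar>t\<bar>)" for k t
    by (rule norm_mellin_exp_le[OF C(2) _ norm_pochhammer_line_ge]) auto
  have I: "integrable lborel (\<lambda>t. mellin_exp k l (Complex (1/8 - real k) t))" for k
  proof (rule integrable_exp_decay[OF _ _ B])
    show "continuous_on UNIV (\<lambda>t. mellin_exp k l (Complex (1 / 8 - real k) t))"
    proof (rule continuous_on_vertical_line[OF holomorphic_mellin_exp])
      show "Complex (1 / 8 - real k) t \<in> {z. Re z = 1 / 8 - real k}" for t by simp
      fix z :: complex and j assume "z \<in> {z. Re z = 1 / 8 - real k}" "j < k"
      then show "z \<noteq> - of_nat j" by auto
    qed auto
  qed auto
  then show ?I .
  define J where "J = (LINT t|lborel. exp (- (1/2) * \<bar>t::real\<bar>))"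
  have "norm (LINT t|lborel. mellin_exp k l (Complex (1/8 - real k) t)) \<le>
     (C * exp (- l/8) * (1 + \<bar>J\<bar>)) * ((2 * exp l) ^ k / fact k)" for k
  proof -
    have "norm (LINT t|lborel. mellin_exp k l (Complex (1/8 - real k) t)) \<le>
       (LINT t|lborel. C / (fact k / 2 ^ k) * exp (- (1/8 - real k) * l) * exp (- (1/2) * \<bar>t\<bar>))"
      by (rule Bochner_Integration.integral_norm_bound_integral[OF I _ B])
         (intro integrable_mult_right integrable_exp_neg_abs, simp)
    also have "\<dots> = C / (fact k / 2 ^ k) * exp (- (1/8 - real k) * l) * J"
      unfolding J_def by simp
    also have "\<dots> \<le> C / (fact k / 2 ^ k) * exp (- (1/8 - real k) * l) * (1 + \<bar>J\<bar>)"
      using C by (intro mult_left_mono) auto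
    also have "exp (- (1/8 - real k) * l) = exp (- l/8) * exp l ^ k"
    proof -
      have "- (1/8 - real k) * l = - l/8 + real k * l" by (simp add: algebra_simps)
      then show ?thesis by (simp only: exp_add exp_of_nat_mult)
    qed
    finally show ?thesis by (simp add: power_mult_distrib field_simps)
  qed
  then show ?B using C by (intro exI[of _ "C * exp (- l/8) * (1 + \<bar>J\<bar>)"]) auto
qed

text \<open>Moving the line by 1 crosses only the pole at - k, whose residue is the k-th term of the
  series of exp(- e^l). The index \<open>Suc k\<close> is used on both lines because it exhibits
  this pole; on the right line it agrees with the index \<open>k\<close>.\<close>

lemma mellin_exp_shift:
  fixes k :: nat and l :: real
  shows "(LINT t|lborel. mellin_exp k l (Complex (1/8 - real k) t)) -
     (LINT t|lborel. mellin_exp (Suc k) l (Complex (1/8 - real (Suc k)) t))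
     = of_real (2 * pi * ((-1) ^ k / fact k * exp (real k * l)))"
proof -
  define a b f where "a = 1/8 - real (Suc k)" "b = 1/8 - real k" "f = mellin_exp (Suc k) l"
  obtain C where C: "C > 0" "\<And>x y. x \<in> {1/16..2} \<Longrightarrow> norm (Gamma (Complex x y)) \<le> C * exp (- (1/2) * \<bar>y\<bar>)"
    using Gamma_strip_decay[of "1/16"] by auto
  have fb: "f (Complex b t) = mellin_exp k l (Complex b t)" for t
    unfolding a_b_f_def by (intro mellin_exp_Suc not_nonpos_Int_if_Re_pos) simp
  have "(LINT t|lborel. f (Complex b t)) - (LINT t|lborel. f (Complex a t)) = 2 * of_real pi * residue f (of_real (- real k))"
  proof (rule strip_single_pole[where \<eta> = "1/16" and c = "1/2" and C = "C / 1 * (exp (- a * l) + exp (- b * l))"])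
    show "f holomorphic_on {z. a - 1 / 16 < Re z \<and> Re z < b + 1 / 16} - {of_real (- real k)}"
      unfolding a_b_f_def
    proof (rule holomorphic_mellin_exp)
      fix z :: complex and j assume z: "z \<in> {z. 1/8 - real (Suc k) - 1 / 16 < Re z \<and> Re z < 1/8 - real k + 1 / 16} - {of_real (- real k)}" "j < Suc k"
      show "z \<noteq> - of_nat j"
      proof
        assume "z = - of_nat j"
        then have "real j > real k - 1 / 4" "j \<noteq> k" using z by auto
        then show False using z by linarith
      qed
    qed auto
    fix x t :: real assume x: "x \<in> {a..b}" and t: "1 \<le> \<bar>t\<bar>"
    have "norm (Complex x t + of_nat i) \<ge> 1" for i
      using abs_Im_le_cmod[of "Complex x t + of_nat i"] t by simp
    then have P: "norm (pochhammer (Complex x t) (Suc k)) \<ge> 1"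
      unfolding pochhammer_prod prod_norm[symmetric] by (intro prod_ge_1) auto
    have "norm (f (Complex x t)) \<le> C / 1 * exp (- x * l) * exp (- (1/2) * \<bar>t\<bar>)"
      unfolding a_b_f_def by (rule norm_mellin_exp_le[OF C(2) _ P]) (use x in \<open>auto simp: a_b_f_def\<close>)
    \<comment> \<open>The direction in which exp(- x l) varies with x depends on the sign of
      \<open>l\<close>; the sum of the two endpoint values covers both cases.\<close>
    also have "exp (- x * l) \<le> exp (- a * l) + exp (- b * l)"
    proof (cases "l \<ge> 0")
      case True
      then have "exp (- x * l) \<le> exp (- a * l)" using x by (auto intro: mult_right_mono)
      then show ?thesis by (simp add: add_increasing2)
    next
      case False
      then have "exp (- x * l) \<le> exp (- b * l)" using x by (auto intro: mult_right_mono_neg)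
      then show ?thesis by (simp add: add_increasing)
    qed
    finally show "norm (f (Complex x t)) \<le> C / 1 * (exp (- a * l) + exp (- b * l)) * exp (- (1/2) * \<bar>t\<bar>)"
      using C(1) by simp
  next
    show "integrable lborel (\<lambda>t. f (Complex a t))" "integrable lborel (\<lambda>t. f (Complex b t))"
      unfolding fb using mellin_exp_integrable(1)[of "Suc k" l] mellin_exp_integrable(1)[of k l]
      by (simp_all add: a_b_f_def)
  qed (auto simp: a_b_f_def)
  moreover have "residue f (- of_nat k) = of_real ((-1) ^ k / fact k * exp (real k * l))"
  proof -
    \<comment> \<open>\<open>g\<close> is \<open>f\<close> with the factor z + k of the denominator
      removed, hence holomorphic near - k, and its value there is the residue.\<close>
    define g where "g = (\<lambda>z::complex. Gamma (z + of_nat (Suc k)) / pochhammer z k * exp (- z * of_real l))"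
    define A where "A = ball (- of_nat k :: complex) (1/2)"
    have A: "\<bar>Re z + real k\<bar> < 1/2" if "z \<in> A" for z
      using that abs_Re_le_cmod[of "z - (- of_nat k)"] by (simp add: A_def dist_norm norm_minus_commute)
    have 1: "z + of_nat (Suc k) \<notin> \<int>\<^sub>\<le>\<^sub>0" if "z \<in> A" for z
    proof (rule not_nonpos_Int_if_Re_pos)
      have "Re z + real k > - (1/2)" using A[OF that] by linarith
      then show "Re (z + of_nat (Suc k)) > 0" by simp
    qed
    have "z + of_nat i \<noteq> 0" if "z \<in> A" "i < k" for z i
    proof
      assume "z + of_nat i = 0"
      then have "Re z = - real i" by (simp add: complex_eq_iff)
      then show False using A[OF that(1)] that(2) by simp
    qed
    then have 2: "(\<Prod>i = 0..<k. z + of_nat i) \<noteq> 0" if "z \<in> A" for z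
      using that by simp
    have "g holomorphic_on A"
      unfolding g_def pochhammer_prod by (intro holomorphic_intros 1 2) auto
    then have "residue (\<lambda>w. g w / (w - (- of_nat k))) (- of_nat k) = g (- of_nat k)"
      by (intro residue_simple[of A]) (auto simp: A_def)
    also have "(\<lambda>w. g w / (w - (- of_nat k))) = f"
      by (simp add: fun_eq_iff g_def a_b_f_def mellin_exp_def pochhammer_Suc divide_simps)
    also have "g (- of_nat k) = of_real ((-1) ^ k / fact k * exp (real k * l))"
    proof -
      have "pochhammer (- of_nat k :: complex) k = (-1) ^ k * fact k"
        by (simp add: pochhammer_minus pochhammer_fact)
      then show ?thesis
        by (simp add: g_def exp_of_real[symmetric] minus_one_power_iff)
    qed
    finally show ?thesis .
  qed
  ultimately show ?thesis unfolding fb by (simp add: a_b_f_def)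
qed

text \<open>The shifts telescope to the exponential series of - e^l, because the integrals on the
  far left vanish in the limit. The abscissa 1/8 is the real part of (1 - s) / 2 on the line Re s =
  3/4.\<close>

theorem cahen_mellin:
  "(LINT t|lborel. Gamma (Complex (1/8) t) * exp (- (Complex (1/8) t) * of_real l)) = 2 * pi * exp (- exp l)"
proof -
  define G where "G = (\<lambda>k. LINT t|lborel. mellin_exp k l (Complex (1/8 - real k) t))"
  obtain C where C: "\<And>k. norm (G k) \<le> C * ((2 * exp l) ^ k / fact k)"
    using mellin_exp_integrable(2)[of l] by (auto simp: G_def)
  have "(\<lambda>k. C * ((2 * exp l) ^ k / fact k)) \<longlonglongrightarrow> C * 0"
    using summable_LIMSEQ_zero[OF summable_exp_generic[of "2 * exp l"]]
    by (intro tendsto_mult tendsto_const) (simp add: scaleR_conv_of_real field_simps)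
  then have G0: "G \<longlonglongrightarrow> 0"
    by (intro Lim_null_comparison[OF always_eventually[OF allI[OF C]]]) simp
  have "(\<lambda>k. G k - G (Suc k)) sums (G 0 - 0)"
    by (rule telescope_sums'[OF G0])
  moreover have "G k - G (Suc k) = of_real (2 * pi * (inverse (fact k) *\<^sub>R (- exp l) ^ k))" for k
  proof -
    have "(- exp l) ^ k = (-1) ^ k * exp (real k * l)"
      by (simp add: exp_of_nat_mult power_minus[of "exp l"])
    then have "2 * pi * ((-1) ^ k / fact k * exp (real k * l)) = 2 * pi * (inverse (fact k) *\<^sub>R (- exp l) ^ k)"
      by (simp add: divide_inverse mult_ac)
    then show ?thesis
      using mellin_exp_shift[of k l] by (simp only: G_def)
  qed
  ultimately have "(\<lambda>k. of_real (2 * pi * (inverse (fact k) *\<^sub>R (- exp l) ^ k))) sums G 0" by simp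
  moreover have "(\<lambda>k. of_real (2 * pi * (inverse (fact k) *\<^sub>R (- exp l) ^ k))) sums complex_of_real (2 * pi * exp (- exp l))"
    by (intro sums_of_real sums_mult exp_converges)
  ultimately have "G 0 = complex_of_real (2 * pi * exp (- exp l))" by (rule sums_unique2)
  then show ?thesis by (simp add: G_def mellin_exp_def)
qed

section \<open>The functional equation of the zeta function\<close>

lemma norm_powr_le:
  fixes z w :: complex
  assumes "z \<noteq> 0"
  shows "norm (z powr w) \<le> norm z powr Re w * exp (pi * \<bar>Im w\<bar>)"
proof -
  have "\<bar>Im (Ln z)\<bar> \<le> pi" using mpi_less_Im_Ln[OF assms] Im_Ln_le_pi[OF assms] by linarith
  then have "\<bar>Im w * Im (Ln z)\<bar> \<le> pi * \<bar>Im w\<bar>"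
    unfolding abs_mult using mult_left_mono[of "\<bar>Im (Ln z)\<bar>" pi "\<bar>Im w\<bar>"] by (simp add: mult.commute)
  then have "Re (w * Ln z) \<le> Re w * ln (norm z) + pi * \<bar>Im w\<bar>"
    using Re_Ln[OF assms] by simp
  then have "exp (Re (w * Ln z)) \<le> exp (Re w * ln (norm z)) * exp (pi * \<bar>Im w\<bar>)"
    by (simp flip: exp_add)
  then show ?thesis using assms by (simp add: powr_def norm_exp_eq_Re)
qed

text \<open>This is ln(x / m) <= x / m - 1, multiplied by m and exponentiated.\<close>

lemma powr_le_exp:
  fixes x m :: real
  assumes "x > 0" "m > 0"
  shows "x powr m \<le> m powr m * exp x"
proof -
  have "ln (x / m) \<le> x / m - 1" using assms by (intro ln_le_minus_one) auto
  then have "m * ln (x / m) \<le> x - m" using assms mult_left_mono[of _ _ m] by (fastforce simp: field_simps)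
  then have "m * ln x \<le> m * ln m + x" using assms by (simp add: ln_div algebra_simps)
  then have "exp (m * ln x) \<le> exp (m * ln m) * exp x" by (simp flip: exp_add)
  then show ?thesis using assms by (simp add: powr_def)
qed

text \<open>With z = \<open>Complex c t\<close>, the quantity \<open>y\<close> dominates both |z|
  and 1/|z|, which handles exponents with real part of either sign. Growth of rate 2 in |t| is
  harmless against the rate 6 of the squared sine in the kernel.\<close>

lemma powr_line_bound:
  fixes R B :: real
  assumes "R > 0" "1 \<le> B" "c \<in> {0..B}" "norm (Complex c t) \<ge> 1/2" "norm w \<le> R"
  shows "norm (Complex c t powr w) \<le> R powr R * exp (2 * B) * exp (pi * R) * exp (2 * \<bar>t\<bar>)"
proof -
  define x where "x = norm (Complex c t)"
  define y where "y = 2 * (B + \<bar>t\<bar>)"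
  have x: "x \<ge> 1/2" "x > 0" "Complex c t \<noteq> 0" using assms by (auto simp: x_def)
  have "x \<le> y" using cmod_le[of "Complex c t"] assms by (simp add: x_def y_def)
  have y2: "y \<ge> 2" using assms by (simp add: y_def)
  then have "1 / y \<le> x" using x by (intro order_trans[OF _ x(1)]) (simp add: field_simps)
  then have "inverse x \<le> y" using x y2 by (simp add: field_simps)
  have "\<bar>ln x\<bar> \<le> ln y"
  proof -
    have "ln x \<le> ln y" using \<open>x \<le> y\<close> x y2 by simp
    moreover have "ln (inverse x) \<le> ln y" using \<open>inverse x \<le> y\<close> x y2 by simp
    ultimately show ?thesis using x by (simp add: ln_inverse)
  qed
  then have "\<bar>Re w\<bar> * \<bar>ln x\<bar> \<le> R * ln y"
    using abs_Re_le_cmod[of w] assms by (intro mult_mono) auto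
  then have "Re w * ln x \<le> R * ln y" using abs_ge_self[of "Re w * ln x"] by (simp add: abs_mult)
  then have "x powr Re w \<le> y powr R" using x y2 by (simp add: powr_def)
  also have "\<dots> \<le> R powr R * exp y" using y2 assms by (intro powr_le_exp) auto
  finally have 1: "x powr Re w \<le> R powr R * exp y" .
  have "pi * \<bar>Im w\<bar> \<le> pi * R" using abs_Im_le_cmod[of w] assms by (intro mult_left_mono) auto
  then have "norm (Complex c t powr w) \<le> (R powr R * exp y) * exp (pi * R)"
    using norm_powr_le[OF x(3), of w] 1 unfolding x_def
    by (elim order_trans) (intro mult_mono, auto)
  also have "exp y = exp (2 * B) * exp (2 * \<bar>t\<bar>)" by (simp add: y_def algebra_simps flip: exp_add)
  finally show ?thesis by (simp add: mult_ac)
qed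

definition sin2 :: "real \<Rightarrow> real \<Rightarrow> real" where
  "sin2 c t = (norm (sin (of_real pi * Complex c t)))\<^sup>2"

lemma sin2_eq: "sin2 c t = (sin (pi * c))\<^sup>2 + (sinh (pi * t))\<^sup>2"
proof -
  have e: "exp (2 * (pi * t)) = (exp (pi * t))\<^sup>2" by (simp add: power2_eq_square flip: exp_add)
  show ?thesis
    unfolding sin2_def norm_sin_squared by (simp add: cos_double_sin sinh_field_def e exp_minus)
      (simp add: field_simps power2_eq_square)
qed

text \<open>The exponent 6 is 2 pi rounded down; the constant 400 is generous.\<close>

lemma sinh_sq_ge:
  assumes "\<bar>t\<bar> \<ge> 1/2"
  shows "(sinh (pi * t))\<^sup>2 \<ge> exp (6 * \<bar>t\<bar>) / 400"
proof -
  define x where "x = pi * \<bar>t\<bar>"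
  have x: "x \<ge> 3 * \<bar>t\<bar>" unfolding x_def using pi_gt3 by (intro mult_right_mono) auto
  then have x1: "x \<ge> 1" using assms by linarith
  have "exp x \<ge> 1 + x" by (rule exp_ge_add_one_self)
  then have "exp x \<ge> 2" using x1 by linarith
  moreover have "exp (- x) \<le> 1" using x1 by simp
  moreover have "u / 4 \<le> (u - v) / 2" if "2 \<le> u" "v \<le> 1" for u v :: real
    using that by (simp add: field_simps)
  ultimately have "exp x / 4 \<le> (exp x - exp (- x)) / 2" by blast
  also have "\<dots> = sinh x" by (simp add: sinh_field_def)
  finally have "sinh x \<ge> exp x / 4" .
  then have "(exp x / 4)\<^sup>2 \<le> (sinh x)\<^sup>2" by (intro power_mono) auto
  also have "(sinh x)\<^sup>2 = (sinh (pi * t))\<^sup>2" by (cases "t \<ge> 0") (auto simp: x_def)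
  also have "(exp x / 4)\<^sup>2 = exp (2 * x) / 16"
    by (simp add: power_divide power2_eq_square flip: exp_add)
  finally have 1: "exp (2 * x) / 16 \<le> (sinh (pi * t))\<^sup>2" .
  have "exp (6 * \<bar>t\<bar>) \<le> exp (2 * x)" using x by simp
  then have "exp (6 * \<bar>t\<bar>) / 400 \<le> exp (2 * x) / 16" using exp_ge_zero[of "2*x"] by linarith
  with 1 show ?thesis by linarith
qed

lemma sin2_ge: "\<bar>t\<bar> \<ge> 1/2 \<Longrightarrow> sin2 c t \<ge> exp (6 * \<bar>t\<bar>) / 400"
  unfolding sin2_eq using sinh_sq_ge[of t] zero_le_power2[of "sin (pi * c)"] by linarith

text \<open>On these lines sin(pi c)^2 = 1, which takes care of small |t|.\<close>

lemma sin2_half_ge: "sin2 (real N + 1/2) t \<ge> exp (6 * \<bar>t\<bar>) / 400"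
proof (cases "\<bar>t\<bar> \<ge> 1/2")
  case False
  have "sin (pi * (real N + 1/2)) = cos (pi * real N)"
    using sin_add[of "pi * real N" "pi/2"] by (simp add: algebra_simps)
  then have "(sin (pi * (real N + 1/2)))\<^sup>2 = 1"
    by (simp add: mult.commute[of pi] cos_npi flip: power_mult)
  then have "sin2 (real N + 1/2) t \<ge> 1" unfolding sin2_eq by simp
  moreover have "exp (6 * \<bar>t\<bar>) \<le> exp 3" using False by simp
  moreover have "exp (3::real) = (exp 1)^3" using exp_of_nat_mult[of 3 "1::real"] by simp
  moreover have "(exp 1)^3 \<le> (3::real)^3" using exp_le by (intro power_mono) auto
  ultimately show ?thesis by simp
qed (rule sin2_ge)

text \<open>Near the origin this replaces the exponential lower bound, which fails there as
  \<open>c\<close> tends to 0: the double zero of the squared sine is compared with |z|^2.\<close>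

lemma sin2_ge_norm:
  assumes "0 < c" "c \<le> 1/4"
  shows "sin2 c t \<ge> (norm (Complex c t))\<^sup>2"
proof -
  have "sin (pi * c) \<ge> c"
  proof -
    have cp: "pi * c \<le> pi / 4" "pi * c \<ge> 3 * c" "pi * c > 0"
      using assms pi_gt3 by (auto intro: mult_right_mono)
    obtain z where z: "0 < z" "z < pi * c" "sin (pi * c) - sin 0 = (pi * c - 0) * cos z"
      using MVT2[of 0 "pi * c" sin cos] cp DERIV_sin by auto
    \<comment> \<open>The intermediate point lies below pi/4, so its cosine is at least 1/2, and
      half of pi c is still at least c.\<close>
    have "z \<le> pi / 3" using z(2) cp(1) pi_gt_zero by linarith
    then have "cos z \<ge> cos (pi / 3)" using z by (intro cos_monotone_0_pi_le) auto
    then have "(pi * c) * (1/2) \<le> (pi * c) * cos z"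
      using cp(3) by (intro mult_left_mono) (auto simp: cos_60)
    then have "sin (pi * c) \<ge> (pi * c) * (1/2)" using z(3) by simp
    then show ?thesis using cp assms by linarith
  qed
  then have "c\<^sup>2 \<le> (sin (pi * c))\<^sup>2" using assms by (intro power_mono) auto
  moreover have "t\<^sup>2 \<le> (sinh (pi * t))\<^sup>2"
  proof -
    have "\<bar>t\<bar> \<le> \<bar>pi * t\<bar>" using pi_gt3 by (simp add: abs_mult mult_le_cancel_right1)
    also have "\<dots> \<le> sinh \<bar>pi * t\<bar>"
    proof -
      have "x \<le> sinh x" if "x \<ge> 0" for x :: real
      proof -
        have "(\<lambda>x. sinh x - x) 0 \<le> (\<lambda>x. sinh x - x) x"
        proof (rule DERIV_nonneg_imp_nondecreasing[OF that])
          fix u :: real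
          show "\<exists>y. ((\<lambda>x. sinh x - x) has_real_derivative y) (at u) \<and> 0 \<le> y"
            by (rule exI[of _ "cosh u - 1"]) (auto intro!: derivative_eq_intros cosh_real_ge_1)
        qed
        then show ?thesis by simp
      qed
      from this[of "\<bar>pi * t\<bar>"] show ?thesis by simp
    qed
    also have "\<dots> = \<bar>sinh (pi * t)\<bar>" by (rule sinh_real_abs)
    finally show ?thesis by (simp only: abs_le_square_iff)
  qed
  ultimately show ?thesis unfolding sin2_eq by (simp add: cmod_power2)
qed

text \<open>This kernel has double poles at the positive integers with residues
  proportional to \<open>n powr (- s)\<close>. Moving the line \<open>Re z = 1/2\<close> to the right therefore gives \<open>\<zeta>(s)\<close> for
  \<open>Re s > 1\<close>; moving it to the imaginary axis gives the functional equation for \<open>Re s < -1\<close>.\<close>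

definition zeta_kernel :: "complex \<Rightarrow> complex \<Rightarrow> complex" where
  "zeta_kernel s z = z powr (1 - s) / (sin (of_real pi * z))\<^sup>2"

section \<open>Estimates for the kernel and its residues\<close>

lemma norm_zeta_kernel: "norm (zeta_kernel s (Complex c t)) = norm (Complex c t powr (1 - s)) / sin2 c t"
  by (simp add: zeta_kernel_def norm_divide norm_power sin2_def)

lemma zeta_kernel_bound:
  assumes "R > 0" "1 \<le> B" "c \<in> {0..B}" "norm (Complex c t) \<ge> 1/2" "norm (1 - s) \<le> R"
    and "sin2 c t \<ge> exp (6 * \<bar>t\<bar>) / 400"
  shows "norm (zeta_kernel s (Complex c t)) \<le> 400 * (R powr R * exp (2 * B) * exp (pi * R)) * exp (- 4 * \<bar>t\<bar>)"
proof -
  have "norm (zeta_kernel s (Complex c t)) \<le> (R powr R * exp (2 * B) * exp (pi * R) * exp (2 * \<bar>t\<bar>)) / (exp (6 * \<bar>t\<bar>) / 400)"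
    unfolding norm_zeta_kernel by (intro frac_le powr_line_bound assms) auto
  also have "\<dots> = 400 * (R powr R * exp (2 * B) * exp (pi * R)) * (exp (2 * \<bar>t\<bar>) / exp (6 * \<bar>t\<bar>))" by simp
  also have "exp (2 * \<bar>t\<bar>) / exp (6 * \<bar>t\<bar>) = exp (- 4 * \<bar>t\<bar>)" by (simp flip: exp_diff)
  finally show ?thesis .
qed

lemma zeta_kernel_half_bound:
  assumes "R > 0" "norm (1 - s) \<le> R"
  shows "norm (zeta_kernel s (Complex (real N + 1/2) t)) \<le>
     400 * (R powr R * exp (2 * (real N + 1)) * exp (pi * R)) * exp (- 4 * \<bar>t\<bar>)"
proof (rule zeta_kernel_bound[OF assms(1) _ _ _ assms(2) sin2_half_ge])
  show "norm (Complex (real N + 1/2) t) \<ge> 1/2"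
    using abs_Re_le_cmod[of "Complex (real N + 1/2) t"] by simp
qed auto

lemma sin_pi_eq_0_iff: "sin (of_real pi * z) = 0 \<longleftrightarrow> z \<in> \<int>" for z :: complex
proof
  assume "sin (of_real pi * z) = 0"
  then obtain n :: int where "of_real pi * z = of_real (of_int n * pi)"
    by (auto simp: sin_eq_0)
  then show "z \<in> \<int>" by auto
next
  assume "z \<in> \<int>"
  then obtain n where "z = of_int n" by (rule Ints_cases)
  then show "sin (of_real pi * z) = 0" by (auto simp: sin_eq_0 intro!: exI[of _ n])
qed

lemma holomorphic_zeta_kernel:
  assumes "\<And>z. z \<in> A \<Longrightarrow> Re z > 0" "\<And>z. z \<in> A \<Longrightarrow> z \<notin> \<int>"
  shows "zeta_kernel s holomorphic_on A"
  unfolding zeta_kernel_def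
  by (intro holomorphic_intros) (use assms in \<open>force simp: sin_pi_eq_0_iff complex_nonpos_Reals_iff\<close>)+

lemma continuous_zeta_kernel_line:
  assumes "c > 0" "c \<notin> \<int>"
  shows "continuous_on UNIV (\<lambda>t. zeta_kernel s (Complex c t))"
  by (rule continuous_on_vertical_line[OF holomorphic_zeta_kernel[of "{z. Re z = c}"]])
     (use assms in \<open>auto elim!: Ints_cases\<close>)

lemma half_not_Int: "real N + 1/2 \<notin> \<int>"
proof
  assume "real N + 1/2 \<in> \<int>"
  then obtain n where "real N + 1/2 = of_int n" by (rule Ints_cases)
  then have "2 * int N + 1 = 2 * n" by linarith
  then show False by presburger
qed

lemma integrable_zeta_kernel_half: "integrable lborel (\<lambda>t. zeta_kernel s (Complex (real N + 1/2) t))"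
proof (rule integrable_exp_decay[where c = 4])
  show "continuous_on UNIV (\<lambda>t. zeta_kernel s (Complex (real N + 1/2) t))"
    by (rule continuous_zeta_kernel_line[OF _ half_not_Int]) simp
  show "norm (zeta_kernel s (Complex (real N + 1/2) t)) \<le>
     400 * ((norm (1 - s) + 1) powr (norm (1 - s) + 1) * exp (2 * (real N + 1)) * exp (pi * (norm (1 - s) + 1))) * exp (- 4 * \<bar>t\<bar>)" for t
    by (rule zeta_kernel_half_bound) (auto intro: add_nonneg_pos)
qed simp

definition line_int :: "complex \<Rightarrow> real \<Rightarrow> complex" where
  "line_int s c = (LINT t|lborel. zeta_kernel s (Complex c t))"

text \<open>\<open>q\<close> extends sin(pi w) / w over 0. Near n the kernel is f(z) / (z - n)^2,
  where f(z) is z^(1 - s) / q(z - n)^2, so the residue is the derivative of f at n. Since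
  \<open>q\<close> is even, q'(0) = 0 and only the power of z contributes.\<close>

lemma residue_zeta_kernel:
  assumes "n \<ge> 1"
  shows "residue (zeta_kernel s) (of_nat n) = (1 - s) * of_nat n powr (- s) / of_real (pi\<^sup>2)"
proof -
  define q where "q = (\<lambda>w::complex. if w = 0 then deriv (\<lambda>w. sin (of_real pi * w)) 0
      else (sin (of_real pi * w) - sin (of_real pi * 0)) / (w - 0))"
  have d: "((\<lambda>w::complex. sin (of_real pi * w)) has_field_derivative of_real pi) (at 0)"
    by (auto intro!: derivative_eq_intros)
  have q0: "q 0 = of_real pi" using DERIV_imp_deriv[OF d] by (simp add: q_def)
  have q1: "q w = sin (of_real pi * w) / w" if "w \<noteq> 0" for w using that by (simp add: q_def)
  have qhol: "q holomorphic_on UNIV"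
    unfolding q_def by (rule pole_lemma_open) (auto intro!: holomorphic_intros)
  define A where "A = ball (of_nat n :: complex) (1/2)"
  define f where "f = (\<lambda>z. z powr (1 - s) / (q (z - of_nat n))\<^sup>2)"
  have A: "\<bar>Re z - real n\<bar> < 1/2" if "z \<in> A" for z
    using that abs_Re_le_cmod[of "z - of_nat n"] by (simp add: A_def dist_norm norm_minus_commute)
  have RA: "Re z > 0" if "z \<in> A" for z
  proof -
    have "Re z > real n - 1/2" using A[OF that] by linarith
    then show ?thesis using assms by linarith
  qed
  have nz: "q (z - of_nat n) \<noteq> 0" if "z \<in> A" for z
  proof (cases "z = of_nat n")
    case False
    have "z - of_nat n \<notin> \<int>"
    proof
      assume "z - of_nat n \<in> \<int>"
      then obtain m where m: "z - of_nat n = of_int m" by (rule Ints_cases)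
      then have "Re z - real n = of_int m" by (metis Re_complex_of_real minus_complex.simps(1) of_real_of_int_eq of_real_of_nat_eq)
      then have "m = 0" using A[OF that] by linarith
      then show False using m False by simp
    qed
    then show ?thesis using False q1 sin_pi_eq_0_iff[of "z - of_nat n"] by auto
  qed (simp add: q0)
  have qhol': "(\<lambda>z. q (z - of_nat n)) holomorphic_on A"
  proof -
    have "(\<lambda>z. z - of_nat n) holomorphic_on A" by (intro holomorphic_intros)
    from holomorphic_on_compose_gen[OF this qhol] show ?thesis by (simp add: o_def)
  qed
  have nn: "z \<notin> \<real>\<^sub>\<le>\<^sub>0" if "z \<in> A" for z
    using RA[OF that] by (auto simp: complex_nonpos_Reals_iff)
  have fhol: "f holomorphic_on A"
    unfolding f_def by (intro holomorphic_intros qhol') (use nz nn in auto)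
  have "residue (\<lambda>z. f z / (z - of_nat n) ^ Suc 1) (of_nat n) = (deriv ^^ 1) f (of_nat n) / fact 1"
    by (rule residue_holomorphic_over_power[OF _ _ fhol]) (auto simp: A_def)
  moreover have "residue (zeta_kernel s) (of_nat n) = residue (\<lambda>z. f z / (z - of_nat n) ^ Suc 1) (of_nat n)"
  proof (rule residue_cong[OF _ refl])
    have "zeta_kernel s z = f z / (z - of_nat n) ^ Suc 1" if "z \<noteq> of_nat n" for z
    proof -
      \<comment> \<open>A shift by n changes the sine at most by a sign, which the square
        removes.\<close>
      have "of_real pi * (z - of_nat n) = of_real pi * z - of_real pi * of_nat n" by (simp add: algebra_simps)
      moreover have "sin (of_real pi * of_nat n :: complex) = 0" by (simp only: sin_pi_eq_0_iff) simp
      moreover from this have "(cos (of_real pi * of_nat n :: complex))\<^sup>2 = 1"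
        using sin_cos_squared_add[of "of_real pi * of_nat n :: complex"] by simp
      ultimately have "(sin (of_real pi * (z - of_nat n)))\<^sup>2 = (sin (of_real pi * z))\<^sup>2"
        by (simp add: sin_diff power_mult_distrib)
      then show ?thesis using that by (simp add: zeta_kernel_def f_def q1 power_divide power2_eq_square)
    qed
    then show "\<forall>\<^sub>F z in at (of_nat n). zeta_kernel s z = f z / (z - of_nat n) ^ Suc 1"
      by (auto simp: eventually_at_filter)
  qed
  ultimately have R: "residue (zeta_kernel s) (of_nat n) = deriv f (of_nat n)" by simp
  obtain d where dq: "(q has_field_derivative d) (at 0)"
    using qhol by (metis UNIV_I field_differentiable_def holomorphic_on_imp_differentiable_at open_UNIV)
  have "((\<lambda>w. q (- w)) has_field_derivative - d) (at 0)"
    using DERIV_chain2[of q d "\<lambda>w. - w" 0 "-1" UNIV] dq DERIV_minus[OF DERIV_ident] by auto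
  moreover have "(\<lambda>w. q (- w)) = q" by (auto simp: q_def fun_eq_iff)
  ultimately have "d = - d" using dq DERIV_unique by metis
  then have "d = 0" by simp
  moreover have l: "((\<lambda>z. z - of_nat n) has_field_derivative 1) (at (of_nat n :: complex))"
    by (auto intro!: derivative_eq_intros)
  ultimately have "((\<lambda>z. q (z - of_nat n)) has_field_derivative 0) (at (of_nat n))"
    using DERIV_chain2[of q 0 "\<lambda>z. z - of_nat n" "of_nat n" 1 UNIV] dq by simp
  then have "(f has_field_derivative (1 - s) * of_nat n powr (- s) / (of_real pi)\<^sup>2) (at (of_nat n))"
    unfolding f_def using assms
    by (auto intro!: derivative_eq_intros simp: q0 field_simps power2_eq_square)
  then show ?thesis using R DERIV_imp_deriv by fastforce
qed

lemma line_int_shift: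
  "line_int s (real (Suc N) + 1/2) - line_int s (real N + 1/2) =
     2 / of_real pi * ((1 - s) * of_nat (Suc N) powr (- s))"
proof -
  define R where "R = norm (1 - s) + 1"
  define C where "C = 400 * (R powr R * exp (2 * (real N + 2)) * exp (pi * R))"
  have R: "R > 0" "norm (1 - s) \<le> R" by (auto simp: R_def intro: add_nonneg_pos)
  have "(LINT t|lborel. zeta_kernel s (Complex (real (Suc N) + 1/2) t)) - (LINT t|lborel. zeta_kernel s (Complex (real N + 1/2) t))
      = 2 * of_real pi * residue (zeta_kernel s) (of_real (real (Suc N)))"
  proof (rule strip_single_pole[where \<eta> = "1/4" and c = 4 and C = C])
    show "zeta_kernel s holomorphic_on {z. real N + 1/2 - 1/4 < Re z \<and> Re z < real (Suc N) + 1/2 + 1/4} - {of_real (real (Suc N))}"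
    proof (rule holomorphic_zeta_kernel)
      fix z assume z: "z \<in> {z. real N + 1/2 - 1/4 < Re z \<and> Re z < real (Suc N) + 1/2 + 1/4} - {of_real (real (Suc N))}"
      show "Re z > 0" using z by simp
      show "z \<notin> \<int>"
      proof
        assume "z \<in> \<int>"
        then obtain m where m: "z = of_int m" by (rule Ints_cases)
        then have "m = int (Suc N)" using z by simp
        then show False using m z by simp
      qed
    qed
    fix x t :: real assume x: "x \<in> {real N + 1/2..real (Suc N) + 1/2}" and t: "1 \<le> \<bar>t\<bar>"
    have "norm (Complex x t) \<ge> 1/2" using abs_Re_le_cmod[of "Complex x t"] x by simp
    then show "norm (zeta_kernel s (Complex x t)) \<le> C * exp (- 4 * \<bar>t\<bar>)" unfolding C_def
      by (intro zeta_kernel_bound R sin2_ge) (use x t in auto)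
  next
    show "integrable lborel (\<lambda>t. zeta_kernel s (Complex (real N + 1/2) t))"
      "integrable lborel (\<lambda>t. zeta_kernel s (Complex (real (Suc N) + 1/2) t))"
      by (rule integrable_zeta_kernel_half)+
  qed auto
  then have "2 * of_real pi * residue (zeta_kernel s) (of_nat (Suc N)) = line_int s (real (Suc N) + 1/2) - line_int s (real N + 1/2)"
    by (simp add: line_int_def)
  then show ?thesis
    using residue_zeta_kernel[of "Suc N" s] by (simp add: power2_eq_square)
qed

text \<open>On these lines |z| >= N + 1/2, so z^(1 - s) decays with N because 1 - Re s < 0, while
  the lower bound for the sine is uniform in N.\<close>

lemma line_int_tendsto_0:
  assumes "Re s > 1"
  shows "(\<lambda>N. line_int s (real N + 1/2)) \<longlonglongrightarrow> 0"
proof -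
  define J where "J = (LINT t|lborel. exp (- 6 * \<bar>t::real\<bar>))"
  define C where "C = 400 * exp (pi * \<bar>Im s\<bar>)"
  have B: "norm (line_int s (real N + 1/2)) \<le> C * (real N + 1/2) powr (1 - Re s) * J" for N
  proof -
    have b: "norm (zeta_kernel s (Complex (real N + 1/2) t)) \<le> C * (real N + 1/2) powr (1 - Re s) * exp (- 6 * \<bar>t\<bar>)" for t
    proof -
      have n: "real N + 1/2 \<le> norm (Complex (real N + 1/2) t)"
        using abs_Re_le_cmod[of "Complex (real N + 1/2) t"] by simp
      have "Complex (real N + 1/2) t \<noteq> 0" by (simp add: complex_eq_iff)
      then have "norm (Complex (real N + 1/2) t powr (1 - s)) \<le> norm (Complex (real N + 1/2) t) powr (1 - Re s) * exp (pi * \<bar>Im s\<bar>)"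
        using norm_powr_le[of "Complex (real N + 1/2) t" "1 - s"] by simp
      also have "\<dots> \<le> (real N + 1/2) powr (1 - Re s) * exp (pi * \<bar>Im s\<bar>)"
        using n assms by (intro mult_right_mono powr_mono2') auto
      finally have "norm (zeta_kernel s (Complex (real N + 1/2) t)) \<le>
          ((real N + 1/2) powr (1 - Re s) * exp (pi * \<bar>Im s\<bar>)) / (exp (6 * \<bar>t\<bar>) / 400)"
        unfolding norm_zeta_kernel by (intro frac_le sin2_half_ge) auto
      also have "\<dots> = C * (real N + 1/2) powr (1 - Re s) * exp (- 6 * \<bar>t\<bar>)"
        by (simp add: C_def exp_minus field_simps)
      finally show ?thesis .
    qed
    have "norm (line_int s (real N + 1/2)) \<le> (LINT t|lborel. C * (real N + 1/2) powr (1 - Re s) * exp (- 6 * \<bar>t\<bar>))"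
      unfolding line_int_def
      by (rule Bochner_Integration.integral_norm_bound_integral[OF integrable_zeta_kernel_half _ b])
         (intro integrable_mult_right integrable_exp_neg_abs, simp)
    then show ?thesis by (simp add: J_def)
  qed
  have "(\<lambda>N. (real N + 1/2) powr (1 - Re s)) \<longlonglongrightarrow> 0"
    using assms by real_asymp
  then have "(\<lambda>N. C * (real N + 1/2) powr (1 - Re s) * J) \<longlonglongrightarrow> C * 0 * J"
    by (intro tendsto_intros)
  then show ?thesis by (intro Lim_null_comparison[OF always_eventually[OF allI[OF B]]]) simp
qed

text \<open>The truncation to [-n, n] is holomorphic by differentiation under the integral sign, and
  the majorant in \<open>b\<close> makes the tails small uniformly on unit balls.\<close>

lemma holomorphic_improper_integral:
  fixes f fs :: "complex \<Rightarrow> real \<Rightarrow> complex"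
  assumes d: "\<And>s t. ((\<lambda>s. f s t) has_field_derivative fs s t) (at s)"
    and cf: "\<And>s. continuous_on UNIV (f s)"
    and cfs: "continuous_on UNIV (\<lambda>(s, t). fs s t)"
    and c: "c > 0" and b: "\<And>s0. \<exists>C. \<forall>s\<in>cball s0 1. \<forall>t. norm (f s t) \<le> C * exp (- c * \<bar>t\<bar>)"
  shows "(\<lambda>s. LINT t|lborel. f s t) holomorphic_on UNIV"
proof (rule holomorphic_uniform_sequence[where f = "\<lambda>n s. integral (cbox (- real n) (real n)) (f s)"])
  show "(\<lambda>s. integral (cbox (- real n) (real n)) (f s)) holomorphic_on UNIV" for n
  proof (rule leibniz_rule_holomorphic[where fx = fs])
    show "((\<lambda>s. f s t) has_field_derivative fs s t) (at s within UNIV)" for s t by (rule d)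
    show "f s integrable_on cbox (- real n) (real n)" for s
      by (rule integrable_continuous) (rule continuous_on_subset[OF cf], simp)
    show "continuous_on (UNIV \<times> cbox (- real n) (real n)) (\<lambda>(s, t). fs s t)"
      by (rule continuous_on_subset[OF cfs]) simp
  qed auto
  fix s0 :: complex
  obtain C where C: "\<And>s t. s \<in> cball s0 1 \<Longrightarrow> norm (f s t) \<le> C * exp (- c * \<bar>t\<bar>)" using b by blast
  define tail where "tail = (\<lambda>n::nat. LINT t|lborel. indicator (- {- real n..real n}) t *\<^sub>R (C * exp (- c * \<bar>t\<bar>)))"
  have g: "integrable lborel (\<lambda>t. C * exp (- c * \<bar>t\<bar>))"
    by (intro integrable_mult_right integrable_exp_neg_abs c)
  have "tail \<longlonglongrightarrow> (LINT t::real|lborel. 0)"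
    unfolding tail_def
  proof (rule integral_dominated_convergence[where w = "\<lambda>t. norm (C * exp (- c * \<bar>t\<bar>))"])
    show "AE t in lborel. (\<lambda>n. indicator (- {- real n..real n}) t *\<^sub>R (C * exp (- c * \<bar>t\<bar>))) \<longlonglongrightarrow> 0"
    proof (rule AE_I2)
      fix t :: real
      have "\<forall>\<^sub>F n in sequentially. real n \<ge> \<bar>t\<bar>"
        using filterlim_real_sequentially by (auto simp: filterlim_at_top)
      then have "\<forall>\<^sub>F n in sequentially. indicator (- {- real n..real n}) t *\<^sub>R (C * exp (- c * \<bar>t\<bar>)) = 0"
        by eventually_elim (auto simp: indicator_def)
      then show "(\<lambda>n. indicator (- {- real n..real n}) t *\<^sub>R (C * exp (- c * \<bar>t\<bar>))) \<longlonglongrightarrow> 0"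
        by (rule tendsto_eventually)
    qed
    show "AE t in lborel. norm (indicator (- {- real n..real n}) t *\<^sub>R (C * exp (- c * \<bar>t\<bar>))) \<le> norm (C * exp (- c * \<bar>t\<bar>))" for n
      by (auto simp: indicator_def)
    show "integrable lborel (\<lambda>t. norm (C * exp (- c * \<bar>t\<bar>)))" by (intro integrable_norm g)
  qed (use g in auto)
  then have tail: "tail \<longlonglongrightarrow> 0" by simp
  have close: "dist (integral (cbox (- real n) (real n)) (f s)) (LINT t|lborel. f s t) \<le> tail n" if s: "s \<in> cball s0 1" for s n
  proof -
    have i: "integrable lborel (f s)" by (rule integrable_exp_decay[OF cf c C[OF s]])
    have i1: "integrable lborel (\<lambda>t. indicator {- real n..real n} t *\<^sub>R f s t)"
      and i2: "integrable lborel (\<lambda>t. indicator (- {- real n..real n}) t *\<^sub>R f s t)"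
      by (rule integrable_mult_indicator[OF _ i], simp)+
    have "integral (cbox (- real n) (real n)) (f s) = (LINT t|lborel. indicator {- real n..real n} t *\<^sub>R f s t)"
      using set_borel_integral_eq_integral(2)[of "{- real n..real n}" "f s"] i1
      by (simp add: set_integrable_def set_lebesgue_integral_def)
    also have "\<dots> = (LINT t|lborel. f s t - indicator (- {- real n..real n}) t *\<^sub>R f s t)"
      by (intro Bochner_Integration.integral_cong) (auto simp: indicator_def)
    also have "\<dots> = (LINT t|lborel. f s t) - (LINT t|lborel. indicator (- {- real n..real n}) t *\<^sub>R f s t)"
      by (rule Bochner_Integration.integral_diff[OF i i2])
    finally have "dist (integral (cbox (- real n) (real n)) (f s)) (LINT t|lborel. f s t) =
       norm (LINT t|lborel. indicator (- {- real n..real n}) t *\<^sub>R f s t)" by (simp add: dist_norm)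
    also have "\<dots> \<le> tail n"
      unfolding tail_def
    proof (rule Bochner_Integration.integral_norm_bound_integral[OF i2])
      show "integrable lborel (\<lambda>t. indicator (- {- real n..real n}) t *\<^sub>R (C * exp (- c * \<bar>t\<bar>)))"
        by (rule integrable_mult_indicator[OF _ g]) simp
      show "norm (indicator (- {- real n..real n}) t *\<^sub>R f s t) \<le> indicator (- {- real n..real n}) t *\<^sub>R (C * exp (- c * \<bar>t\<bar>))" for t
        using C[OF s, of t] by (auto simp: indicator_def)
    qed
    finally show ?thesis .
  qed
  have "uniform_limit (cball s0 1) (\<lambda>n s. integral (cbox (- real n) (real n)) (f s)) (\<lambda>s. LINT t|lborel. f s t) sequentially"
  proof (rule uniform_limitI)
    fix e :: real assume "e > 0"
    then have "\<forall>\<^sub>F n in sequentially. tail n < e" using tail by (simp add: order_tendstoD)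
    then show "\<forall>\<^sub>F n in sequentially. \<forall>s\<in>cball s0 1. dist (integral (cbox (- real n) (real n)) (f s)) (LINT t|lborel. f s t) < e"
    proof eventually_elim
      case (elim n)
      then show ?case using close[of _ n] by (meson le_less_trans)
    qed
  qed
  then show "\<exists>d>0. cball s0 d \<subseteq> UNIV \<and> uniform_limit (cball s0 d) (\<lambda>n s. integral (cbox (- real n) (real n)) (f s)) (\<lambda>s. LINT t|lborel. f s t) sequentially"
    by (intro exI[of _ 1]) auto
qed simp

text \<open>The line Re z = 1/2 meets neither the integers nor the branch cut, and the decay is
  uniform for bounded s. So the integral is entire, and it can serve as the continuation of (s - 1)
  zeta(s) up to a constant.\<close>

lemma holomorphic_line_int: "(\<lambda>s. line_int s (1/2)) holomorphic_on UNIV"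
  unfolding line_int_def
proof (rule holomorphic_improper_integral[where c = 4 and fs = "\<lambda>s t. - Ln (Complex (1/2) t) * zeta_kernel s (Complex (1/2) t)"])
  fix s t
  have nz: "Complex (1/2) t \<noteq> 0" by (simp add: complex_eq_iff)
  have "((\<lambda>s. Complex (1/2) t powr (1 - s)) has_field_derivative (Ln (Complex (1/2) t) * Complex (1/2) t powr (1 - s)) * (- 1)) (at s)"
    by (rule DERIV_chain'[OF _ has_field_derivative_powr_right[OF nz]]) (auto intro!: derivative_eq_intros)
  from DERIV_cdivide[OF this]
  show "((\<lambda>s. zeta_kernel s (Complex (1/2) t)) has_field_derivative - Ln (Complex (1/2) t) * zeta_kernel s (Complex (1/2) t)) (at s)"
    unfolding zeta_kernel_def by simp
next
  show "continuous_on UNIV (\<lambda>t. zeta_kernel s (Complex (1/2) t))" for s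
    using continuous_zeta_kernel_line[of "1/2" s] half_not_Int[of 0] by simp
  have "Complex (1/2) t \<notin> \<real>\<^sub>\<le>\<^sub>0" for t by (simp add: complex_nonpos_Reals_iff)
  moreover have "sin (of_real pi * Complex (1/2) t) \<noteq> 0" for t
  proof -
    have "Complex (1/2) t \<notin> \<int>"
    proof
      assume "Complex (1/2) t \<in> \<int>"
      then obtain m where "Complex (1/2) t = of_int m" by (rule Ints_cases)
      then have "(1/2::real) = of_int m" by (metis complex.sel(1) Re_complex_of_real of_real_of_int_eq)
      then show False using half_not_Int[of 0] by (metis Ints_of_int add_0 of_nat_0)
    qed
    then show ?thesis by (simp add: sin_pi_eq_0_iff)
  qed
  ultimately show "continuous_on UNIV (\<lambda>(s, t). - Ln (Complex (1/2) t) * zeta_kernel s (Complex (1/2) t))"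
  proof -
    assume nn: "\<And>t. Complex (1/2) t \<notin> \<real>\<^sub>\<le>\<^sub>0" and sn: "\<And>t. sin (of_real pi * Complex (1/2) t) \<noteq> 0"
    have cg: "continuous_on UNIV (\<lambda>p::complex \<times> real. Complex (1/2) (snd p))"
      unfolding Complex_eq by (intro continuous_intros)
    have nz: "Complex (1/2) t \<noteq> 0" for t by (simp add: complex_eq_iff)
    have "continuous_on UNIV (\<lambda>p. - Ln (Complex (1/2) (snd p)) *
        (exp ((1 - fst p) * Ln (Complex (1/2) (snd p))) / (sin (of_real pi * Complex (1/2) (snd p)))\<^sup>2))"
      by (intro continuous_intros cg) (use nn sn in auto)
    then show ?thesis by (simp add: zeta_kernel_def case_prod_unfold powr_def nz)
  qed
  fix s0 :: complex
  define R where "R = norm (1 - s0) + 1"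
  have "norm (zeta_kernel s (Complex (1/2) t)) \<le> 400 * (R powr R * exp (2 * (real 0 + 1)) * exp (pi * R)) * exp (- 4 * \<bar>t\<bar>)"
    if "s \<in> cball s0 1" for s t
  proof -
    have "norm (1 - s) \<le> norm (1 - s0) + norm (s0 - s)" using norm_triangle_ineq[of "1 - s0" "s0 - s"] by simp
    then have "norm (1 - s) \<le> R" using that by (simp add: R_def dist_norm)
    moreover have "R > 0" by (simp add: R_def add_nonneg_pos)
    ultimately show ?thesis using zeta_kernel_half_bound[of R s 0 t] by simp
  qed
  then show "\<exists>C. \<forall>s\<in>cball s0 1. \<forall>t. norm (zeta_kernel s (Complex (1/2) t)) \<le> C * exp (- 4 * \<bar>t\<bar>)" by blast
qed simp

section \<open>The kernel integral as a continuation of zeta, and its move to the imaginary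
  axis\<close>

lemma zeta_sums: "Re s > 1 \<Longrightarrow> (\<lambda>n. 1 / of_nat (Suc n) powr s) sums zeta s"
  using is_zeta_zeta by (simp add: is_zeta_def)

lemma zeta_holomorphic: "zeta holomorphic_on UNIV - {1}"
  using is_zeta_zeta by (simp add: is_zeta_def)

text \<open>For Re s > 1 the shifts to the right telescope into the Dirichlet series; both sides are
  holomorphic away from 1.\<close>

lemma zeta_eq_line_int:
  assumes "s \<noteq> 1"
  shows "(s - 1) * zeta s = of_real pi / 2 * line_int s (1/2)"
proof -
  have gt1: "(s - 1) * zeta s = of_real pi / 2 * line_int s (1/2)" if s: "Re s > 1" for s
  proof -
    have "(\<lambda>N. line_int s (real (Suc N) + 1/2) - line_int s (real N + 1/2)) sums (0 - line_int s (real 0 + 1/2))"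
      by (rule telescope_sums[where f = "\<lambda>N. line_int s (real N + 1/2)", OF line_int_tendsto_0[OF s]])
    then have "(\<lambda>N. 2 / of_real pi * ((1 - s) * of_nat (Suc N) powr (- s))) sums (- line_int s (1/2))"
      unfolding line_int_shift by simp
    moreover have "(\<lambda>N. 2 / of_real pi * ((1 - s) * of_nat (Suc N) powr (- s))) sums (2 / of_real pi * ((1 - s) * zeta s))"
      using zeta_sums[OF s] by (intro sums_mult) (simp add: powr_minus divide_inverse)
    ultimately have "- line_int s (1/2) = 2 / of_real pi * ((1 - s) * zeta s)" by (rule sums_unique2)
    then show ?thesis by (simp add: field_simps)
  qed
  show ?thesis
  proof (rule analytic_continuation_open[where s = "{s. Re s > 1}" and s' = "UNIV - {1}" and f = "\<lambda>s. (s - 1) * zeta s"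
        and g = "\<lambda>s. of_real pi / 2 * line_int s (1/2)"])
    have "2 \<in> {s :: complex. Re s > 1}" by simp
    then show "{s :: complex. Re s > 1} \<noteq> {}" by blast
    show "connected (UNIV - {1 :: complex})"
      using connected_punctured_universe[of "1 :: complex"] by (simp add: Compl_eq_Diff_UNIV)
    show "(\<lambda>s. (s - 1) * zeta s) holomorphic_on UNIV - {1}"
      by (intro holomorphic_intros zeta_holomorphic)
    show "(\<lambda>s. of_real pi / 2 * line_int s (1/2)) holomorphic_on UNIV - {1}"
      by (intro holomorphic_intros holomorphic_on_subset[OF holomorphic_line_int]) auto
  qed (use gt1 assms in \<open>auto intro: open_halfspace_Re_gt\<close>)
qed

text \<open>The bound must be uniform in \<open>c\<close> down to the imaginary axis, which runs
  through the zero of the sine at 0. Near 0 the kernel is at most a constant times |z|^(- 1 - Re s),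
  and this stays bounded because Re s < -1.\<close>

lemma zeta_kernel_left_bound:
  assumes s: "Re s < -1"
  obtains C where "\<And>c t. 0 < c \<Longrightarrow> c \<le> 1/4 \<Longrightarrow> norm (zeta_kernel s (Complex c t)) \<le> C * exp (- 4 * \<bar>t\<bar>)"
proof -
  define R where "R = norm (1 - s) + 1"
  have R: "R > 0" "norm (1 - s) \<le> R" by (auto simp: R_def intro: add_nonneg_pos)
  define C1 where "C1 = 400 * (R powr R * exp (2 * 1) * exp (pi * R))"
  define C2 where "C2 = exp (pi * \<bar>Im s\<bar>) * exp 2"
  have C: "C1 \<ge> 0" "C2 \<ge> 0" by (auto simp: C1_def C2_def)
  have "norm (zeta_kernel s (Complex c t)) \<le> (C1 + C2) * exp (- 4 * \<bar>t\<bar>)" if c: "0 < c" "c \<le> 1/4" for c t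
  proof (cases "\<bar>t\<bar> \<ge> 1/2")
    case True
    have "norm (Complex c t) \<ge> 1/2" using abs_Im_le_cmod[of "Complex c t"] True by simp
    then have "norm (zeta_kernel s (Complex c t)) \<le> C1 * exp (- 4 * \<bar>t\<bar>)" unfolding C1_def
      by (intro zeta_kernel_bound R sin2_ge) (use c True in auto)
    also have "\<dots> \<le> (C1 + C2) * exp (- 4 * \<bar>t\<bar>)" using C by (intro mult_right_mono) auto
    finally show ?thesis .
  next
    case False
    define x where "x = norm (Complex c t)"
    have nz: "Complex c t \<noteq> 0" using c by (simp add: complex_eq_iff)
    then have x: "x > 0" by (simp add: x_def)
    have "x \<le> 1" using cmod_le[of "Complex c t"] c False by (simp add: x_def)
    have "norm (zeta_kernel s (Complex c t)) \<le> (x powr (1 - Re s) * exp (pi * \<bar>Im s\<bar>)) / x\<^sup>2"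
      unfolding norm_zeta_kernel
    proof (rule frac_le)
      show "norm (Complex c t powr (1 - s)) \<le> x powr (1 - Re s) * exp (pi * \<bar>Im s\<bar>)"
        using norm_powr_le[OF nz, of "1 - s"] by (simp add: x_def)
      show "x\<^sup>2 \<le> sin2 c t" using sin2_ge_norm[OF c] by (simp add: x_def)
    qed (use x in auto)
    also have "\<dots> = x powr (1 - Re s - 2) * exp (pi * \<bar>Im s\<bar>)"
      using x by (simp add: powr_diff power2_eq_square field_simps)
    also have "\<dots> \<le> 1 * exp (pi * \<bar>Im s\<bar>)"
      using x \<open>x \<le> 1\<close> s by (intro mult_right_mono powr_le1) auto
    also have "\<dots> \<le> C2 * exp (- 4 * \<bar>t\<bar>)"
    proof -
      have "1 \<le> exp 2 * exp (- 4 * \<bar>t\<bar>)" using False by (simp flip: exp_add)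
      then have "exp (pi * \<bar>Im s\<bar>) * 1 \<le> exp (pi * \<bar>Im s\<bar>) * (exp 2 * exp (- 4 * \<bar>t\<bar>))"
        by (rule mult_left_mono) simp
      then show ?thesis by (simp add: C2_def mult.assoc)
    qed
    also have "\<dots> \<le> (C1 + C2) * exp (- 4 * \<bar>t\<bar>)" using C by (intro mult_right_mono) auto
    finally show ?thesis .
  qed
  then show thesis by (rule that)
qed

lemma line_int_left:
  assumes s: "Re s < -1" and \<epsilon>: "0 < \<epsilon>" "\<epsilon> \<le> 1/4"
  shows "line_int s \<epsilon> = line_int s (1/2)"
proof -
  define R where "R = norm (1 - s) + 1"
  define C where "C = 400 * (R powr R * exp (2 * 1) * exp (pi * R))"
  have R: "R > 0" "norm (1 - s) \<le> R" by (auto simp: R_def intro: add_nonneg_pos)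
  obtain C' where C': "\<And>t. norm (zeta_kernel s (Complex \<epsilon> t)) \<le> C' * exp (- 4 * \<bar>t\<bar>)"
    using zeta_kernel_left_bound[OF s] \<epsilon> by metis
  have nI: "\<epsilon> \<notin> \<int>" using \<epsilon> by (auto elim!: Ints_cases)
  define A where "A = {z. \<epsilon> - \<epsilon>/2 < Re z \<and> Re z < 1/2 + \<epsilon>/2}"
  have hol: "zeta_kernel s holomorphic_on A"
  proof (rule holomorphic_zeta_kernel)
    fix z assume z: "z \<in> A"
    show "Re z > 0" using z \<epsilon> by (simp add: A_def)
    show "z \<notin> \<int>"
    proof
      assume "z \<in> \<int>"
      then obtain m where m: "z = of_int m" by (rule Ints_cases)
      then have "0 < real_of_int m" "real_of_int m < 1" using z \<epsilon> by (auto simp: A_def)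
      then have "0 < m" "m < 1" by simp_all
      then show False by linarith
    qed
  qed
  \<comment> \<open>No pole lies between the two lines; 3/8 is an arbitrary interior point, with
    residue 0.\<close>
  have "(LINT t|lborel. zeta_kernel s (Complex (1/2) t)) - (LINT t|lborel. zeta_kernel s (Complex \<epsilon> t))
      = 2 * of_real pi * residue (zeta_kernel s) (of_real (3/8))"
  proof (rule strip_single_pole[where \<eta> = "\<epsilon>/2" and c = 4 and C = C])
    show "zeta_kernel s holomorphic_on {z. \<epsilon> - \<epsilon>/2 < Re z \<and> Re z < 1/2 + \<epsilon>/2} - {of_real (3/8)}"
      by (rule holomorphic_on_subset[OF hol]) (auto simp: A_def)
    fix x t :: real assume x: "x \<in> {\<epsilon>..1/2}" and t: "1 \<le> \<bar>t\<bar>"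
    have "norm (Complex x t) \<ge> 1/2" using abs_Im_le_cmod[of "Complex x t"] t by simp
    then show "norm (zeta_kernel s (Complex x t)) \<le> C * exp (- 4 * \<bar>t\<bar>)" unfolding C_def
      by (intro zeta_kernel_bound R sin2_ge) (use x t \<epsilon> in auto)
  next
    show "integrable lborel (\<lambda>t. zeta_kernel s (Complex \<epsilon> t))"
      by (rule integrable_exp_decay[OF continuous_zeta_kernel_line[OF \<epsilon>(1) nI] _ C']) simp
    show "integrable lborel (\<lambda>t. zeta_kernel s (Complex (1/2) t))"
      using integrable_zeta_kernel_half[of s 0] by simp
  qed (use \<epsilon> in auto)
  moreover have "residue (zeta_kernel s) (of_real (3/8)) = 0"
  proof (rule residue_holo[OF _ _ hol])
    have "A = {z. Re z > \<epsilon>/2} \<inter> {z. Re z < 1/2 + \<epsilon>/2}" by (auto simp: A_def)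
    then show "open A" by (simp only: open_Int open_halfspace_Re_gt open_halfspace_Re_lt)
  qed (use \<epsilon> in \<open>auto simp: A_def\<close>)
  ultimately show ?thesis by (simp add: line_int_def)
qed

lemma line_int_imaginary_axis:
  assumes s: "Re s < -1"
  shows "line_int s (1/2) = (LINT t|lborel. zeta_kernel s (Complex 0 t))"
proof -
  obtain C where C: "\<And>c t. 0 < c \<Longrightarrow> c \<le> 1/4 \<Longrightarrow> norm (zeta_kernel s (Complex c t)) \<le> C * exp (- 4 * \<bar>t\<bar>)"
    using zeta_kernel_left_bound[OF s] by metis
  define \<epsilon> where "\<epsilon> = (\<lambda>n::nat. 1 / (real n + 4))"
  have \<epsilon>: "0 < \<epsilon> n" "\<epsilon> n \<le> 1/4" for n by (auto simp: \<epsilon>_def field_simps)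
  have \<epsilon>0: "\<epsilon> \<longlonglongrightarrow> 0" unfolding \<epsilon>_def by real_asymp
  have nI: "\<epsilon> n \<notin> \<int>" for n using \<epsilon>[of n] by (auto elim!: Ints_cases)
  have g: "integrable lborel (\<lambda>t. C * exp (- 4 * \<bar>t\<bar>))"
    by (intro integrable_mult_right integrable_exp_neg_abs) simp
  have ms: "(\<lambda>t. zeta_kernel s (Complex (\<epsilon> n) t)) \<in> borel_measurable lborel" for n
    using borel_measurable_continuous_onI[OF continuous_zeta_kernel_line[OF \<epsilon>(1) nI]] by simp
  have lim: "(\<lambda>n. zeta_kernel s (Complex (\<epsilon> n) t)) \<longlonglongrightarrow> zeta_kernel s (Complex 0 t)" if t: "t \<noteq> 0" for t
  proof -
    have "Complex 0 t \<notin> \<int>"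
    proof
      assume "Complex 0 t \<in> \<int>"
      then obtain n where "Complex 0 t = of_int n" by (rule Ints_cases)
      then show False using t by (simp add: complex_eq_iff)
    qed
    then have nz: "sin (of_real pi * Complex 0 t) \<noteq> 0" by (simp add: sin_pi_eq_0_iff)
    have nn: "Complex 0 t \<notin> \<real>\<^sub>\<le>\<^sub>0" using t by (simp add: complex_nonpos_Reals_iff)
    have "isCont (zeta_kernel s) (Complex 0 t)"
      unfolding zeta_kernel_def by (intro continuous_intros) (use nz nn in auto)
    moreover have "(\<lambda>n. Complex (\<epsilon> n) t) \<longlonglongrightarrow> Complex 0 t"
      by (intro tendsto_Complex \<epsilon>0 tendsto_const)
    ultimately show ?thesis by (rule isCont_tendsto_compose)
  qed
  \<comment> \<open>Setting the integrands to 0 at t = 0 gives pointwise convergence everywhere,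
    from which the measurability of the limit follows. The kernel itself has the value 0 there,
    since division by zero yields 0.\<close>
  define K where "K = (\<lambda>t. if t = 0 then 0 else zeta_kernel s (Complex 0 t))"
  have K0: "K t = zeta_kernel s (Complex 0 t)" for t
    by (cases "t = 0") (auto simp: K_def zeta_kernel_def Complex_eq)
  have mK: "K \<in> borel_measurable lborel"
  proof -
    have "(\<lambda>t. if t = 0 then 0 else zeta_kernel s (Complex (\<epsilon> n) t)) \<in> borel_measurable lborel" for n
      using ms by measurable
    moreover have "(\<lambda>n. if t = 0 then 0 else zeta_kernel s (Complex (\<epsilon> n) t)) \<longlonglongrightarrow> K t" for t
      using lim[of t] by (auto simp: K_def)
    ultimately show ?thesis by (rule borel_measurable_LIMSEQ_metric)
  qed
  have "(\<lambda>n. LINT t|lborel. zeta_kernel s (Complex (\<epsilon> n) t)) \<longlonglongrightarrow> (LINT t|lborel. K t)"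
  proof (rule integral_dominated_convergence[where w = "\<lambda>t. C * exp (- 4 * \<bar>t\<bar>)", OF mK ms g])
    show "AE t in lborel. (\<lambda>n. zeta_kernel s (Complex (\<epsilon> n) t)) \<longlonglongrightarrow> K t"
      using AE_lborel_singleton[of 0] by eventually_elim (use lim in \<open>simp add: K0\<close>)
    show "AE t in lborel. norm (zeta_kernel s (Complex (\<epsilon> n) t)) \<le> C * exp (- 4 * \<bar>t\<bar>)" for n
      using C[OF \<epsilon>] by simp
  qed
  then have "(\<lambda>n::nat. line_int s (1/2)) \<longlonglongrightarrow> (LINT t|lborel. K t)"
    using line_int_left[OF s \<epsilon>] by (simp add: line_int_def)
  then have "line_int s (1/2) = (LINT t|lborel. K t)" by (rule LIMSEQ_unique[OF tendsto_const])
  then show ?thesis by (simp add: K0)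
qed

section \<open>Evaluation of the integral over the imaginary axis\<close>

lemma Gamma_integral_scaled:
  assumes z: "Re z > 0" and a: "a > 0"
  defines "f \<equiv> \<lambda>a t::real. indicator {0<..} t *\<^sub>R (complex_of_real t powr (z - 1) / of_real (exp (a * t)))"
  shows "integrable lborel (f a)" "(LINT t|lborel. f a t) = Gamma z * of_real a powr (- z)"
proof -
  have m: "f b \<in> borel_measurable lborel" for b
    unfolding f_def by measurable
  have int: "integrable lborel (f b)" if "b > 0" for b
    using absolutely_integrable_Gamma_integral[OF z that] m[of b]
    unfolding set_integrable_def f_def by (subst (asm) integrable_completion) auto
  show "integrable lborel (f a)" using int[OF a] .
  have "set_integrable lborel {0<..} (\<lambda>t. complex_of_real t powr (z - 1) / of_real (exp (1 * t)))"
    using int[of 1] by (simp add: set_integrable_def f_def)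
  from set_borel_integral_eq_integral(2)[OF this]
  have 1: "(LINT t|lborel. f 1 t) = Gamma z"
    using Gamma_integral_complex'[OF z] by (simp add: set_lebesgue_integral_def f_def integral_unique)
  have "f 1 (a * t) = of_real a powr (z - 1) * f a t" for t
  proof (cases "t > 0")
    case True
    then have "complex_of_real (a * t) powr (z - 1) = of_real a powr (z - 1) * of_real t powr (z - 1)"
      using a by (simp add: powr_times_real)
    then show ?thesis using True a by (simp add: f_def)
  qed (use a in \<open>auto simp: f_def zero_less_mult_iff\<close>)
  then have "Gamma z = \<bar>a\<bar> *\<^sub>R (of_real a powr (z - 1) * (LINT t|lborel. f a t))"
    using lborel_integral_real_affine[of a "f 1" 0] a by (simp add: 1)
  also have "\<dots> = of_real a powr z * (LINT t|lborel. f a t)"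
    using a by (simp add: scaleR_conv_of_real powr_diff)
  finally show "(LINT t|lborel. f a t) = Gamma z * of_real a powr (- z)"
    using a by (simp add: powr_minus field_simps)
qed

text \<open>With q = exp(- 2 pi t) this is 4 times the sum of k q^k, a differentiated geometric
  series with value 4 q / (1 - q)^2.\<close>

lemma sinh_sq_series:
  assumes "t > (0::real)"
  shows "(\<lambda>k. 4 * real (Suc k) / exp (2 * pi * real (Suc k) * t)) sums (1 / (sinh (pi * t))\<^sup>2)"
proof -
  define q where "q = exp (- (2 * (pi * t)))"
  have q: "0 < q" "q < 1" using assms by (auto simp: q_def)
  have "(\<lambda>k. (4 * q) * (of_nat (Suc k) * q ^ k)) sums ((4 * q) * (1 / (1 - q)\<^sup>2))"
    by (intro sums_mult geometric_deriv_sums) (use q in auto)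
  moreover have "(4 * q) * (of_nat (Suc k) * q ^ k) = 4 * real (Suc k) / exp (2 * pi * real (Suc k) * t)" for k
  proof -
    have "q * q ^ k = exp (real (Suc k) * (- (2 * (pi * t))))" unfolding q_def exp_of_nat_mult by simp
    also have "real (Suc k) * (- (2 * (pi * t))) = - (2 * pi * real (Suc k) * t)" by (simp add: algebra_simps)
    finally have "q * q ^ k = 1 / exp (2 * pi * real (Suc k) * t)" by (simp only: exp_minus inverse_eq_divide)
    moreover have "(4 * q) * (of_nat (Suc k) * q ^ k) = 4 * real (Suc k) * (q * q ^ k)"
      by (simp only: mult_ac)
    ultimately show ?thesis by simp
  qed
  moreover have "(4 * q) * (1 / (1 - q)\<^sup>2) = 1 / (sinh (pi * t))\<^sup>2"
  proof -
    define u where "u = exp (pi * t)"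
    have u: "u > 0" by (simp add: u_def)
    have qu: "q = 1 / u\<^sup>2" by (simp add: q_def u_def exp_minus inverse_eq_divide power2_eq_square flip: exp_add)
    have sh: "sinh (pi * t) = (u - 1 / u) / 2" by (simp add: sinh_field_def u_def exp_minus inverse_eq_divide)
    have "u \<noteq> 1" using assms by (simp add: u_def)
    then have "u\<^sup>2 \<noteq> 1" using u by (simp add: power2_eq_1_iff)
    then show ?thesis using u unfolding qu sh
      by (simp add: divide_simps) (simp add: power2_eq_square algebra_simps)
  qed
  ultimately show ?thesis by simp
qed

text \<open>Expanding 1 / sinh^2 turns the integral into a series of Gamma integrals. Their
  dependence on k is k times k^(s - 2), which is the general term of the Dirichlet series of zeta at
  1 - s.\<close>

lemma sinh_integral:
  assumes s: "Re s < -1"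
  defines "g \<equiv> \<lambda>t. indicator {0<..} t *\<^sub>R (complex_of_real t powr (1 - s) / of_real ((sinh (pi * t))\<^sup>2))"
  shows "integrable lborel g" "(LINT t|lborel. g t) = 4 * Gamma (2 - s) * of_real (2 * pi) powr (s - 2) * zeta (1 - s)"
proof -
  define a where "a = (\<lambda>k. 2 * pi * real (Suc k))"
  define f where "f = (\<lambda>z k t. indicator {0<..} t *\<^sub>R (complex_of_real t powr (z - 1) / of_real (exp (a k * t))))"
  define gk where "gk = (\<lambda>k t. of_real (4 * real (Suc k)) * f (2 - s) k t)"
  have a: "a k > 0" for k by (simp add: a_def)
  have f: "integrable lborel (f z k)" "(LINT t|lborel. f z k t) = Gamma z * of_real (a k) powr (- z)" if "Re z > 0" for z k
    using Gamma_integral_scaled[OF that a] by (simp_all add: f_def)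
  have int: "integrable lborel (gk k)" for k
    unfolding gk_def by (intro integrable_mult_right f) (use s in simp)
  \<comment> \<open>The absolute value of a term is the same term with 2 - s replaced by its real
    part \<open>x\<close>. The integrals of the norms are therefore Gamma integrals too, and they
    are summable like k^(1 - x) with x > 3.\<close>
  define x where "x = 2 - Re s"
  have x: "x > 3" using s by (simp add: x_def)
  have sums: "(\<lambda>k. gk k t) sums g t" for t
  proof (cases "t > 0")
    case True
    from sums_mult[OF sums_of_real[OF sinh_sq_series[OF True]], of "complex_of_real t powr (1 - s)"]
    show ?thesis using True by (simp add: gk_def g_def f_def a_def mult_ac)
  qed (simp add: gk_def g_def f_def)
  have nf: "norm (f (2 - s) k t) = Re (f (of_real x) k t)" for k t
  proof (cases "t > 0")
    case True
    have "norm (complex_of_real t powr (1 - s)) = t powr (x - 1)"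
      using True by (simp add: norm_powr_real_powr x_def)
    moreover have "complex_of_real t powr (of_real x - 1) = of_real (t powr (x - 1))"
      using True by (metis less_imp_le of_real_1 of_real_diff powr_of_real)
    ultimately show ?thesis using True by (simp add: f_def norm_divide)
  qed (simp add: f_def)
  have nint: "(LINT t|lborel. norm (gk k t)) = 4 * (Gamma x * (2 * pi) powr (- x)) * real (Suc k) powr (1 - x)" for k
  proof -
    have "(LINT t|lborel. norm (gk k t)) = (LINT t|lborel. 4 * real (Suc k) * Re (f (of_real x) k t))"
      unfolding gk_def norm_mult nf norm_of_real by simp
    also have "\<dots> = 4 * real (Suc k) * Re (LINT t|lborel. f (of_real x) k t)"
      using integral_Re[OF f(1)[of "of_real x" k]] x by simp
    also have "(LINT t|lborel. f (of_real x) k t) = of_real (Gamma x * a k powr (- x))"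
      using f(2)[of "of_real x" k] x a[of k] powr_of_real[of "a k" "- x"] by (simp add: Gamma_complex_of_real)
    also have "a k powr (- x) = (2 * pi) powr (- x) * real (Suc k) powr (- x)"
      unfolding a_def by (rule powr_mult)
    also have "4 * real (Suc k) * Re (of_real (Gamma x * ((2 * pi) powr (- x) * real (Suc k) powr (- x)))) =
      4 * (Gamma x * (2 * pi) powr (- x)) * (real (Suc k) powr 1 * real (Suc k) powr (- x))" by simp
    also have "real (Suc k) powr 1 * real (Suc k) powr (- x) = real (Suc k) powr (1 - x)"
      by (simp only: powr_add[symmetric]) simp
    finally show ?thesis .
  qed
  have ae: "AE t in lborel. summable (\<lambda>k. norm (gk k t))"
  proof (rule AE_I2)
    fix t
    show "summable (\<lambda>k. norm (gk k t))"
    proof (cases "t > 0")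
      case True
      from summable_mult[OF sums_summable[OF sinh_sq_series[OF True]], of "norm (complex_of_real t powr (1 - s))"]
      moreover have "norm (gk k t) = norm (complex_of_real t powr (1 - s)) * (4 * real (Suc k) / exp (2 * pi * real (Suc k) * t))" for k
        unfolding gk_def norm_mult norm_of_real f_def using True by (simp add: a_def norm_divide)
      ultimately show ?thesis by simp
    qed (simp add: gk_def f_def)
  qed
  have "summable (\<lambda>k. real (Suc k) powr (1 - x))"
    using x by (subst summable_Suc_iff) (simp add: summable_real_powr_iff)
  then have sm: "summable (\<lambda>k. LINT t|lborel. norm (gk k t))"
    unfolding nint by (rule summable_mult)
  have gsum: "(\<Sum>k. gk k t) = g t" for t using sums by (simp add: sums_iff)
  show "integrable lborel g" using integrable_suminf[OF int ae sm] by (simp add: gsum)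
  have "(\<lambda>k. LINT t|lborel. gk k t) sums (LINT t|lborel. g t)"
    using sums_integral[OF int ae sm] by (simp add: gsum)
  moreover have "(LINT t|lborel. gk k t) = 4 * Gamma (2 - s) * of_real (2 * pi) powr (s - 2) * (1 / of_nat (Suc k) powr (1 - s))" for k
  proof -
    have "(LINT t|lborel. gk k t) = of_real (4 * real (Suc k)) * (Gamma (2 - s) * of_real (a k) powr (s - 2))"
      unfolding gk_def using f(2)[of "2 - s" k] s by simp
    also have "complex_of_real (a k) powr (s - 2) = of_real (2 * pi) powr (s - 2) * of_real (real (Suc k)) powr (s - 2)"
      unfolding a_def of_real_mult[of "2 * pi"] by (intro powr_times_real) auto
    also have "of_real (real (Suc k)) powr (s - 2) = (1 / of_nat (Suc k) powr (1 - s)) / of_nat (Suc k)"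
    proof -
      have "s - 2 = - (1 - s) - 1" by simp
      then show ?thesis by (simp only: powr_diff powr_minus of_real_of_nat_eq) (simp add: divide_inverse)
    qed
    finally show ?thesis by (simp add: field_simps del: of_nat_Suc)
  qed
  moreover have "(\<lambda>k. 4 * Gamma (2 - s) * of_real (2 * pi) powr (s - 2) * (1 / of_nat (Suc k) powr (1 - s))) sums
     (4 * Gamma (2 - s) * of_real (2 * pi) powr (s - 2) * zeta (1 - s))"
    by (intro sums_mult zeta_sums) (use s in simp)
  ultimately show "(LINT t|lborel. g t) = 4 * Gamma (2 - s) * of_real (2 * pi) powr (s - 2) * zeta (1 - s)"
    by (simp only: sums_unique2)
qed

text \<open>On the imaginary axis sin(pi i t)^2 = - sinh(pi t)^2, and both halves reduce to the same
  integral over t > 0, up to the phases \<open>e\<close> and \<open>e'\<close> that come from the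
  argument of z. Their sum is 2 cos(pi (1 - s) / 2) = 2 sin(pi s / 2).\<close>

lemma line_int_eval:
  assumes s: "Re s < -1"
  shows "line_int s (1/2) = - 8 * sin (of_real pi * s / 2) * Gamma (2 - s) * of_real (2 * pi) powr (s - 2) * zeta (1 - s)"
proof -
  define g where "g = (\<lambda>t. indicator {0<..} t *\<^sub>R (complex_of_real t powr (1 - s) / of_real ((sinh (pi * t))\<^sup>2)))"
  define e where "e = exp (\<i> * of_real pi / 2 * (1 - s))"
  define e' where "e' = exp (- (\<i> * of_real pi / 2 * (1 - s)))"
  have gi: "integrable lborel g" and gv: "(LINT t|lborel. g t) = 4 * Gamma (2 - s) * of_real (2 * pi) powr (s - 2) * zeta (1 - s)"
    using sinh_integral[OF s] by (simp_all add: g_def)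
  have gi': "integrable lborel (\<lambda>t. g (- t))" using lborel_integrable_real_affine[OF gi, of "-1" 0] by simp
  have gv': "(LINT t|lborel. g (- t)) = (LINT t|lborel. g t)"
    using lborel_integral_real_affine[of "-1" g 0] by simp
  have "zeta_kernel s (Complex 0 t) = - e * g t - e' * g (- t)" for t
  proof -
    have sn: "(sin (of_real pi * Complex 0 t))\<^sup>2 = - of_real ((sinh (pi * t))\<^sup>2)"
    proof -
      have "of_real pi * Complex 0 t = \<i> * of_real (pi * t)" by (simp add: Complex_eq)
      moreover have "sinh (complex_of_real (pi * t)) = of_real (sinh (pi * t))"
        by (simp add: sinh_field_def flip: exp_of_real)
      moreover have "sin (\<i> * w) = \<i> * sinh w" for w
        by (simp add: sinh_conv_sin)
      ultimately have "sin (of_real pi * Complex 0 t) = \<i> * of_real (sinh (pi * t))"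
        by (simp only:)
      then show ?thesis by (simp add: power_mult_distrib)
    qed
    consider "t > 0" | "t < 0" | "t = 0" by linarith
    then show ?thesis
    proof cases
      case 1
      have "Ln (Complex 0 t) = of_real (ln t) + \<i> * of_real pi / 2"
        using 1 Ln_times_ii[of "of_real t"] by (simp add: Complex_eq Ln_of_real mult.commute)
      then have "Complex 0 t powr (1 - s) = e * complex_of_real t powr (1 - s)"
      proof -
        have "(1 - s) * (of_real (ln t) + \<i> * of_real pi / 2) = \<i> * of_real pi / 2 * (1 - s) + (1 - s) * of_real (ln t)"
          by (simp add: field_simps)
        then have "exp ((1 - s) * Ln (Complex 0 t)) = e * exp ((1 - s) * Ln (of_real t))"
          unfolding \<open>Ln (Complex 0 t) = _\<close> e_def using 1 by (simp only: exp_add Ln_of_real)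
        then show ?thesis using 1 by (simp add: powr_def complex_eq_iff[of "Complex 0 t"])
      qed
      then show ?thesis using 1 sn by (simp add: zeta_kernel_def g_def)
    next
      case 2
      have "Ln (Complex 0 t) = of_real (ln (- t)) - \<i> * of_real pi / 2"
      proof (rule Ln_unique)
        have "exp (\<i> * complex_of_real (- pi / 2)) = - \<i>"
          unfolding cis_conv_exp[symmetric] by (simp add: complex_eq_iff)
        moreover have "exp (complex_of_real (ln (- t))) = of_real (- t)" using 2 by (simp only: exp_of_real exp_ln neg_0_less_iff_less)
        moreover have "of_real (ln (- t)) - \<i> * of_real pi / 2 = complex_of_real (ln (- t)) + \<i> * of_real (- pi / 2)"
          by simp
        ultimately show "exp (of_real (ln (- t)) - \<i> * of_real pi / 2) = Complex 0 t"
          by (simp only: exp_add) (simp add: complex_eq_iff)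
        have "Im (of_real (ln (- t)) - \<i> * of_real pi / 2) = - pi / 2" by simp
        then show "- pi < Im (of_real (ln (- t)) - \<i> * of_real pi / 2)"
          "Im (of_real (ln (- t)) - \<i> * of_real pi / 2) \<le> pi"
          using pi_gt_zero by linarith+
      qed
      then have "Complex 0 t powr (1 - s) = e' * complex_of_real (- t) powr (1 - s)"
      proof -
        have "(1 - s) * (of_real (ln (- t)) - \<i> * of_real pi / 2) = - (\<i> * of_real pi / 2 * (1 - s)) + (1 - s) * of_real (ln (- t))"
          by (simp add: field_simps)
        moreover have "0 < - t" using 2 by simp
        ultimately have "exp ((1 - s) * Ln (Complex 0 t)) = e' * exp ((1 - s) * Ln (of_real (- t)))"
          unfolding \<open>Ln (Complex 0 t) = _\<close> e'_def by (simp only: exp_add Ln_of_real)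
        then show ?thesis using 2 by (simp add: powr_def complex_eq_iff[of "Complex 0 t"])
      qed
      then show ?thesis using 2 sn by (simp add: zeta_kernel_def g_def)
    qed (simp add: zeta_kernel_def g_def Complex_eq)
  qed
  then have "line_int s (1/2) = (LINT t|lborel. - e * g t - e' * g (- t))"
    using line_int_imaginary_axis[OF s] by simp
  also have "\<dots> = - e * (LINT t|lborel. g t) - e' * (LINT t|lborel. g t)"
    using gi gi' by (simp add: gv')
  also have "\<dots> = - (e + e') * (LINT t|lborel. g t)" by (simp add: algebra_simps)
  also have "e + e' = 2 * sin (of_real pi * s / 2)"
  proof -
    have "cos (of_real pi / 2 - of_real pi * s / 2) = sin (of_real pi * s / 2)" by (simp add: cos_diff)
    moreover have "of_real pi / 2 - of_real pi * s / 2 = of_real pi / 2 * (1 - s)" by (simp add: algebra_simps)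
    ultimately have "cos (of_real pi / 2 * (1 - s)) = sin (of_real pi * s / 2)" by (simp only:)
    moreover have "2 * cos (of_real pi / 2 * (1 - s)) = e + e'"
      using cos_exp_eq[of "of_real pi / 2 * (1 - s)"] by (simp add: e_def e'_def mult_ac)
    ultimately show ?thesis by simp
  qed
  finally show ?thesis unfolding gv by (simp add: mult_ac)
qed

text \<open>The evaluation on the imaginary axis is the asymmetric form, valid for Re s < -1;
  duplication and reflection of Gamma make it symmetric. Writing it with \<open>rGamma\<close> keeps
  both sides holomorphic off 0 and 1, so that it extends by analytic continuation.\<close>

theorem zeta_functional_equation:
  assumes "s \<noteq> 0" "s \<noteq> 1"
  shows "zeta s * rGamma ((1 - s) / 2) * of_real pi powr ((1 - s) / 2) =
     zeta (1 - s) * rGamma (s / 2) * of_real pi powr (s / 2)"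
proof -
  define L where "L = (\<lambda>s. zeta s * rGamma ((1 - s) / 2) * of_real pi powr ((1 - s) / 2))"
  define M where "M = (\<lambda>s. zeta (1 - s) * rGamma (s / 2) * of_real pi powr (s / 2))"
  have left: "L s = M s" if s: "Re s < -1" for s
  proof -
    \<comment> \<open>All powers of pi and 2 are rewritten as exponentials in \<open>l\<close> and
      \<open>l2\<close>, which reduces the comparison of constants to an identity between
      exponents.\<close>
    define l where "l = complex_of_real (ln pi)"
    define l2 where "l2 = complex_of_real (ln 2)"
    have lnpi: "Ln (of_real pi) = l" by (simp add: l_def Ln_of_real)
    have pp: "of_real pi powr w = exp (w * l)" for w by (simp add: powr_def lnpi)
    have "Ln (of_real (2 * pi)) = of_real (ln (2 * pi))" by (rule Ln_of_real) simp
    then have "Ln (of_real (2 * pi)) = l2 + l" by (simp add: l_def l2_def ln_mult)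
    then have p2: "of_real (2 * pi) powr w = exp (w * (l2 + l))" for w by (simp add: powr_def)
    have el: "complex_of_real pi = exp l" "(2::complex) = exp l2"
      by (simp_all add: l_def l2_def exp_of_real)
    have sq: "complex_of_real (sqrt pi) = exp (l / 2)"
    proof -
      have "sqrt pi = exp (ln pi / 2)" by (simp add: powr_half_sqrt[symmetric] powr_def)
      then show ?thesis by (simp add: l_def flip: exp_of_real)
    qed
    have s1: "s - 1 \<noteq> 0" using s by auto
    have "(s - 1) * zeta s = of_real pi / 2 * (- 8 * sin (of_real pi * s / 2) * Gamma (2 - s) * of_real (2 * pi) powr (s - 2) * zeta (1 - s))"
      using zeta_eq_line_int[of s] s1 by (simp add: line_int_eval[OF s])
    moreover have "Gamma (2 - s) = (1 - s) * Gamma (1 - s)"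
      using Gamma_plus1[of "1 - s"] not_nonpos_Int_if_Re_pos[of "1 - s"] s by simp
    ultimately have "(s - 1) * zeta s = (s - 1) * (4 * of_real pi * sin (of_real pi * s / 2) * Gamma (1 - s) * of_real (2 * pi) powr (s - 2) * zeta (1 - s))"
      by (simp add: algebra_simps)
    then have z: "zeta s = 4 * of_real pi * sin (of_real pi * s / 2) * Gamma (1 - s) * of_real (2 * pi) powr (s - 2) * zeta (1 - s)"
      using s1 by (metis mult_left_cancel)
    define G where "G = Gamma ((1 - s) / 2)"
    define G2 where "G2 = Gamma (1 - s / 2)"
    have np: "(1 - s) / 2 \<notin> \<int>\<^sub>\<le>\<^sub>0" "1 - s / 2 \<notin> \<int>\<^sub>\<le>\<^sub>0"
      by (rule not_nonpos_Int_if_Re_pos; use s in simp)+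
    have G: "G \<noteq> 0" "G2 \<noteq> 0" using np by (auto simp: G_def G2_def Gamma_eq_zero_iff)
    have h: "(1 - s) / 2 + 1/2 = 1 - s / 2" by (simp add: field_simps)
    have "G * G2 = exp ((1 - 2 * ((1 - s) / 2)) * l2) * exp (l / 2) * Gamma (1 - s)"
    proof -
      have h2: "2 * ((1 - s) / 2) = 1 - s" by simp
      show ?thesis
        using Gamma_legendre_duplication[of "(1 - s) / 2"] np unfolding h h2 by (simp add: G_def G2_def l2_def sq)
    qed
    then have dup: "Gamma (1 - s) = G * G2 * exp (- (s * l2)) * exp (- (l / 2))"
      by (simp add: exp_minus field_simps)
    have "rGamma (s / 2) * inverse G2 = sin (of_real pi * (s / 2)) / of_real pi"
      using rGamma_reflection_complex[of "s / 2"] by (simp add: G2_def rGamma_inverse_Gamma)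
    then have refl: "sin (of_real pi * s / 2) * G2 = of_real pi * rGamma (s / 2)"
      using G by (simp add: field_simps)
    have "L s = 4 * of_real pi * (sin (of_real pi * s / 2) * G2) * exp (- (s * l2)) * exp (- (l / 2)) *
          of_real (2 * pi) powr (s - 2) * zeta (1 - s) * of_real pi powr ((1 - s) / 2)"
      unfolding L_def z dup using G by (simp add: rGamma_inverse_Gamma G_def[symmetric])
    also have "\<dots> = (4 * of_real pi * of_real pi * exp (- (s * l2)) * exp (- (l / 2)) *
          of_real (2 * pi) powr (s - 2) * of_real pi powr ((1 - s) / 2)) * (zeta (1 - s) * rGamma (s / 2))"
      unfolding refl by (simp add: mult_ac)
    also have "4 * of_real pi * of_real pi * exp (- (s * l2)) * exp (- (l / 2)) *
          of_real (2 * pi) powr (s - 2) * of_real pi powr ((1 - s) / 2) = of_real pi powr (s / 2)"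
    proof -
      have "(4::complex) = exp l2 * exp l2" by (simp flip: el)
      then have "4 * of_real pi * of_real pi * exp (- (s * l2)) * exp (- (l / 2)) *
          of_real (2 * pi) powr (s - 2) * of_real pi powr ((1 - s) / 2) =
          exp l2 * exp l2 * exp l * exp l * exp (- (s * l2)) * exp (- (l / 2)) * exp ((s - 2) * (l2 + l)) * exp ((1 - s) / 2 * l)"
        unfolding pp p2 by (simp only: el(1))
      also have "\<dots> = exp (l2 + l2 + l + l + (- (s * l2)) + (- (l / 2)) + (s - 2) * (l2 + l) + (1 - s) / 2 * l)"
        by (simp only: exp_add)
      also have "l2 + l2 + l + l + (- (s * l2)) + (- (l / 2)) + (s - 2) * (l2 + l) + (1 - s) / 2 * l = s / 2 * l"
        by (simp add: field_simps)
      finally show ?thesis unfolding pp .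
    qed
    finally show ?thesis by (simp add: M_def mult_ac)
  qed
  have "L s = M s"
  proof (rule analytic_continuation_open[where s = "{s. Re s < -1}" and s' = "UNIV - {0, 1}" and f = L and g = M])
    have "-2 \<in> {s :: complex. Re s < -1}" by simp
    then show "{s :: complex. Re s < -1} \<noteq> {}" by blast
    show "connected (UNIV - {0, 1 :: complex})"
      by (rule connected_open_delete_finite) auto
    show "L holomorphic_on UNIV - {0, 1}"
      unfolding L_def by (intro holomorphic_intros holomorphic_on_subset[OF zeta_holomorphic]) auto
    have "zeta \<circ> (\<lambda>s. 1 - s) holomorphic_on UNIV - {0, 1}"
      by (rule holomorphic_on_compose_gen[OF _ zeta_holomorphic]) (auto intro!: holomorphic_intros)
    then show "M holomorphic_on UNIV - {0, 1}"
      unfolding M_def o_def by (intro holomorphic_intros) auto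
  qed (use left assms in \<open>auto intro: open_halfspace_Re_lt\<close>)
  then show ?thesis by (simp add: L_def M_def)
qed

section \<open>Growth of the zeta function to the right of the imaginary axis\<close>

text \<open>This is (s - 1) times the difference between n^(-s) and the integral of x^(-s) over
  [n, n + 1]. The integrals telescope, and the differences are small enough to be summed for Re s >
  0.\<close>

definition zeta_term :: "nat \<Rightarrow> complex \<Rightarrow> complex" where
  "zeta_term n s = (s - 1) * of_nat n powr (- s) + of_nat (Suc n) powr (1 - s) - of_nat n powr (1 - s)"

lemma norm_of_nat_powr: "n \<ge> 1 \<Longrightarrow> norm (of_nat n powr s) = real n powr Re s"
  using norm_powr_real_powr[of "of_nat n" s] by simp

lemma powr_diff_bound:
  assumes "0 < a" "a \<le> x" "Re w \<le> 1"
  shows "norm (complex_of_real x powr w - of_real a powr w) \<le> norm w * a powr (Re w - 1) * (x - a)"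
proof -
  define S where "S = complex_of_real ` {a..x}"
  have "S = closed_segment (of_real a) (of_real x)"
    using assms closed_segment_of_real[of a x, where ?'a = complex] by (simp add: S_def closed_segment_eq_real_ivl)
  then have "convex S" by simp
  then have "norm (of_real x powr w - of_real a powr w) \<le> (norm w * a powr (Re w - 1)) * norm (complex_of_real x - of_real a)"
  proof (rule field_differentiable_bound[where f = "\<lambda>z. z powr w" and f' = "\<lambda>z. w * z powr (w - 1)"])
    fix z assume "z \<in> S"
    then obtain y where y: "z = of_real y" "a \<le> y" by (auto simp: S_def)
    then have "z \<notin> \<real>\<^sub>\<le>\<^sub>0" using assms by (simp add: complex_nonpos_Reals_iff)
    then show "((\<lambda>z. z powr w) has_field_derivative w * z powr (w - 1)) (at z within S)"
      by (rule has_field_derivative_at_within[OF has_field_derivative_powr])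
    have "norm (z powr (w - 1)) = y powr (Re w - 1)"
      using y assms by (subst norm_powr_real_powr) auto
    also have "\<dots> \<le> a powr (Re w - 1)" using y assms by (intro powr_mono2') auto
    finally show "norm (w * z powr (w - 1)) \<le> norm w * a powr (Re w - 1)"
      by (simp add: norm_mult mult_left_mono)
  qed (use assms in \<open>auto simp: S_def\<close>)
  also have "norm (complex_of_real x - of_real a) = x - a"
    using assms by (simp flip: of_real_diff)
  finally show ?thesis .
qed

text \<open>Two mean value estimates: the term is G(n + 1) - G(n), where the derivative of
  \<open>G\<close> is (1 - s) (z^(-s) - n^(-s)), itself small by
  \<open>powr_diff_bound\<close>.\<close>

lemma norm_zeta_term_le:
  assumes n: "n \<ge> 1" and s: "Re s > -1"
  shows "norm (zeta_term n s) \<le> norm s * norm (s - 1) * real n powr (- 1 - Re s)"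
proof -
  define S where "S = complex_of_real ` {real n..real (Suc n)}"
  have "S = closed_segment (of_real (real n)) (of_real (real (Suc n)))"
    using closed_segment_of_real[of "real n" "real (Suc n)", where ?'a = complex] by (simp add: S_def closed_segment_eq_real_ivl)
  then have "convex S" by simp
  define G where "G = (\<lambda>z. z powr (1 - s) - (1 - s) * of_nat n powr (- s) * z)"
  define B where "B = norm s * norm (s - 1) * real n powr (- 1 - Re s)"
  have "norm (G (of_real (real (Suc n))) - G (of_real (real n))) \<le> B * norm (complex_of_real (real (Suc n)) - of_real (real n))"
  proof (rule field_differentiable_bound[OF \<open>convex S\<close>, where f' = "\<lambda>z. (1 - s) * (z powr (- s) - of_nat n powr (- s))"])
    fix z assume "z \<in> S"
    then obtain y where y: "z = of_real y" "real n \<le> y" "y \<le> real (Suc n)" by (auto simp: S_def)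
    then have nz: "z \<notin> \<real>\<^sub>\<le>\<^sub>0" using n by (auto simp: complex_nonpos_Reals_iff)
    have dp: "((\<lambda>z. z powr (1 - s)) has_field_derivative (1 - s) * z powr (1 - s - 1)) (at z)"
      by (rule has_field_derivative_powr[OF nz])
    have "(G has_field_derivative (1 - s) * z powr (1 - s - 1) - (1 - s) * of_nat n powr (- s)) (at z)"
      using DERIV_diff[OF dp DERIV_cmult[OF DERIV_ident, of "(1 - s) * of_nat n powr (- s)"]] by (simp add: G_def)
    then have "(G has_field_derivative (1 - s) * (z powr (- s) - of_nat n powr (- s))) (at z)"
      by (simp add: right_diff_distrib)
    then show "(G has_field_derivative (1 - s) * (z powr (- s) - of_nat n powr (- s))) (at z within S)"
      by (rule has_field_derivative_at_within)
    have "norm (of_real y powr (- s) - of_real (real n) powr (- s)) \<le> norm (- s) * real n powr (Re (- s) - 1) * (y - real n)"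
      by (rule powr_diff_bound) (use n y s in auto)
    also have "\<dots> \<le> norm (- s) * real n powr (Re (- s) - 1) * 1"
      using y by (intro mult_left_mono) auto
    also have "Re (- s) - 1 = - 1 - Re s" by simp
    finally have "norm (z powr (- s) - of_nat n powr (- s)) \<le> norm s * real n powr (- 1 - Re s)"
      by (simp add: y(1))
    then have "norm (1 - s) * norm (z powr (- s) - of_nat n powr (- s)) \<le> norm (1 - s) * (norm s * real n powr (- 1 - Re s))"
      by (rule mult_left_mono) simp
    then show "norm ((1 - s) * (z powr (- s) - of_nat n powr (- s))) \<le> B"
      by (simp add: norm_mult B_def norm_minus_commute[of 1] mult_ac)
  next
    show "of_real (real (Suc n)) \<in> S" "of_real (real n) \<in> S"
      unfolding S_def by (rule imageI, simp)+
  qed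
  also have "norm (complex_of_real (real (Suc n)) - of_real (real n)) = 1" by simp
  finally show ?thesis by (simp add: G_def B_def zeta_term_def algebra_simps)
qed

lemma summable_Suc_powr: "a < -1 \<Longrightarrow> summable (\<lambda>n. real (Suc n) powr a)"
  by (subst summable_Suc_iff) (simp add: summable_real_powr_iff)

text \<open>This is (s - 1) zeta(s) for Re s > 0 with the singularity at 1 removed; the leading 1 is
  what remains of the telescoped integrals.\<close>

definition zeta_reg :: "complex \<Rightarrow> complex" where
  "zeta_reg s = 1 + (\<Sum>n. zeta_term (Suc n) s)"

lemma summable_zeta_term:
  assumes "Re s > 0"
  shows "summable (\<lambda>n. norm (zeta_term (Suc n) s))"
proof (rule summable_comparison_test')
  show "summable (\<lambda>n. norm s * norm (s - 1) * real (Suc n) powr (- 1 - Re s))"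
    by (intro summable_mult summable_Suc_powr) (use assms in simp)
  show "norm (norm (zeta_term (Suc n) s)) \<le> norm s * norm (s - 1) * real (Suc n) powr (- 1 - Re s)" for n
    using norm_zeta_term_le[of "Suc n" s] assms by simp
qed

lemma zeta_reg_holomorphic: "zeta_reg holomorphic_on {s. Re s > 0}"
proof -
  have "(\<lambda>s. \<Sum>n. zeta_term (Suc n) s) holomorphic_on {s. Re s > 0}"
  proof (rule holomorphic_suminf)
    show "open {s. Re s > 0}" by (rule open_halfspace_Re_gt)
    show "zeta_term (Suc n) holomorphic_on {s. Re s > 0}" for n
      unfolding zeta_term_def by (intro holomorphic_intros)
    fix x assume x: "x \<in> {s. Re s > 0}"
    define d where "d = Re x / 2"
    have d: "d > 0" using x by (simp add: d_def)
    have Re: "Re y \<ge> d" if "y \<in> cball x d" for y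
      using abs_Re_le_cmod[of "x - y"] that by (auto simp: dist_norm d_def)
    define M where "M = (\<lambda>n. (norm x + d) * (norm x + d + 1) * real (Suc n) powr (- 1 - d))"
    have "norm (zeta_term (Suc n) y) \<le> M n" if y: "y \<in> cball x d" for n y
    proof -
      have ny: "norm y \<le> norm x + d" using y norm_triangle_sub[of y x] by (simp add: dist_norm norm_minus_commute)
      then have "norm (y - 1) \<le> norm x + d + 1" using norm_triangle_ineq4[of y 1] by simp
      have "norm (zeta_term (Suc n) y) \<le> norm y * norm (y - 1) * real (Suc n) powr (- 1 - Re y)"
        by (rule norm_zeta_term_le) (use Re[OF y] d in auto)
      also have "\<dots> \<le> M n" unfolding M_def
        using ny \<open>norm (y - 1) \<le> _\<close> Re[OF y] d by (intro mult_mono powr_mono) auto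
      finally show ?thesis .
    qed
    moreover have "summable M" unfolding M_def
      by (intro summable_mult summable_Suc_powr) (use d in simp)
    moreover have "cball x d \<subseteq> {s. Re s > 0}" using Re d by force
    ultimately show "\<exists>d>0. \<exists>M. cball x d \<subseteq> {s. Re s > 0} \<and> summable M \<and>
        (\<forall>n. \<forall>y\<in>cball x d. norm (zeta_term (Suc n) y) \<le> M n)"
      using d by blast
  qed
  then show ?thesis unfolding zeta_reg_def by (intro holomorphic_intros)
qed

lemma zeta_reg_eq:
  assumes "Re s > 0" "s \<noteq> 1"
  shows "zeta_reg s = (s - 1) * zeta s"
proof -
  have gt1: "zeta_reg s = (s - 1) * zeta s" if s: "Re s > 1" for s
  proof -
    have "(\<lambda>n. (s - 1) * (1 / of_nat (Suc n) powr s)) sums ((s - 1) * zeta s)"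
      by (intro sums_mult zeta_sums s)
    moreover have "(\<lambda>n. of_nat (Suc (Suc n)) powr (1 - s) - of_nat (Suc n) powr (1 - s)) sums (0 - of_nat (Suc 0) powr (1 - s) :: complex)"
      by (rule telescope_sums[where f = "\<lambda>n. of_nat (Suc n) powr (1 - s)"])
         (intro tendsto_neg_powr_complex_of_nat filterlim_subseq, use s in \<open>auto simp: strict_mono_def\<close>)
    ultimately have "(\<lambda>n. (s - 1) * (1 / of_nat (Suc n) powr s) + (of_nat (Suc (Suc n)) powr (1 - s) - of_nat (Suc n) powr (1 - s)))
       sums ((s - 1) * zeta s + (0 - of_nat (Suc 0) powr (1 - s)))" by (rule sums_add)
    then have "(\<lambda>n. zeta_term (Suc n) s) sums ((s - 1) * zeta s - 1)"
      by (simp add: zeta_term_def powr_minus divide_inverse algebra_simps)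
    then show ?thesis by (simp add: zeta_reg_def sums_iff)
  qed
  show ?thesis
  proof (rule analytic_continuation_open[where s = "{s. Re s > 1}" and s' = "{s. Re s > 0} - {1}" and f = zeta_reg
        and g = "\<lambda>s. (s - 1) * zeta s"])
    have "2 \<in> {s :: complex. Re s > 1}" by simp
    then show "{s :: complex. Re s > 1} \<noteq> {}" by blast
    show "connected ({s. Re s > 0} - {1 :: complex})"
      by (rule connected_open_delete) (auto intro: open_halfspace_Re_gt convex_connected convex_halfspace_Re_gt)
    show "open ({s. Re s > 0} - {1 :: complex})" by (intro open_Diff open_halfspace_Re_gt) auto
    show "zeta_reg holomorphic_on {s. Re s > 0} - {1}"
      by (rule holomorphic_on_subset[OF zeta_reg_holomorphic]) auto
    show "(\<lambda>s. (s - 1) * zeta s) holomorphic_on {s. Re s > 0} - {1}"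
      by (intro holomorphic_intros holomorphic_on_subset[OF zeta_holomorphic]) auto
  qed (use gt1 assms in \<open>auto intro: open_halfspace_Re_gt\<close>)
qed

lemma zeta_reg_1: "zeta_reg 1 = 1"
  by (simp add: zeta_reg_def zeta_term_def del: of_nat_Suc)

lemma zeta_reg_bound:
  obtains C where "C > 0" "\<And>s. Re s \<ge> 1/4 \<Longrightarrow> norm (zeta_reg s) \<le> C * (1 + norm s)\<^sup>2"
proof -
  define K where "K = (\<Sum>n. real (Suc n) powr (- 1 - 1/4))"
  have sm: "summable (\<lambda>n. real (Suc n) powr (- 1 - 1/4))" by (rule summable_Suc_powr) simp
  have K: "K \<ge> 0" unfolding K_def by (intro suminf_nonneg sm) auto
  have "norm (zeta_reg s) \<le> (1 + K) * (1 + norm s)\<^sup>2" if s: "Re s \<ge> 1/4" for s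
  proof -
    have "norm (\<Sum>n. zeta_term (Suc n) s) \<le> (\<Sum>n. norm s * norm (s - 1) * real (Suc n) powr (- 1 - 1/4))"
    proof (rule order_trans[OF summable_norm[OF summable_zeta_term]])
      show "(\<Sum>n. norm (zeta_term (Suc n) s)) \<le> (\<Sum>n. norm s * norm (s - 1) * real (Suc n) powr (- 1 - 1/4))"
      proof (rule suminf_le[OF _ summable_zeta_term summable_mult[OF sm]])
        fix n
        have "norm (zeta_term (Suc n) s) \<le> norm s * norm (s - 1) * real (Suc n) powr (- 1 - Re s)"
          by (rule norm_zeta_term_le) (use s in auto)
        also have "\<dots> \<le> norm s * norm (s - 1) * real (Suc n) powr (- 1 - 1/4)"
          using s by (intro mult_left_mono powr_mono) auto
        finally show "norm (zeta_term (Suc n) s) \<le> norm s * norm (s - 1) * real (Suc n) powr (- 1 - 1/4)" .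
      qed (use s in simp)
    qed (use s in simp)
    also have "\<dots> = norm s * norm (s - 1) * K" unfolding K_def by (rule suminf_mult[OF sm])
    also have "\<dots> \<le> (1 + norm s) * (1 + norm s) * K"
      using norm_triangle_ineq4[of s 1] K by (intro mult_right_mono mult_mono) auto
    finally have "norm (\<Sum>n. zeta_term (Suc n) s) \<le> K * (1 + norm s)\<^sup>2" by (simp add: power2_eq_square mult_ac)
    moreover have "1 \<le> (1 + norm s)\<^sup>2" by (rule one_le_power) simp
    moreover have "norm (zeta_reg s) \<le> 1 + norm (\<Sum>n. zeta_term (Suc n) s)"
      unfolding zeta_reg_def using norm_triangle_ineq[of 1 "\<Sum>n. zeta_term (Suc n) s"] by simp
    ultimately show ?thesis by (simp only: distrib_right mult_1)
  qed
  then show thesis using K by (intro that[of "1 + K"]) auto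
qed

text \<open>This excludes 0 as an ordinate, so that the ordinates fall into positive ones and their
  negatives. The terms at 1/2 are real and bounded below by telescoping terms with sum -1/2, which
  the leading 1 outweighs.\<close>

lemma zeta_reg_half_nonzero: "zeta_reg (1/2) \<noteq> 0"
proof -
  define a where "a = (\<lambda>n. sqrt (real (Suc (Suc n))) - sqrt (real (Suc n)) - 1 / (2 * sqrt (real (Suc n))))"
  have pw: "complex_of_nat n powr (1/2) = of_real (sqrt (real n))" for n
  proof -
    have "complex_of_real (real n) powr of_real (1/2) = of_real (real n powr (1/2))"
      by (rule powr_of_real) auto
    then show ?thesis by (simp add: powr_half_sqrt)
  qed
  have tm: "zeta_term (Suc n) (1/2) = of_real (a n)" for n
  proof -
    have e: "(1/2 - 1::complex) = - (1/2)" "(1 - 1/2::complex) = 1/2" by simp_all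
    have "zeta_term (Suc n) (1/2) = - (1/2) * inverse (of_real (sqrt (real (Suc n))))
        + of_real (sqrt (real (Suc (Suc n)))) - of_real (sqrt (real (Suc n)))"
      unfolding zeta_term_def e powr_minus pw by (rule refl)
    moreover have "- (1/2) * inverse (of_real u) + of_real v - of_real u = complex_of_real (v - u - 1 / (2 * u))" for u v
      by (simp add: inverse_eq_divide)
    ultimately show ?thesis by (simp only: a_def)
  qed
  have "summable (\<lambda>n. norm (zeta_term (Suc n) (1/2)))" by (rule summable_zeta_term) simp
  then have sa: "summable a" unfolding tm norm_of_real by (rule summable_rabs_cancel)
  have Z: "zeta_reg (1/2) = of_real (1 + (\<Sum>n. a n))"
    unfolding zeta_reg_def tm suminf_of_real[OF sa, symmetric] by simp
  define b where "b = (\<lambda>n. 1/2 * (1 / sqrt (real (Suc (Suc n))) - 1 / sqrt (real (Suc n))))"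
  have "(\<lambda>n. 1 / sqrt (real (Suc n))) \<longlonglongrightarrow> 0" by real_asymp
  then have b: "b sums (1/2 * (0 - 1 / sqrt (real (Suc 0))))"
    unfolding b_def by (intro sums_mult telescope_sums[where f = "\<lambda>n. 1 / sqrt (real (Suc n))"])
  have "b n \<le> a n" for n
  proof -
    define u v where "u = sqrt (real (Suc n))" "v = sqrt (real (Suc (Suc n)))"
    have u: "0 < u" "u \<le> v" by (auto simp: u_v_def)
    have "(v - u) * (v + u) = v\<^sup>2 - u\<^sup>2" by (simp add: power2_eq_square algebra_simps)
    then have "(v - u) * (v + u) = 1" by (simp add: u_v_def)
    then have "v - u = 1 / (v + u)" using u by (simp add: field_simps)
    also have "\<dots> \<ge> 1 / (2 * v)" using u by (intro divide_left_mono) auto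
    finally have "v - u \<ge> 1 / (2 * v)" .
    then have "1/2 * (1 / v - 1 / u) \<le> v - u - 1 / (2 * u)" by (simp add: diff_divide_distrib)
    then show ?thesis by (simp only: a_def b_def u_v_def)
  qed
  then have "- 1/2 \<le> (\<Sum>n. a n)"
    using suminf_le[OF _ sums_summable[OF b] sa] sums_unique[OF b] by simp
  then have "1 + (\<Sum>n. a n) \<noteq> 0" by linarith
  then show ?thesis unfolding Z by (metis of_real_eq_0_iff)
qed

section \<open>The Moebius function\<close>

lemma summable_on_Times_mult:
  fixes f :: "'a \<Rightarrow> real" and g :: "'b \<Rightarrow> real"
  assumes "f summable_on A" "g summable_on B" "\<And>x. x \<in> A \<Longrightarrow> f x \<ge> 0" "\<And>y. y \<in> B \<Longrightarrow> g y \<ge> 0"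
  shows "(\<lambda>(x, y). f x * g y) summable_on A \<times> B"
proof (rule summable_on_SigmaI[where g = "\<lambda>x. f x * infsum g B"])
  show "((\<lambda>y. case (x, y) of (x, y) \<Rightarrow> f x * g y) has_sum f x * infsum g B) B" for x
    using has_sum_cmult_right[OF has_sum_infsum[OF assms(2)], of "f x"] by simp
  show "(\<lambda>x. f x * infsum g B) summable_on A"
    by (rule summable_on_cmult_left[OF assms(1)])
qed (use assms in auto)

lemma abs_moebius_le_1: "\<bar>moebius n\<bar> \<le> 1"
  by (simp add: moebius_def power_abs)

lemma moebius_1 [simp]: "moebius (Suc 0) = 1"
  by (simp add: moebius_def)

lemma moebius_mult_prime:
  assumes p: "prime p" and d: "\<not> p dvd d"
  shows "moebius (p * d) = - moebius d"
proof -
  have d0: "d \<noteq> 0" using d by (intro notI) simp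
  have cop: "coprime p d" using p d by (rule prime_imp_coprime)
  have sq: "squarefree (p * d) \<longleftrightarrow> squarefree d"
    using squarefree_mult_coprime[OF cop squarefree_prime[OF p]] squarefree_multD(2) by blast
  have "prime_factors (p * d) = insert p (prime_factors d)"
    using p d0 by (simp add: prime_factors_product prime_factorization_prime)
  moreover have "p \<notin> prime_factors d" using d by (auto dest: in_prime_factors_imp_dvd)
  ultimately have "card (prime_factors (p * d)) = Suc (card (prime_factors d))" by simp
  then show ?thesis by (simp add: moebius_def sq)
qed

text \<open>For a prime p dividing n, the divisors d and p d with p not dividing d cancel in pairs;
  every other divisor is a multiple of p^2.\<close>

lemma sum_moebius_divisors:
  assumes "n \<ge> 1"
  shows "(\<Sum>d\<in>{d. d dvd n}. moebius d) = (if n = 1 then 1 else 0)"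
proof (cases "n = 1")
  case True
  then have "{d. d dvd n} = {Suc 0}" by auto
  then show ?thesis using True by simp
next
  case False
  then obtain p where p: "prime p" "p dvd n" using prime_factor_nat by blast
  define D where "D = {d. d dvd n \<and> \<not> p dvd d}"
  have fin: "finite {d. d dvd n}" using assms by (intro finite_divisors_nat) simp
  have sub: "D \<union> (*) p ` D \<subseteq> {d. d dvd n}"
    using p by (auto simp: D_def intro!: divides_mult prime_imp_coprime)
  have inj: "inj_on ((*) p) D" using p(1) by (auto simp: inj_on_def)
  have finD: "finite D" by (rule finite_subset[OF _ fin]) (auto simp: D_def)
  have "(\<Sum>d\<in>{d. d dvd n}. moebius d) = (\<Sum>d\<in>D \<union> (*) p ` D. moebius d)"
  proof (rule sum.mono_neutral_right[OF fin sub])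
    show "\<forall>d\<in>{d. d dvd n} - (D \<union> (*) p ` D). moebius d = 0"
    proof
      fix d assume d: "d \<in> {d. d dvd n} - (D \<union> (*) p ` D)"
      then have "p dvd d" by (auto simp: D_def)
      then obtain e where e: "d = p * e" by (elim dvdE)
      have "e dvd n" using d e by (auto intro: dvd_mult_right)
      then have "p dvd e" using d e by (auto simp: D_def)
      then have "p ^ 2 dvd d" by (simp add: e power2_eq_square)
      then have "\<not> squarefree d" using p(1) by (intro not_squarefreeI) auto
      then show "moebius d = 0" by (simp add: moebius_def)
    qed
  qed
  also have "\<dots> = (\<Sum>d\<in>D. moebius d) + (\<Sum>d\<in>(*) p ` D. moebius d)"
    using finD by (intro sum.union_disjoint) (auto simp: D_def)
  also have "(\<Sum>d\<in>(*) p ` D. moebius d) = (\<Sum>d\<in>D. - moebius d)"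
    unfolding sum.reindex[OF inj] by (intro sum.cong) (auto simp: D_def intro: moebius_mult_prime[OF p(1)])
  finally show ?thesis using False by (simp add: sum_negf)
qed

text \<open>Absolute convergence allows the double series over (a, b) to be regrouped by the product
  n = a b, where the divisor sum leaves only n = 1.\<close>

lemma moebius_dirichlet_series:
  assumes s: "Re s > 1"
  shows "summable (\<lambda>n. norm (of_real (moebius (Suc n)) * of_nat (Suc n) powr (- s)))"
    and "(\<Sum>n. of_real (moebius (Suc n)) * of_nat (Suc n) powr (- s)) * zeta s = 1"
proof -
  define A where "A = {1::nat..}"
  define f where "f = (\<lambda>n::nat. of_nat n powr (- s))"
  define m where "m = (\<lambda>n. complex_of_real (moebius n) * f n)"
  have fm: "f (a * b) = f a * f b" for a b
    using powr_times_real[of "of_nat a" "of_nat b" "- s"] by (simp add: f_def)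
  have nf: "norm (f (Suc n)) = real (Suc n) powr (- Re s)" for n
    using norm_of_nat_powr[of "Suc n" "- s"] by (simp add: f_def)
  have sf: "summable (\<lambda>n. norm (f (Suc n)))"
    unfolding nf by (rule summable_Suc_powr) (use s in simp)
  have nm: "norm (m n) \<le> norm (f n)" for n
    using mult_right_mono[OF abs_moebius_le_1, of "norm (f n)" n] by (simp add: m_def norm_mult)
  have sm: "summable (\<lambda>n. norm (m (Suc n)))"
    by (rule summable_comparison_test'[OF sf]) (simp add: nm)
  show "summable (\<lambda>n. norm (of_real (moebius (Suc n)) * of_nat (Suc n) powr (- s)))"
    using sm by (simp add: m_def f_def)
  have bij: "bij_betw Suc UNIV A"
    by (rule bij_betwI[of _ _ _ "\<lambda>n. n - 1"]) (auto simp: A_def)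
  have conv: "g summable_on A \<and> infsum g A = (\<Sum>n. g (Suc n))" if "summable (\<lambda>n. norm (g (Suc n)))" for g :: "nat \<Rightarrow> complex"
  proof -
    have "((\<lambda>n. g (Suc n)) has_sum (\<Sum>n. g (Suc n))) UNIV"
      using norm_summable_imp_has_sum[OF that] summable_norm_cancel[OF that] by (simp add: summable_sums)
    then have "(g has_sum (\<Sum>n. g (Suc n))) A"
      using has_sum_reindex_bij_betw[OF bij, of g] by simp
    then show ?thesis by (auto simp: summable_on_def infsumI)
  qed
  have absA: "(\<lambda>n. norm (g n)) summable_on A" if "summable (\<lambda>n. norm (g (Suc n)))" for g :: "nat \<Rightarrow> complex"
    using summable_on_reindex_bij_betw[OF bij, of "\<lambda>n. norm (g n)"] norm_summable_imp_summable_on[of "\<lambda>n. norm (g (Suc n))"] that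
    by simp
  have zeta: "zeta s = infsum f A"
    using conv[OF sf] zeta_sums[OF s] by (simp add: f_def sums_iff powr_minus divide_inverse)
  have prod_summable: "(\<lambda>(a, b). m a * f b) summable_on A \<times> A"
  proof (rule abs_summable_summable)
    show "(\<lambda>x. norm (case x of (a, b) \<Rightarrow> m a * f b)) summable_on A \<times> A"
      using summable_on_Times_mult[OF absA[OF sm] absA[OF sf]]
      by (simp add: case_prod_unfold norm_mult)
  qed
  define B where "B = Sigma A (\<lambda>n. {d. d dvd n})"
  define h where "h = (\<lambda>(a, b). (a * b, a :: nat))"
  have hbij: "bij_betw h (A \<times> A) B"
  proof (rule bij_betwI[of _ _ _ "\<lambda>(n, d). (d, n div d)"])
    show "h \<in> A \<times> A \<rightarrow> B" by (auto simp: h_def A_def B_def)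
    show "(\<lambda>(n, d). (d, n div d)) \<in> B \<rightarrow> A \<times> A"
      by (auto simp: A_def B_def Suc_le_eq div_greater_zero_iff dest: dvd_imp_le intro: dvd_pos_nat)
    show "(case h x of (n, d) \<Rightarrow> (d, n div d)) = x" if "x \<in> A \<times> A" for x
      using that by (auto simp: h_def A_def)
    show "h (case y of (n, d) \<Rightarrow> (d, n div d)) = y" if "y \<in> B" for y
      using that by (auto simp: h_def B_def)
  qed
  define G where "G = (\<lambda>(n::nat, d). complex_of_real (moebius d) * f n)"
  have Gh: "G (h x) = (case x of (a, b) \<Rightarrow> m a * f b)" for x
    by (auto simp: G_def h_def m_def fm split: prod.split)
  have "infsum m A * infsum f A = infsum (\<lambda>x. m x * infsum f A) A"
    using infsum_cmult_left'[of m "infsum f A" A] by simp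
  also have "\<dots> = infsum (\<lambda>a. infsum (\<lambda>b. m a * f b) A) A"
    by (simp add: infsum_cmult_right')
  also have "\<dots> = infsum (\<lambda>(a, b). m a * f b) (A \<times> A)"
    by (rule infsum_Sigma'_banach[OF prod_summable])
  also have "\<dots> = infsum (\<lambda>x. G (h x)) (A \<times> A)"
    unfolding Gh ..
  also have "\<dots> = infsum G B" by (rule infsum_reindex_bij_betw[OF hbij])
  also have "\<dots> = infsum (\<lambda>n. infsum (\<lambda>d. complex_of_real (moebius d) * f n) {d. d dvd n}) A"
    unfolding B_def G_def
  proof (rule infsum_Sigma'_banach[symmetric])
    have "(\<lambda>x. G (h x)) summable_on A \<times> A" unfolding Gh by (rule prod_summable)
    then have "G summable_on B" using summable_on_reindex_bij_betw[OF hbij, of G] by simp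
    then show "(\<lambda>(n, d). complex_of_real (moebius d) * f n) summable_on (SIGMA n:A. {d. d dvd n})"
      by (simp add: G_def B_def)
  qed
  also have "\<dots> = infsum (\<lambda>n. if n = 1 then 1 else 0) A"
  proof (rule infsum_cong)
    fix n assume "n \<in> A"
    then have n: "n \<ge> 1" by (simp add: A_def)
    have fin: "finite {d. d dvd n}" using n by (intro finite_divisors_nat) simp
    have "infsum (\<lambda>d. complex_of_real (moebius d) * f n) {d. d dvd n} = of_real (\<Sum>d\<in>{d. d dvd n}. moebius d) * f n"
      using fin by (simp add: sum_distrib_right)
    then show "infsum (\<lambda>d. complex_of_real (moebius d) * f n) {d. d dvd n} = (if n = 1 then 1 else 0)"
      unfolding sum_moebius_divisors[OF n] by (simp add: f_def)
  qed
  also have "\<dots> = infsum (\<lambda>n. 1) {1::nat}"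
    by (rule infsum_cong_neutral) (auto simp: A_def)
  also have "\<dots> = (1::complex)" by simp
  finally show "(\<Sum>n. of_real (moebius (Suc n)) * of_nat (Suc n) powr (- s)) * zeta s = 1"
    using conv[OF sm] by (simp add: zeta m_def f_def)
qed

section \<open>The summatory function and Abel summation\<close>

lemma mertens_nat: "mertens (real n) = (\<Sum>k=1..n. moebius k)"
  by (simp add: mertens_def)

lemma mertens_Suc: "mertens (real (Suc n)) = mertens (real n) + moebius (Suc n)"
  by (simp add: mertens_nat del: of_nat_Suc)

lemma mertens_0 [simp]: "mertens 0 = 0"
  by (simp add: mertens_def)

lemma abs_mertens_diff_le: "\<bar>mertens (real (n + k)) - mertens (real n)\<bar> \<le> real k"
proof (induction k)
  case (Suc k)
  then show ?case using mertens_Suc[of "n + k"] abs_moebius_le_1[of "Suc (n + k)"] by simp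
qed simp

lemma abs_mertens_le: "\<bar>mertens (real n)\<bar> \<le> real n"
  using abs_mertens_diff_le[of 0 n] by simp

lemma moebius_abel_summation:
  fixes h :: "nat \<Rightarrow> complex"
  shows "(\<Sum>n<N. of_real (moebius (Suc n)) * h (Suc n)) =
    (\<Sum>n<N. of_real (mertens (real (Suc n))) * (h (Suc n) - h (Suc (Suc n)))) + of_real (mertens (real N)) * h (Suc N)"
proof (induction N)
  case (Suc N)
  have "complex_of_real (mertens (real (Suc N))) = of_real (mertens (real N)) + of_real (moebius (Suc N))"
    by (simp only: mertens_Suc of_real_add)
  then show ?case using Suc by (simp add: algebra_simps del: of_nat_Suc)
qed simp

text \<open>The Dirichlet series of 1/zeta after Abel summation. In this form the hypothesis yields
  absolute convergence for Re s > 1/2.\<close>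

definition mertens_series :: "complex \<Rightarrow> complex" where
  "mertens_series s = (\<Sum>n. of_real (mertens (real (Suc n))) * (of_nat (Suc n) powr (- s) - of_nat (Suc (Suc n)) powr (- s)))"

lemma norm_mertens_term_le:
  assumes "Re s > 0" 
  shows "norm (of_real (mertens (real (Suc n))) * (of_nat (Suc n) powr (- s) - of_nat (Suc (Suc n)) powr (- s)))
     \<le> norm s * (\<bar>mertens (real (Suc n))\<bar> * real (Suc n) powr (- Re s - 1))"
proof -
  have "norm (of_real (real (Suc (Suc n))) powr (- s) - of_real (real (Suc n)) powr (- s)) \<le>
      norm (- s) * real (Suc n) powr (Re (- s) - 1) * (real (Suc (Suc n)) - real (Suc n))"
    by (rule powr_diff_bound) (use assms in auto)
  then have "norm (of_nat (Suc n) powr (- s) - of_nat (Suc (Suc n)) powr (- s)) \<le> norm s * real (Suc n) powr (- Re s - 1)"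
    by (simp add: norm_minus_commute del: of_nat_Suc) (simp add: norm_minus_commute)
  then have "\<bar>mertens (real (Suc n))\<bar> * norm (of_nat (Suc n) powr (- s) - of_nat (Suc (Suc n)) powr (- s))
     \<le> \<bar>mertens (real (Suc n))\<bar> * (norm s * real (Suc n) powr (- Re s - 1))"
    by (rule mult_left_mono) simp
  then show ?thesis by (simp only: norm_mult norm_of_real mult_ac)
qed

lemma mertens_series_eq:
  assumes s: "Re s > 1"
  shows "mertens_series s * zeta s = 1"
proof -
  define h where "h = (\<lambda>n. complex_of_nat n powr (- s))"
  define m where "m = (\<lambda>n. of_real (moebius (Suc n)) * h (Suc n))"
  have "summable m" unfolding m_def h_def
    using moebius_dirichlet_series(1)[OF s] by (rule summable_norm_cancel)
  then have "(\<lambda>N. \<Sum>n<N. m n) \<longlonglongrightarrow> suminf m" by (simp add: summable_LIMSEQ)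
  moreover have "(\<lambda>N. of_real (mertens (real N)) * h (Suc N)) \<longlonglongrightarrow> 0"
  proof (rule Lim_null_comparison[OF always_eventually])
    show "\<forall>N. norm (of_real (mertens (real N)) * h (Suc N)) \<le> real (Suc N) powr (1 - Re s)"
    proof
      fix N
      have "norm (of_real (mertens (real N)) * h (Suc N)) \<le> real (Suc N) * real (Suc N) powr (- Re s)"
        unfolding norm_mult norm_of_real h_def
        using abs_mertens_le[of N] norm_of_nat_powr[of "Suc N" "- s"] by (intro mult_mono) auto
      also have "\<dots> = real (Suc N) powr 1 * real (Suc N) powr (- Re s)" by simp
      also have "\<dots> = real (Suc N) powr (1 - Re s)" by (simp only: powr_add[symmetric]) simp
      finally show "norm (of_real (mertens (real N)) * h (Suc N)) \<le> real (Suc N) powr (1 - Re s)" .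
    qed
    show "(\<lambda>N. real (Suc N) powr (1 - Re s)) \<longlonglongrightarrow> 0" using s by real_asymp
  qed
  ultimately have "(\<lambda>N. (\<Sum>n<N. m n) - of_real (mertens (real N)) * h (Suc N)) \<longlonglongrightarrow> suminf m - 0"
    by (rule tendsto_diff)
  moreover have "(\<Sum>n<N. m n) - of_real (mertens (real N)) * h (Suc N) =
     (\<Sum>n<N. of_real (mertens (real (Suc n))) * (h (Suc n) - h (Suc (Suc n))))" for N
    using moebius_abel_summation[of h N] by (simp add: m_def del: of_nat_Suc)
  ultimately have "(\<lambda>n. of_real (mertens (real (Suc n))) * (h (Suc n) - h (Suc (Suc n)))) sums suminf m"
    by (simp add: sums_def)
  then have "mertens_series s = suminf m"
    unfolding mertens_series_def h_def by (rule sums_unique[symmetric])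
  then show ?thesis using moebius_dirichlet_series(2)[OF s] by (simp add: m_def h_def)
qed

section \<open>Consequences of the weak Mertens hypothesis\<close>

lemma has_integral_mertens_step:
  assumes "n \<ge> 1"
  shows "((\<lambda>x. (mertens x / x)\<^sup>2) has_integral (mertens (real n))\<^sup>2 * (1 / real n - 1 / (real n + 1))) {real n..real n + 1}"
proof -
  define m where "m = mertens (real n)"
  have "((\<lambda>x. (m / x)\<^sup>2) has_integral (- (m\<^sup>2 / (real n + 1)) - - (m\<^sup>2 / real n))) {real n..real n + 1}"
  proof (rule fundamental_theorem_of_calculus)
    fix x assume "x \<in> {real n..real n + 1}"
    then have "x > 0" using assms by auto
    then show "((\<lambda>x. - (m\<^sup>2 / x)) has_vector_derivative (m / x)\<^sup>2) (at x within {real n..real n + 1})"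
      unfolding has_real_derivative_iff_has_vector_derivative[symmetric]
      by (auto intro!: derivative_eq_intros simp: power2_eq_square field_simps)
  qed simp
  also have "- (m\<^sup>2 / (real n + 1)) - - (m\<^sup>2 / real n) = m\<^sup>2 * (1 / real n - 1 / (real n + 1))"
    by (simp add: algebra_simps)
  finally have I: "((\<lambda>x. (m / x)\<^sup>2) has_integral m\<^sup>2 * (1 / real n - 1 / (real n + 1))) {real n..real n + 1}" .
  have eq: "(mertens x / x)\<^sup>2 = (m / x)\<^sup>2" if "x \<in> {real n..real n + 1} - {real n + 1}" for x
  proof -
    have "\<lfloor>x\<rfloor> = int n" using that by (intro floor_unique) auto
    then show ?thesis by (simp add: mertens_def m_def)
  qed
  show ?thesis unfolding m_def[symmetric]
    by (rule has_integral_spike_finite[of "{real n + 1}", OF _ eq I]) simp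
qed

lemma has_integral_mertens:
  "((\<lambda>x. (mertens x / x)\<^sup>2) has_integral (\<Sum>n=1..N. (mertens (real n))\<^sup>2 * (1 / real n - 1 / (real n + 1)))) {1..real N + 1}"
proof (induction N)
  case (Suc N)
  have "((\<lambda>x. (mertens x / x)\<^sup>2) has_integral (\<Sum>n=1..N. (mertens (real n))\<^sup>2 * (1 / real n - 1 / (real n + 1)))
     + (mertens (real (Suc N)))\<^sup>2 * (1 / real (Suc N) - 1 / (real (Suc N) + 1))) {1..real (Suc N) + 1}"
  proof (rule has_integral_combine[where c = "real N + 1"])
    show "((\<lambda>x. (mertens x / x)\<^sup>2) has_integral (mertens (real (Suc N)))\<^sup>2 * (1 / real (Suc N) - 1 / (real (Suc N) + 1))) {real N + 1..real (Suc N) + 1}"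
      using has_integral_mertens_step[of "Suc N"] by (simp add: add.commute)
  qed (use Suc in auto)
  then show ?case by simp
qed (simp add: has_integral_refl)

text \<open>M is constant between integers, and 1/n^2 is at most twice the integral of 1/x^2 over
  [n, n + 1]. The bound \<open>1 + ln (real N)\<close> is positive already at N = 1, so the finitely
  many N below the threshold of the O-estimate can be absorbed into the constant.\<close>

lemma weak_mertens_partial_sums:
  assumes weak_mertens_hypothesis
  obtains C where "C > 0" "\<And>N. N \<ge> 1 \<Longrightarrow> (\<Sum>n=1..N. (mertens (real n))\<^sup>2 / (real n)\<^sup>2) \<le> C * (1 + ln (real N))"
proof -
  define S where "S = (\<lambda>N. \<Sum>n=1..N. (mertens (real n))\<^sup>2 / (real n)\<^sup>2)"
  define I where "I = (\<lambda>X. integral {1..X} (\<lambda>x. (mertens x / x)\<^sup>2))"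
  have "I \<in> O[at_top](\<lambda>X. ln X)" using assms by (simp add: weak_mertens_hypothesis_def I_def)
  then obtain c where c: "c > 0" "\<forall>\<^sub>F X in at_top. norm (I X) \<le> c * norm (ln X)"
    by (elim landau_o.bigE)
  then obtain X0 where X0: "\<And>X. X \<ge> X0 \<Longrightarrow> norm (I X) \<le> c * norm (ln X)"
    by (auto simp: eventually_at_top_linorder)
  define N0 where "N0 = nat \<lceil>X0\<rceil>"
  have mono: "S a \<le> S b" if "a \<le> b" for a b
    unfolding S_def by (rule sum_mono2) (use that in auto)
  have S0: "S N \<ge> 0" for N unfolding S_def by (rule sum_nonneg) auto
  have big: "S N \<le> 2 * c * (1 + ln (real N))" if N: "N \<ge> N0" "N \<ge> 1" for N
  proof -
    have "S N \<le> 2 * I (real N + 1)"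
    proof -
      have "I (real N + 1) = (\<Sum>n=1..N. (mertens (real n))\<^sup>2 * (1 / real n - 1 / (real n + 1)))"
        unfolding I_def by (rule integral_unique[OF has_integral_mertens])
      moreover have "S N \<le> (\<Sum>n=1..N. 2 * ((mertens (real n))\<^sup>2 * (1 / real n - 1 / (real n + 1))))"
        unfolding S_def
      proof (rule sum_mono)
        fix n assume "n \<in> {1..N}"
        then have n: "real n \<ge> 1" by simp
        have "1 / (real n)\<^sup>2 \<le> 2 * (1 / real n - 1 / (real n + 1))"
        proof -
          have "real n * (real n + 1) \<le> 2 * (real n)\<^sup>2" using n by (simp add: power2_eq_square algebra_simps)
          then have "2 / (2 * (real n)\<^sup>2) \<le> 2 / (real n * (real n + 1))" using n by (intro divide_left_mono) auto
          also have "2 / (real n * (real n + 1)) = 2 * (1 / real n - 1 / (real n + 1))" using n by (simp add: field_simps)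
          finally show ?thesis by simp
        qed
        then have "(mertens (real n))\<^sup>2 * (1 / (real n)\<^sup>2) \<le> (mertens (real n))\<^sup>2 * (2 * (1 / real n - 1 / (real n + 1)))"
          by (rule mult_left_mono) simp
        then show "(mertens (real n))\<^sup>2 / (real n)\<^sup>2 \<le> 2 * ((mertens (real n))\<^sup>2 * (1 / real n - 1 / (real n + 1)))"
          by (simp only: mult.left_commute mult_1_right times_divide_eq_right)
      qed
      ultimately show ?thesis by (simp add: sum_distrib_left)
    qed
    also have "I (real N + 1) \<le> c * ln (real N + 1)"
    proof -
      have "real N + 1 \<ge> X0" using N unfolding N0_def by linarith
      from X0[OF this] show ?thesis by simp
    qed
    also have "ln (real N + 1) \<le> 1 + ln (real N)"
    proof -
      have "ln (real N + 1) \<le> ln (2 * real N)" using N by simp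
      also have "\<dots> = ln 2 + ln (real N)" using N by (simp add: ln_mult)
      also have "ln (2::real) \<le> 1" using ln_le_minus_one[of 2] by simp
      finally show ?thesis by simp
    qed
    finally show ?thesis using c(1) by simp
  qed
  define C where "C = 2 * c + S N0"
  have "S N \<le> C * (1 + ln (real N))" if N: "N \<ge> 1" for N
  proof (cases "N \<ge> N0")
    case True
    have "2 * c * (1 + ln (real N)) \<le> C * (1 + ln (real N))"
      using N S0[of N0] by (intro mult_right_mono) (auto simp: C_def add_nonneg_nonneg)
    then show ?thesis using big[OF True N] by linarith
  next
    case False
    have "S N \<le> S N0" using False by (intro mono) simp
    also have "\<dots> \<le> C * 1" using c by (simp add: C_def)
    also have "\<dots> \<le> C * (1 + ln (real N))" using N c S0[of N0] by (intro mult_left_mono) (auto simp: C_def)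
    finally show ?thesis .
  qed
  moreover have "C > 0" using c S0[of N0] by (simp add: C_def add_pos_nonneg)
  ultimately show thesis using that unfolding S_def by blast
qed

text \<open>Abel summation, carried out as an induction: the subtracted term
  \<open>(1 + ln N + 1 / d) * N powr - d\<close> is the integral of \<open>(1 + ln x) * d * x powr (- d - 1)\<close> over \<open>x > N\<close>.\<close>

lemma weighted_sum_bound:
  fixes c :: "nat \<Rightarrow> real"
  assumes S: "\<And>N. N \<ge> 1 \<Longrightarrow> (\<Sum>n=1..N. c n) \<le> C * (1 + ln (real N))" and C: "C \<ge> 0" and d: "d > 0" and N: "N \<ge> 1"
  shows "(\<Sum>n=1..N. c n * real n powr (- d)) \<le> C * (1 + 1 / d)"
proof -
  have "(\<Sum>n=1..N. c n * real n powr (- d)) \<le> (\<Sum>n=1..N. c n) * real N powr (- d) + C * (1 + 1 / d)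
      - C * (1 + ln (real N) + 1 / d) * real N powr (- d)"
    using N
  proof (induction N rule: dec_induct)
    case base
    then show ?case by simp
  next
    case (step n)
    define u v where "u = ln (real n)" "v = ln (real (Suc n))"
    define a b where "a = real n powr (- d)" "b = real (Suc n) powr (- d)"
    have uv: "u \<le> v" using step by (simp add: u_v_def)
    have ab: "a = exp (- d * u)" "b = exp (- d * v)" using step by (auto simp: a_b_def u_v_def powr_def)
    have "b \<le> a" using uv d by (simp add: ab)
    \<comment> \<open>The right side is the integral of exp(- d x) over [u, v], the left side the
      length of the interval times the minimum.\<close>
    have key: "(v - u) * b \<le> (a - b) / d"
    proof -
      have "1 + d * (v - u) \<le> exp (d * (v - u))" by (rule exp_ge_add_one_self)
      then have "(1 + d * (v - u)) * b \<le> exp (d * (v - u)) * b" by (rule mult_right_mono) (simp add: ab)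
      also have "exp (d * (v - u)) * b = a" by (simp add: ab algebra_simps flip: exp_add)
      finally show ?thesis using d by (simp add: field_simps)
    qed
    define S where "S = (\<Sum>n=1..n. c n)"
    define A where "A = (\<Sum>n=1..n. c n * real n powr (- d))"
    have IH: "A \<le> S * a + C * (1 + 1 / d) - C * (1 + u + 1 / d) * a"
      using step by (simp add: A_def S_def a_b_def u_v_def)
    have 1: "S * (a - b) \<le> C * (1 + u) * (a - b)"
      using assms(1)[of n] step \<open>b \<le> a\<close> by (intro mult_right_mono) (auto simp: S_def u_v_def)
    have 2: "C * ((v - u) * b) \<le> C * ((a - b) / d)" using key C by (rule mult_left_mono)
    \<comment> \<open>The inequality to be proved is linear once the products are treated as
      independent variables.\<close>
    have aux: "A + x \<le> q + x + E - (r + t + w)"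
      if "A \<le> p + E - (k + l + y)" "p - q \<le> k + l - r - z" "t - z \<le> y - w" for p q k l y r z t w x E :: real
      using that by linarith
    have "A + c (Suc n) * b \<le> S * b + c (Suc n) * b + C * (1 + 1 / d) - (C * b + C * v * b + C / d * b)"
    proof (rule aux)
      show "A \<le> S * a + C * (1 + 1 / d) - (C * a + C * u * a + C / d * a)" using IH by (simp add: algebra_simps)
      show "S * a - S * b \<le> C * a + C * u * a - C * b - C * u * b" using 1 by (simp add: algebra_simps)
      show "C * v * b - C * u * b \<le> C / d * a - C / d * b" using 2 by (simp add: algebra_simps diff_divide_distrib)
    qed
    also have "\<dots> = (S + c (Suc n)) * b + C * (1 + 1 / d) - C * (1 + v + 1 / d) * b"
      by (simp add: algebra_simps)
    finally have "A + c (Suc n) * b \<le> (S + c (Suc n)) * b + C * (1 + 1 / d) - C * (1 + v + 1 / d) * b" .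
    then show ?case using step by (simp add: A_def S_def a_b_def u_v_def)
  qed
  also have "\<dots> \<le> C * (1 + 1 / d)"
  proof -
    have "(\<Sum>n=1..N. c n) * real N powr (- d) \<le> C * (1 + ln (real N)) * real N powr (- d)"
      by (intro mult_right_mono S N) auto
    also have "\<dots> \<le> C * (1 + ln (real N) + 1 / d) * real N powr (- d)"
      using C d by (intro mult_right_mono mult_left_mono) auto
    finally show ?thesis by simp
  qed
  finally show ?thesis .
qed

lemma harmonic_sum_le: "N \<ge> 1 \<Longrightarrow> (\<Sum>n=1..N. 1 / real n) \<le> 1 + ln (real N)"
proof (induction N rule: dec_induct)
  case (step n)
  have "ln (real n / real (Suc n)) \<le> real n / real (Suc n) - 1" using step by (intro ln_le_minus_one) auto
  then have "1 / real (Suc n) \<le> ln (real (Suc n)) - ln (real n)"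
    using step by (simp add: ln_div field_simps)
  then show ?case using step by (simp del: of_nat_Suc)
qed simp

lemma mertens_abs_series:
  assumes weak_mertens_hypothesis
  obtains K where "K > 0"
    "\<And>d. 0 < d \<Longrightarrow> d \<le> 1 \<Longrightarrow> summable (\<lambda>n. \<bar>mertens (real (Suc n))\<bar> * real (Suc n) powr (- (3/2) - d))"
    "\<And>d. 0 < d \<Longrightarrow> d \<le> 1 \<Longrightarrow> (\<Sum>n. \<bar>mertens (real (Suc n))\<bar> * real (Suc n) powr (- (3/2) - d)) \<le> K / d"
proof -
  obtain C where C: "C > 0" "\<And>N. N \<ge> 1 \<Longrightarrow> (\<Sum>n=1..N. (mertens (real n))\<^sup>2 / (real n)\<^sup>2) \<le> C * (1 + ln (real N))"
    using weak_mertens_partial_sums[OF assms] by blast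
  define f where "f = (\<lambda>d n. \<bar>mertens (real n)\<bar> * real n powr (- (3/2) - d))"
  have part: "(\<Sum>n<N. f d (Suc n)) \<le> (C + 1) / d" if d: "0 < d" "d \<le> 1" for d N
  proof (cases "N \<ge> 1")
    case True
    have "(\<Sum>n<N. f d (Suc n)) = (\<Sum>n=1..N. f d n)"
      by (rule sum.reindex_bij_witness[of _ "\<lambda>n. n - 1" Suc]) auto
    also have "\<dots> \<le> (\<Sum>n=1..N. ((mertens (real n))\<^sup>2 / (real n)\<^sup>2 * real n powr (- d) + 1 / real n * real n powr (- d)) / 2)"
    proof (rule sum_mono)
      fix n assume "n \<in> {1..N}"
      then have n: "real n \<ge> 1" by simp
      \<comment> \<open>The summand is a b n^(- d). The part with a^2 is summed by the hypothesis
        and the part with b^2 = 1/n by the harmonic sum, both through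
        \<open>weighted_sum_bound\<close>.\<close>
      define a b where "a = \<bar>mertens (real n)\<bar> / real n" "b = real n powr (- (1/2))"
      have b2: "b\<^sup>2 = 1 / real n"
      proof -
        have "b\<^sup>2 = real n powr (- (1/2) + - (1/2))" unfolding powr_add by (simp add: a_b_def power2_eq_square)
        then show ?thesis using n by (simp add: powr_minus_divide)
      qed
      have "0 \<le> (a - b)\<^sup>2" by simp
      then have "a * b \<le> (a\<^sup>2 + b\<^sup>2) / 2" by (simp add: power2_diff)
      then have "a * b * real n powr (- d) \<le> (a\<^sup>2 + b\<^sup>2) / 2 * real n powr (- d)" by (rule mult_right_mono) simp
      moreover have "f d n = a * b * real n powr (- d)"
      proof -
        have "real n powr (- (3/2) - d) = real n powr (-1 + (- (1/2) + (- d)))" by simp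
        also have "\<dots> = 1 / real n * (b * real n powr (- d))"
          unfolding powr_add using n by (simp add: a_b_def powr_minus_divide)
        finally show ?thesis by (simp add: f_def a_b_def)
      qed
      moreover have "a\<^sup>2 = (mertens (real n))\<^sup>2 / (real n)\<^sup>2" by (simp add: a_b_def power_divide)
      ultimately show "f d n \<le> ((mertens (real n))\<^sup>2 / (real n)\<^sup>2 * real n powr (- d) + 1 / real n * real n powr (- d)) / 2"
        by (simp add: b2 algebra_simps)
    qed
    also have "\<dots> = ((\<Sum>n=1..N. (mertens (real n))\<^sup>2 / (real n)\<^sup>2 * real n powr (- d)) + (\<Sum>n=1..N. 1 / real n * real n powr (- d))) / 2"
      by (simp only: sum_divide_distrib[symmetric] sum.distrib)
    also have "\<dots> \<le> (C * (1 + 1 / d) + 1 * (1 + 1 / d)) / 2"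
    proof -
      have "(\<Sum>n=1..N. (mertens (real n))\<^sup>2 / (real n)\<^sup>2 * real n powr (- d)) \<le> C * (1 + 1 / d)"
        by (rule weighted_sum_bound[OF C(2) less_imp_le[OF C(1)] d(1) True])
      moreover have "(\<Sum>n=1..N. 1 / real n * real n powr (- d)) \<le> 1 * (1 + 1 / d)"
        by (rule weighted_sum_bound[OF _ _ d(1) True]) (use harmonic_sum_le in auto)
      ultimately show ?thesis by (intro divide_right_mono add_mono) (assumption | simp)+
    qed
    also have "\<dots> = (C + 1) * ((1 + 1 / d) / 2)" by (simp only: distrib_right times_divide_eq_right)
    also have "\<dots> \<le> (C + 1) * (1 / d)" using C d by (intro mult_left_mono) (auto simp: field_simps)
    finally show ?thesis by simp
  qed (use C d in \<open>simp add: not_le\<close>)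
  have f0: "0 \<le> f d (Suc n)" for d n by (simp add: f_def)
  have sm: "summable (\<lambda>n. f d (Suc n))" if d: "0 < d" "d \<le> 1" for d
    by (rule summableI_nonneg_bounded[OF f0 part[OF d]])
  moreover have "(\<Sum>n. f d (Suc n)) \<le> (C + 1) / d" if d: "0 < d" "d \<le> 1" for d
    by (rule suminf_le_const[OF sm[OF d] part[OF d]])
  ultimately show thesis using that[of "C + 1"] C by (simp add: f_def del: of_nat_Suc)
qed

text \<open>This is for the boundary term of the Abel summation in F, where the trivial bound |M(N)|
  <= N does not suffice. A large value of |M| persists on a block of consecutive integers, so the
  mean square bound makes (|M(N)| / N)^3 at most of order log N / N.\<close>

lemma mertens_over_n_tendsto_0:
  assumes weak_mertens_hypothesis
  shows "(\<lambda>N. mertens (real N) / real N) \<longlonglongrightarrow> 0"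
proof -
  obtain C where C: "C > 0" "\<And>N. N \<ge> 1 \<Longrightarrow> (\<Sum>n=1..N. (mertens (real n))\<^sup>2 / (real n)\<^sup>2) \<le> C * (1 + ln (real N))"
    using weak_mertens_partial_sums[OF assms] by blast
  text \<open>If \<open>\<bar>M N\<bar> = m\<close>, then \<open>\<bar>M n\<bar> \<ge> m / 2\<close> for \<open>N \<le> n \<le> N + m / 2\<close>, because \<open>M\<close> changes by at most 1 in each step.\<close>
  have cube: "\<bar>mertens (real N) / real N\<bar> ^ 3 \<le> 32 * C * (1 + ln (2 * real N)) / real N" if N: "N \<ge> 1" for N
  proof -
    define m where "m = \<bar>mertens (real N)\<bar>"
    define k where "k = nat \<lfloor>m / 2\<rfloor>"
    have m: "0 \<le> m" "m \<le> real N" using abs_mertens_le[of N] by (auto simp: m_def)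
    have k: "real k \<le> m / 2" "m / 2 \<le> real (Suc k)" using m by (auto simp: k_def) linarith+
    then have kN: "N + k \<le> 2 * N" using m by linarith
    define D where "D = m\<^sup>2 / 4 / (4 * (real N)\<^sup>2)"
    have "real (Suc k) * D = (\<Sum>n\<in>{N..N + k}. D)" by simp
    also have "\<dots> \<le> (\<Sum>n\<in>{N..N + k}. (mertens (real n))\<^sup>2 / (real n)\<^sup>2)"
    proof (rule sum_mono)
      fix n assume n: "n \<in> {N..N + k}"
      then obtain j where j: "n = N + j" "j \<le> k" using nat_le_iff_add by auto
      have "m - \<bar>mertens (real n)\<bar> \<le> real j" using abs_mertens_diff_le[of N j] unfolding j m_def by linarith
      then have "m / 2 \<le> \<bar>mertens (real n)\<bar>" using j(2) k(1) by linarith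
      then have "(m / 2)\<^sup>2 \<le> \<bar>mertens (real n)\<bar>\<^sup>2" using m by (intro power_mono) auto
      then have 1: "m\<^sup>2 / 4 \<le> (mertens (real n))\<^sup>2" by (simp add: power_divide)
      have "real n \<le> 2 * real N" using j(2) j(1) kN by linarith
      then have "(real n)\<^sup>2 \<le> (2 * real N)\<^sup>2" by (intro power_mono) auto
      then show "D \<le> (mertens (real n))\<^sup>2 / (real n)\<^sup>2"
        unfolding D_def using 1 n N by (intro frac_le) auto
    qed
    also have "\<dots> \<le> (\<Sum>n=1..2 * N. (mertens (real n))\<^sup>2 / (real n)\<^sup>2)"
      using kN N by (intro sum_mono2) auto
    also have "\<dots> \<le> C * (1 + ln (2 * real N))" using C(2)[of "2 * N"] N by simp
    finally have 2: "real (Suc k) * D \<le> C * (1 + ln (2 * real N))" .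
    have "m / 2 * D \<le> real (Suc k) * D"
      using k by (intro mult_right_mono) (auto simp: D_def)
    with 2 have "m / 2 * D \<le> C * (1 + ln (2 * real N))" by linarith
    moreover have "m / 2 * D = m ^ 3 / (32 * (real N)\<^sup>2)"
      by (simp add: D_def power2_eq_square power3_eq_cube)
    ultimately have "m ^ 3 / (32 * (real N)\<^sup>2) * (32 / real N) \<le> C * (1 + ln (2 * real N)) * (32 / real N)"
      by (intro mult_right_mono) auto
    also have "m ^ 3 / (32 * (real N)\<^sup>2) * (32 / real N) = (m / real N) ^ 3"
      by (simp add: power_divide power2_eq_square power3_eq_cube)
    also have "m / real N = \<bar>mertens (real N) / real N\<bar>" by (simp add: m_def)
    finally show ?thesis by (simp only: times_divide_eq_right mult_ac)
  qed
  have "(\<lambda>N. \<bar>mertens (real N) / real N\<bar> ^ 3) \<longlonglongrightarrow> 0"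
  proof (rule Lim_null_comparison)
    show "\<forall>\<^sub>F N in sequentially. norm (\<bar>mertens (real N) / real N\<bar> ^ 3) \<le> 32 * C * (1 + ln (2 * real N)) / real N"
      using eventually_ge_at_top[of 1] by eventually_elim (use cube in \<open>simp del: power_divide\<close>)
    show "(\<lambda>N. 32 * C * (1 + ln (2 * real N)) / real N) \<longlonglongrightarrow> 0" by real_asymp
  qed
  then have "(\<lambda>N. root 3 (\<bar>mertens (real N) / real N\<bar> ^ 3)) \<longlonglongrightarrow> root 3 0" by (rule tendsto_real_root)
  then have "(\<lambda>N. \<bar>mertens (real N) / real N\<bar>) \<longlonglongrightarrow> 0" by (simp add: odd_real_root_power_cancel)
  then show ?thesis by (rule tendsto_rabs_zero_cancel)
qed

lemma mertens_series_bound: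
  assumes weak_mertens_hypothesis
  obtains K where "K > 0" "\<And>s. 1/2 < Re s \<Longrightarrow> Re s \<le> 3/2 \<Longrightarrow> norm (mertens_series s) \<le> K * norm s / (Re s - 1/2)"
proof -
  obtain K where K: "K > 0"
    "\<And>d. 0 < d \<Longrightarrow> d \<le> 1 \<Longrightarrow> summable (\<lambda>n. \<bar>mertens (real (Suc n))\<bar> * real (Suc n) powr (- (3/2) - d))"
    "\<And>d. 0 < d \<Longrightarrow> d \<le> 1 \<Longrightarrow> (\<Sum>n. \<bar>mertens (real (Suc n))\<bar> * real (Suc n) powr (- (3/2) - d)) \<le> K / d"
    using mertens_abs_series[OF assms] by blast
  have "norm (mertens_series s) \<le> K * norm s / (Re s - 1/2)" if s: "1/2 < Re s" "Re s \<le> 3/2" for s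
  proof -
    define d where "d = Re s - 1/2"
    have d: "0 < d" "d \<le> 1" using s by (auto simp: d_def)
    have e: "- Re s - 1 = - (3/2) - d" by (simp add: d_def)
    have b: "norm (of_real (mertens (real (Suc n))) * (of_nat (Suc n) powr (- s) - of_nat (Suc (Suc n)) powr (- s)))
      \<le> norm s * (\<bar>mertens (real (Suc n))\<bar> * real (Suc n) powr (- (3/2) - d))" for n
      using norm_mertens_term_le[of s n] s unfolding e by simp
    have "norm (mertens_series s) \<le> (\<Sum>n. norm s * (\<bar>mertens (real (Suc n))\<bar> * real (Suc n) powr (- (3/2) - d)))"
      unfolding mertens_series_def by (rule norm_suminf_le[OF b summable_mult[OF K(2)[OF d]]])
    also have "\<dots> = norm s * (\<Sum>n. \<bar>mertens (real (Suc n))\<bar> * real (Suc n) powr (- (3/2) - d))"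
      by (rule suminf_mult[OF K(2)[OF d]])
    also have "\<dots> \<le> norm s * (K / d)" by (intro mult_left_mono K(3)[OF d]) simp
    finally show ?thesis by (simp add: d_def mult_ac)
  qed
  then show thesis using K(1) that by blast
qed

lemma mertens_series_holomorphic:
  assumes weak_mertens_hypothesis
  shows "mertens_series holomorphic_on {s. Re s > 1/2}"
  unfolding mertens_series_def
proof (rule holomorphic_suminf)
  show "open {s. Re s > 1/2}" by (rule open_halfspace_Re_gt)
  show "(\<lambda>s. of_real (mertens (real (Suc n))) * (of_nat (Suc n) powr (- s) - of_nat (Suc (Suc n)) powr (- s))) holomorphic_on {s. Re s > 1/2}" for n
    by (intro holomorphic_intros)
  obtain K where K: "K > 0"
    "\<And>d. 0 < d \<Longrightarrow> d \<le> 1 \<Longrightarrow> summable (\<lambda>n. \<bar>mertens (real (Suc n))\<bar> * real (Suc n) powr (- (3/2) - d))"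
    "\<And>d. 0 < d \<Longrightarrow> d \<le> 1 \<Longrightarrow> (\<Sum>n. \<bar>mertens (real (Suc n))\<bar> * real (Suc n) powr (- (3/2) - d)) \<le> K / d"
    using mertens_abs_series[OF assms] by blast
  fix x assume x: "x \<in> {s. Re s > 1/2}"
  \<comment> \<open>The cap at 1 is the range in which the majorant is available; the half leaves
    room to move within the ball.\<close>
  define d where "d = min 1 ((Re x - 1/2) / 2)"
  have d: "0 < d" "d \<le> 1" "2 * d \<le> Re x - 1/2" using x by (auto simp: d_def min_def)
  have Re: "Re y \<ge> 1/2 + d" if "y \<in> cball x d" for y
    using abs_Re_le_cmod[of "x - y"] that d by (auto simp: dist_norm)
  define M where "M = (\<lambda>n. (norm x + d) * (\<bar>mertens (real (Suc n))\<bar> * real (Suc n) powr (- (3/2) - d)))"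
  have "norm (of_real (mertens (real (Suc n))) * (of_nat (Suc n) powr (- y) - of_nat (Suc (Suc n)) powr (- y))) \<le> M n"
    if y: "y \<in> cball x d" for n y
  proof -
    have ny: "norm y \<le> norm x + d" using y norm_triangle_sub[of y x] by (simp add: dist_norm norm_minus_commute)
    have "norm (of_real (mertens (real (Suc n))) * (of_nat (Suc n) powr (- y) - of_nat (Suc (Suc n)) powr (- y)))
       \<le> norm y * (\<bar>mertens (real (Suc n))\<bar> * real (Suc n) powr (- Re y - 1))"
      by (rule norm_mertens_term_le) (use Re[OF y] d in linarith)
    also have "\<dots> \<le> M n" unfolding M_def
      using ny Re[OF y] d by (intro mult_mono powr_mono) auto
    finally show ?thesis .
  qed
  moreover have "summable M" unfolding M_def by (intro summable_mult K(2) d)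
  moreover have "cball x d \<subseteq> {s. Re s > 1/2}" using Re d by force
  ultimately show "\<exists>d>0. \<exists>M. cball x d \<subseteq> {s. Re s > 1/2} \<and> summable M \<and>
      (\<forall>n. \<forall>y\<in>cball x d. norm (of_real (mertens (real (Suc n))) * (of_nat (Suc n) powr (- y) - of_nat (Suc (Suc n)) powr (- y))) \<le> M n)"
    using d by blast
qed

text \<open>Stated with \<open>zeta_reg\<close>, the relation between \<open>mertens_series\<close>
  and 1/zeta also covers s = 1. Away from that point it excludes zeros with Re s > 1/2.\<close>

lemma mertens_series_zeta_reg:
  assumes weak_mertens_hypothesis and s: "Re s > 1/2"
  shows "mertens_series s * zeta_reg s = s - 1"
proof (rule analytic_continuation_open[where s = "{s. Re s > 1}" and s' = "{s. Re s > 1/2}" and f = "\<lambda>s. mertens_series s * zeta_reg s"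
        and g = "\<lambda>s. s - 1"])
  have "2 \<in> {s :: complex. Re s > 1}" by simp
  then show "{s :: complex. Re s > 1} \<noteq> {}" by blast
  show "connected {s. Re s > 1/2}" by (intro convex_connected convex_halfspace_Re_gt)
  show "open {s. Re s > 1}" "open {s. Re s > 1/2}" by (rule open_halfspace_Re_gt)+
  show "(\<lambda>s. mertens_series s * zeta_reg s) holomorphic_on {s. Re s > 1/2}"
    by (intro holomorphic_intros mertens_series_holomorphic assms holomorphic_on_subset[OF zeta_reg_holomorphic]) auto
  show "mertens_series z * zeta_reg z = z - 1" if "z \<in> {s. Re s > 1}" for z
  proof -
    have "z \<noteq> 1" using that by auto
    then show ?thesis using mertens_series_eq[of z] zeta_reg_eq[of z] that
      by (simp add: mult.left_commute)
  qed
  show "(\<lambda>s. s - 1) holomorphic_on {s. Re s > 1/2}" by (intro holomorphic_intros)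
  show "{s. Re s > 1} \<subseteq> {s. Re s > 1/2}" by auto
  show "s \<in> {s. Re s > 1/2}" using s by simp
qed

section \<open>The zeros under the weak Mertens hypothesis\<close>

lemma zeta_reg_cnj:
  assumes "Re s > 0"
  shows "zeta_reg (cnj s) = cnj (zeta_reg s)"
proof -
  have t: "zeta_term (Suc n) (cnj s) = cnj (zeta_term (Suc n) s)" for n
  proof -
    have p: "cnj (of_nat (Suc k) powr w) = of_nat (Suc k) powr cnj w" for k w
      by (subst cnj_powr) (auto simp: complex_is_Real_iff)
    show ?thesis unfolding zeta_term_def by (simp add: p del: of_nat_Suc)
  qed
  have "(\<lambda>n. zeta_term (Suc n) s) sums (\<Sum>n. zeta_term (Suc n) s)"
    using summable_norm_cancel[OF summable_zeta_term[OF assms]] by (rule summable_sums)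
  then have "(\<lambda>n. cnj (zeta_term (Suc n) s)) sums cnj (\<Sum>n. zeta_term (Suc n) s)"
    by (simp add: sums_cnj)
  then show ?thesis by (simp add: zeta_reg_def t sums_iff)
qed

lemma deriv_zeta_reg_cnj:
  assumes "Re s > 0"
  shows "deriv zeta_reg (cnj s) = cnj (deriv zeta_reg s)"
proof -
  have "(zeta_reg has_field_derivative deriv zeta_reg s) (at s)"
    by (rule holomorphic_derivI[OF zeta_reg_holomorphic]) (use assms in \<open>auto intro: open_halfspace_Re_gt\<close>)
  then have d: "(cnj \<circ> zeta_reg \<circ> cnj has_field_derivative cnj (deriv zeta_reg s)) (at (cnj s))"
    using has_field_derivative_cnj_cnj[of zeta_reg "deriv zeta_reg s" "cnj s"] by simp
  have "(zeta_reg has_field_derivative cnj (deriv zeta_reg s)) (at (cnj s))"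
  proof (rule has_field_derivative_transform_within_open[OF d, where S = "{s. Re s > 0}"])
    show "open {s. Re s > 0}" by (rule open_halfspace_Re_gt)
    show "(cnj \<circ> zeta_reg \<circ> cnj) x = zeta_reg x" if "x \<in> {s. Re s > 0}" for x
      using that zeta_reg_cnj[of "cnj x"] by simp
  qed (use assms in simp)
  then show ?thesis by (rule DERIV_imp_deriv)
qed

text \<open>Ordinates of both signs. The definition refers to the critical line only; that these are
  all the nontrivial zeros under the hypothesis is \<open>nontrivial_zeros_eq\<close>.\<close>

definition zero_ordinates :: "real set" where
  "zero_ordinates = {\<gamma>. zeta_reg (Complex (1/2) \<gamma>) = 0}"

lemma uminus_zero_ordinates_iff [simp]: "- \<gamma> \<in> zero_ordinates \<longleftrightarrow> \<gamma> \<in> zero_ordinates"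
proof -
  have "Complex (1/2) (- \<gamma>) = cnj (Complex (1/2) \<gamma>)" by (simp add: complex_eq_iff)
  then show ?thesis using zeta_reg_cnj[of "Complex (1/2) \<gamma>"] by (simp add: zero_ordinates_def)
qed

lemma zero_notin_zero_ordinates: "0 \<notin> zero_ordinates"
proof -
  have e: "Complex (1/2) 0 = 1/2" by (simp add: complex_eq_iff)
  show ?thesis using zeta_reg_half_nonzero unfolding zero_ordinates_def mem_Collect_eq e .
qed

lemma deriv_zeta_reg:
  assumes "Re s > 0" "s \<noteq> 1" "zeta s = 0"
  shows "deriv zeta_reg s = (s - 1) * deriv zeta s"
proof -
  have op: "open ({s. Re s > 0} - {1})" by (intro open_Diff open_halfspace_Re_gt) auto
  have "(zeta has_field_derivative deriv zeta s) (at s)"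
    by (rule holomorphic_derivI[OF zeta_holomorphic]) (use assms in auto)
  then have "((\<lambda>s. (s - 1) * zeta s) has_field_derivative (s - 1) * deriv zeta s) (at s)"
    using assms(3) by (auto intro!: derivative_eq_intros)
  then have "(zeta_reg has_field_derivative (s - 1) * deriv zeta s) (at s)"
    by (rule has_field_derivative_transform_within_open[OF _ op]) (use assms zeta_reg_eq in auto)
  then show ?thesis by (rule DERIV_imp_deriv)
qed

lemma zero_coeff_eq:
  assumes "\<gamma> \<in> zero_ordinates"
  shows "zero_coeff \<gamma> = Gamma (Complex (1/4) (- \<gamma>/2)) * (Complex (1/2) \<gamma> - 1) / deriv zeta_reg (Complex (1/2) \<gamma>)"
proof -
  define s where "s = Complex (1/2) \<gamma>"
  have s: "Re s > 0" "s \<noteq> 1" by (auto simp: s_def complex_eq_iff)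
  have "zeta s = 0" using assms zeta_reg_eq[OF s] s(2) by (simp add: zero_ordinates_def s_def)
  from deriv_zeta_reg[OF s this] have "deriv zeta_reg s = (s - 1) * deriv zeta s" .
  moreover have "1/2 + \<i> * of_real \<gamma> = s" "1/4 - \<i> * of_real \<gamma> / 2 = Complex (1/4) (- \<gamma>/2)"
    by (auto simp: s_def complex_eq_iff)
  ultimately show ?thesis using s(2) by (simp add: zero_coeff_def s_def)
qed

lemma norm_zero_coeff_uminus:
  assumes "\<gamma> \<in> zero_ordinates"
  shows "norm (zero_coeff (- \<gamma>)) = norm (zero_coeff \<gamma>)"
proof -
  have e: "Complex (1/2) (- \<gamma>) = cnj (Complex (1/2) \<gamma>)" "Complex (1/4) (- (- \<gamma>) / 2) = cnj (Complex (1/4) (- \<gamma>/2))"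
    by (simp_all add: complex_eq_iff)
  have "norm (cnj (Complex (1/2) \<gamma>) - 1) = norm (Complex (1/2) \<gamma> - 1)"
    by (simp add: cmod_def)
  then show ?thesis
    unfolding zero_coeff_eq[OF assms] zero_coeff_eq[OF iffD2[OF uminus_zero_ordinates_iff assms]] e
    by (simp add: norm_mult norm_divide deriv_zeta_reg_cnj flip: cnj_Gamma)
qed

context
  assumes wmh: weak_mertens_hypothesis
begin

lemma zeta_reg_nonzero_right: "Re s > 1/2 \<Longrightarrow> zeta_reg s \<noteq> 0"
proof (cases "s = 1")
  case False
  assume "Re s > 1/2"
  from mertens_series_zeta_reg[OF wmh this] show ?thesis using False by (metis mult_zero_right right_minus_eq)
qed (simp add: zeta_reg_1)

text \<open>The functional equation would reflect such a zero to the right of the critical line,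
  where there is none, since \<open>rGamma (s / 2)\<close> does not vanish.\<close>

lemma zeta_nonzero_left:
  assumes "0 < Re s" "Re s < 1/2"
  shows "zeta s \<noteq> 0"
proof
  assume z: "zeta s = 0"
  have s: "s \<noteq> 0" "s \<noteq> 1" using assms by auto
  have "zeta (1 - s) \<noteq> 0" using zeta_reg_nonzero_right[of "1 - s"] zeta_reg_eq[of "1 - s"] assms s by auto
  moreover have "rGamma (s / 2) \<noteq> 0" unfolding rGamma_eq_zero_iff
    by (rule not_nonpos_Int_if_Re_pos) (use assms in simp)
  ultimately show False using zeta_functional_equation[OF s] z by simp
qed

lemma nontrivial_zeros_eq: "nontrivial_zeros = Complex (1/2) ` zero_ordinates"
proof
  show "nontrivial_zeros \<subseteq> Complex (1/2) ` zero_ordinates"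
  proof
    fix s assume s: "s \<in> nontrivial_zeros"
    then have s': "0 < Re s" "Re s < 1" "zeta s = 0" "s \<noteq> 1" by (auto simp: nontrivial_zeros_def)
    then have Z: "zeta_reg s = 0" by (simp add: zeta_reg_eq)
    have "\<not> Re s < 1/2" using zeta_nonzero_left s' by blast
    moreover have "\<not> Re s > 1/2" using zeta_reg_nonzero_right Z by blast
    ultimately have "s = Complex (1/2) (Im s)" by (simp add: complex_eq_iff)
    then show "s \<in> Complex (1/2) ` zero_ordinates" using Z by (auto simp: zero_ordinates_def intro!: image_eqI)
  qed
  show "Complex (1/2) ` zero_ordinates \<subseteq> nontrivial_zeros"
  proof safe
    fix \<gamma> assume g: "\<gamma> \<in> zero_ordinates"
    have "Complex (1/2) \<gamma> \<noteq> 1" by (simp add: complex_eq_iff)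
    then have "zeta (Complex (1/2) \<gamma>) = 0" using g zeta_reg_eq[of "Complex (1/2) \<gamma>"] by (simp add: zero_ordinates_def)
    then show "Complex (1/2) \<gamma> \<in> nontrivial_zeros" by (simp add: nontrivial_zeros_def)
  qed
qed

lemma positive_ordinates_eq: "positive_ordinates = {\<gamma> \<in> zero_ordinates. \<gamma> > 0}"
  by (auto simp: positive_ordinates_def nontrivial_zeros_eq)

lemma zeta_reg_lower_bound:
  obtains K where "K > 0"
    "\<And>s. 1/2 < Re s \<Longrightarrow> Re s \<le> 3/2 \<Longrightarrow> norm (s - 1) * (Re s - 1/2) \<le> K * norm s * norm (zeta_reg s)"
proof -
  obtain K where K: "K > 0" "\<And>s. 1/2 < Re s \<Longrightarrow> Re s \<le> 3/2 \<Longrightarrow> norm (mertens_series s) \<le> K * norm s / (Re s - 1/2)"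
    using mertens_series_bound[OF wmh] by blast
  have "norm (s - 1) * (Re s - 1/2) \<le> K * norm s * norm (zeta_reg s)" if s: "1/2 < Re s" "Re s \<le> 3/2" for s
  proof -
    have "norm (s - 1) = norm (mertens_series s) * norm (zeta_reg s)"
      using mertens_series_zeta_reg[OF wmh, of s] s by (simp flip: norm_mult)
    also have "\<dots> \<le> K * norm s / (Re s - 1/2) * norm (zeta_reg s)"
      by (intro mult_right_mono K(2) s) simp
    finally have "norm (s - 1) * (Re s - 1/2) \<le> K * norm s / (Re s - 1/2) * norm (zeta_reg s) * (Re s - 1/2)"
      using s by (intro mult_right_mono) auto
    also have "\<dots> = K * norm s * norm (zeta_reg s)" using s by simp
    finally show ?thesis .
  qed
  then show thesis using K(1) that by blast
qed

text \<open>For \<open>zeta_reg\<close> the bound is a constant: on the critical line |s - 1| = |s|,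
  so the two factors of \<open>zeta_reg_lower_bound\<close> cancel in the limit.\<close>

lemma deriv_zeta_reg_lower_bound:
  obtains c where "c > 0" "\<And>\<gamma>. \<gamma> \<in> zero_ordinates \<Longrightarrow> c \<le> norm (deriv zeta_reg (Complex (1/2) \<gamma>))"
proof -
  obtain K where K: "K > 0"
    "\<And>s. 1/2 < Re s \<Longrightarrow> Re s \<le> 3/2 \<Longrightarrow> norm (s - 1) * (Re s - 1/2) \<le> K * norm s * norm (zeta_reg s)"
    using zeta_reg_lower_bound by blast
  have "1 / K \<le> norm (deriv zeta_reg (Complex (1/2) \<gamma>))" if g: "\<gamma> \<in> zero_ordinates" for \<gamma>
  proof -
    define s where "s = Complex (1/2) \<gamma>"
    define D where "D = deriv zeta_reg s"
    have Z0: "zeta_reg s = 0" using g by (simp add: zero_ordinates_def s_def)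
    have s0: "norm s > 0" by (simp add: s_def complex_eq_iff)
    have ns: "norm (s - 1) = norm s" by (simp add: s_def cmod_def)
    have "(zeta_reg has_field_derivative D) (at s)"
      unfolding D_def by (rule holomorphic_derivI[OF zeta_reg_holomorphic]) (auto intro: open_halfspace_Re_gt simp: s_def)
    then have "((\<lambda>h. (zeta_reg (s + h) - zeta_reg s) / h) \<longlongrightarrow> D) (at 0)"
      by (simp add: DERIV_def)
    \<comment> \<open>The zero is approached horizontally from the right; the factor Re s - 1/2 of
      the lower bound is then the denominator of the difference quotient.\<close>
    define d where "d = (\<lambda>n::nat. 1 / (real n + 1))"
    have d: "0 < d n" "d n \<le> 1" for n by (auto simp: d_def)
    have dl: "d \<longlonglongrightarrow> 0" unfolding d_def by real_asymp
    have ne: "complex_of_real (d n) \<noteq> 0" for n using d(1)[of n] by simp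
    have "(\<lambda>n. complex_of_real (d n)) \<longlonglongrightarrow> of_real 0"
      by (intro tendsto_of_real dl)
    then have "filterlim (\<lambda>n. complex_of_real (d n)) (at 0) sequentially"
      unfolding filterlim_at using ne by simp
    then have "(\<lambda>n. (zeta_reg (s + of_real (d n)) - zeta_reg s) / of_real (d n)) \<longlonglongrightarrow> D"
      by (rule filterlim_compose[OF \<open>((\<lambda>h. (zeta_reg (s + h) - zeta_reg s) / h) \<longlongrightarrow> D) (at 0)\<close>])
    then have l1: "(\<lambda>n. K * norm (s + of_real (d n)) * norm ((zeta_reg (s + of_real (d n)) - zeta_reg s) / of_real (d n))) \<longlonglongrightarrow>
        K * norm (s + of_real 0) * norm D"
      using dl by (intro tendsto_intros)
    have l2: "(\<lambda>n. norm (s + of_real (d n) - 1)) \<longlonglongrightarrow> norm (s + of_real 0 - 1)"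
      using dl by (intro tendsto_intros)
    have "norm (s + of_real 0 - 1) \<le> K * norm (s + of_real 0) * norm D"
    proof (rule LIMSEQ_le[OF l2 l1], intro exI allI impI)
      fix n
      have "norm (s + of_real (d n) - 1) * d n \<le> K * norm (s + of_real (d n)) * norm (zeta_reg (s + of_real (d n)))"
        using K(2)[of "s + of_real (d n)"] d[of n] by (simp add: s_def)
      then show "norm (s + of_real (d n) - 1) \<le> K * norm (s + of_real (d n)) * norm ((zeta_reg (s + of_real (d n)) - zeta_reg s) / of_real (d n))"
        using d(1)[of n] by (simp add: Z0 norm_divide field_simps)
    qed
    then have "norm s \<le> K * norm s * norm D" using ns by simp
    then have "1 \<le> K * norm D" using s0 by simp
    then show ?thesis using K(1) by (simp add: field_simps D_def s_def)
  qed
  then show thesis using K(1) by (intro that[of "1 / K"]) auto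
qed

text \<open>If two zeros are close, the Taylor expansion at the first bounds the derivative there by
  \<open>B\<close> times their distance, with \<open>B\<close> controlling the second derivative,
  while \<open>deriv_zeta_reg_lower_bound\<close> keeps it away from 0. Cauchy's inequality gives a
  \<open>B\<close> of quadratic size.\<close>

lemma zero_gap:
  obtains c where "0 < c" "c \<le> 1"
    "\<And>\<gamma> \<gamma>'. \<gamma> \<in> zero_ordinates \<Longrightarrow> \<gamma>' \<in> zero_ordinates \<Longrightarrow> \<gamma> \<noteq> \<gamma>' \<Longrightarrow> c / (3 + \<bar>\<gamma>\<bar>)\<^sup>2 \<le> \<bar>\<gamma> - \<gamma>'\<bar>"
proof -
  obtain k where k: "k > 0" "\<And>\<gamma>. \<gamma> \<in> zero_ordinates \<Longrightarrow> k \<le> norm (deriv zeta_reg (Complex (1/2) \<gamma>))"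
    using deriv_zeta_reg_lower_bound by blast
  obtain C where C: "C > 0" "\<And>s. Re s \<ge> 1/4 \<Longrightarrow> norm (zeta_reg s) \<le> C * (1 + norm s)\<^sup>2"
    using zeta_reg_bound by blast
  \<comment> \<open>128 = 2! * 8^2 comes from Cauchy's inequality on circles of radius 1/8, a radius
    that keeps the discs within Re s >= 1/4. The cap 1 serves ordinates more than 1/8 apart.\<close>
  define c where "c = min 1 (k / (128 * C))"
  have c: "0 < c" "c \<le> 1" "c \<le> k / (128 * C)" using k C by (auto simp: c_def)
  have "c / (3 + \<bar>\<gamma>\<bar>)\<^sup>2 \<le> \<bar>\<gamma> - \<gamma>'\<bar>" if g: "\<gamma> \<in> zero_ordinates" "\<gamma>' \<in> zero_ordinates" "\<gamma> \<noteq> \<gamma>'" for \<gamma> \<gamma>'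
  proof (cases "\<bar>\<gamma> - \<gamma>'\<bar> \<le> 1/8")
    case False
    have "(3::real)\<^sup>2 \<le> (3 + \<bar>\<gamma>\<bar>)\<^sup>2" by (intro power_mono) auto
    then have "c / (3 + \<bar>\<gamma>\<bar>)\<^sup>2 \<le> 1 / 9" using c by (intro frac_le) auto
    then show ?thesis using False by linarith
  next
    case True
    define s where "s = Complex (1/2) \<gamma>"
    define s' where "s' = Complex (1/2) \<gamma>'"
    define S where "S = cball s (1/8)"
    define B where "B = 2 * (C * (3 + \<bar>\<gamma>\<bar>)\<^sup>2) / (1/8)\<^sup>2"
    have dist: "norm (s' - s) = \<bar>\<gamma> - \<gamma>'\<bar>" by (simp add: s_def s'_def cmod_def abs_minus_commute)
    have ReS: "Re y \<ge> 1/4" if "dist x y \<le> 1/8" "x \<in> S" for x y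
      using that abs_Re_le_cmod[of "x - y"] abs_Re_le_cmod[of "s - x"] by (auto simp: S_def dist_norm s_def)
    have ns: "norm s \<le> 1/2 + \<bar>\<gamma>\<bar>" using cmod_le[of s] by (simp add: s_def)
    have nS: "norm y \<le> 1 + \<bar>\<gamma>\<bar>" if "dist x y \<le> 1/8" "x \<in> S" for x y
      using that ns norm_triangle_ineq[of "y - x" x] norm_triangle_ineq[of "x - s" s]
      by (auto simp: S_def dist_norm norm_minus_commute)
    have hol: "zeta_reg holomorphic_on cball x (1/8)" if "x \<in> S" for x
    proof (rule holomorphic_on_subset[OF zeta_reg_holomorphic], safe)
      fix y assume "y \<in> cball x (1/8)"
      then show "Re y > 0" using ReS[OF _ that, of y] by simp
    qed
    have der: "((deriv ^^ i) zeta_reg has_field_derivative (deriv ^^ Suc i) zeta_reg x) (at x within S)" if "x \<in> S" for i x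
    proof (rule has_field_derivative_at_within)
      have op: "open {s. Re s > (0::real)}" by (rule open_halfspace_Re_gt)
      have "Re x > 0" using ReS[OF _ that, of x] by simp
      then show "((deriv ^^ i) zeta_reg has_field_derivative (deriv ^^ Suc i) zeta_reg x) (at x)"
        using holomorphic_derivI[OF holomorphic_higher_deriv[OF zeta_reg_holomorphic op] op] by simp
    qed
    have bd: "norm ((deriv ^^ Suc (Suc 0)) zeta_reg x) \<le> B" if x: "x \<in> S" for x
    proof -
      have "norm ((deriv ^^ 2) zeta_reg x) \<le> fact 2 * (C * (3 + \<bar>\<gamma>\<bar>)\<^sup>2) / (1/8) ^ 2"
      proof (rule Cauchy_inequality)
        show "zeta_reg holomorphic_on ball x (1/8)"
          by (rule holomorphic_on_subset[OF hol[OF x]]) auto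
        show "continuous_on (cball x (1/8)) zeta_reg" by (rule holomorphic_on_imp_continuous_on[OF hol[OF x]])
        fix y assume "norm (x - y) = 1/8"
        then have y: "dist x y \<le> 1/8" by (simp add: dist_norm)
        have "norm (zeta_reg y) \<le> C * (1 + norm y)\<^sup>2" by (rule C(2)[OF ReS[OF y x]])
        also have "\<dots> \<le> C * (3 + \<bar>\<gamma>\<bar>)\<^sup>2" using nS[OF y x] C by (intro mult_left_mono power_mono) auto
        finally show "norm (zeta_reg y) \<le> C * (3 + \<bar>\<gamma>\<bar>)\<^sup>2" .
      qed simp
      then show ?thesis by (simp add: B_def numeral_2_eq_2)
    qed
    have "norm ((deriv ^^ 0) zeta_reg s' - (\<Sum>i\<le>Suc 0. (deriv ^^ i) zeta_reg s * (s' - s) ^ i / fact i)) \<le> B * norm (s' - s) ^ Suc (Suc 0) / fact (Suc 0)"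
      by (rule complex_Taylor[where S = S and n = "Suc 0" and f = "\<lambda>i. (deriv ^^ i) zeta_reg", OF _ der bd])
         (use True dist in \<open>auto simp: S_def dist_norm norm_minus_commute\<close>)
    moreover have "zeta_reg s = 0" "zeta_reg s' = 0" using g by (auto simp: zero_ordinates_def s_def s'_def)
    ultimately have "norm (deriv zeta_reg s) * norm (s' - s) \<le> B * (norm (s' - s))\<^sup>2"
      by (simp add: norm_mult power2_eq_square)
    moreover have "norm (s' - s) > 0" using g dist by simp
    ultimately have "norm (deriv zeta_reg s) \<le> B * norm (s' - s)" by (simp add: power2_eq_square)
    then have "k \<le> B * \<bar>\<gamma> - \<gamma>'\<bar>" using k(2)[OF g(1)] dist by (simp add: s_def)
    moreover have "B = 128 * C * (3 + \<bar>\<gamma>\<bar>)\<^sup>2" by (simp add: B_def power2_eq_square)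
    ultimately have "k / (128 * C) / (3 + \<bar>\<gamma>\<bar>)\<^sup>2 \<le> \<bar>\<gamma> - \<gamma>'\<bar>"
      using C by (simp add: field_simps)
    moreover have "c / (3 + \<bar>\<gamma>\<bar>)\<^sup>2 \<le> k / (128 * C) / (3 + \<bar>\<gamma>\<bar>)\<^sup>2"
      using c by (intro divide_right_mono) auto
    ultimately show ?thesis by linarith
  qed
  then show thesis using c that by blast
qed

end

section \<open>The quotient of Gamma and zeta, and sums over the zeros\<close>

lemma power_exp_bound:
  fixes a :: real
  assumes "a > 0"
  obtains D where "D > 0" "\<And>x. x \<ge> 0 \<Longrightarrow> (3 + x) ^ Suc m * exp (- a * x) \<le> D"
proof -
  define M where "M = real (Suc m)"
  define D where "D = M powr M * exp (3 * a) / a ^ Suc m"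
  have M: "M > 0" by (simp add: M_def)
  have "(3 + x) ^ Suc m * exp (- a * x) \<le> D" if x: "x \<ge> 0" for x
  proof -
    have y: "a * (3 + x) > 0" using x assms by simp
    have "(a * (3 + x)) ^ Suc m \<le> M powr M * exp (a * (3 + x))"
      using powr_le_exp[OF y M] y by (simp only: M_def powr_realpow)
    moreover have "exp (a * (3 + x)) = exp (3 * a) * exp (a * x)" by (simp add: distrib_left mult.commute exp_add)
    ultimately have "a ^ Suc m * (3 + x) ^ Suc m \<le> M powr M * exp (3 * a) * exp (a * x)"
      by (simp only: power_mult_distrib mult.assoc)
    then have "a ^ Suc m * (3 + x) ^ Suc m * exp (- a * x) \<le> M powr M * exp (3 * a) * exp (a * x) * exp (- a * x)"
      by (rule mult_right_mono) simp
    also have "\<dots> = M powr M * exp (3 * a)" by (simp add: exp_minus)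
    finally show ?thesis using assms by (simp add: D_def pos_le_divide_eq mult_ac del: power_Suc)
  qed
  moreover have "D > 0" using assms M by (simp add: D_def)
  ultimately show thesis using that by blast
qed

lemma summable_on_inverse_square: "(\<lambda>n::nat. D / (1 + real n)\<^sup>2) summable_on UNIV"
proof -
  have "summable (\<lambda>n. E / (1 + real n)\<^sup>2)" for E
  proof -
    have "E * real (Suc n) powr (-2) = E / (1 + real n)\<^sup>2" for n
      by (simp add: powr_minus divide_simps powr_numeral)
    moreover have "summable (\<lambda>n. E * real (Suc n) powr (-2))" by (intro summable_mult summable_Suc_powr) simp
    ultimately show ?thesis by (simp only:)
  qed
  from this[of "\<bar>D\<bar>"] have "summable (\<lambda>n. norm (D / (1 + real n)\<^sup>2))" by simp
  then show ?thesis by (rule norm_summable_imp_summable_on)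
qed

definition zeta_quotient :: "complex \<Rightarrow> complex" where
  "zeta_quotient s = Gamma ((1 - s) / 2) * (s - 1) / zeta_reg s"

lemma zeta_quotient_eq:
  assumes "Re s > 0" "s \<noteq> 1"
  shows "zeta_quotient s = Gamma ((1 - s) / 2) * inverse (zeta s)"
  using assms by (cases "zeta s = 0") (auto simp: zeta_quotient_def zeta_reg_eq field_simps)

text \<open>The Gamma factor of the quotient is the one in the functional equation, whose inverse
  therefore relates the values at s and 1 - s up to powers of pi.\<close>

lemma norm_zeta_quotient_reflect:
  assumes "0 < Re s" "Re s < 1"
  shows "norm (zeta_quotient s) = norm (zeta_quotient (1 - s)) * pi powr (1/2 - Re s)"
proof -
  have s: "s \<noteq> 0" "s \<noteq> 1" using assms by auto
  have n: "norm (of_real pi powr w) = pi powr Re w" for w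
    using norm_powr_real_powr[of "of_real pi" w] by simp
  have "norm (inverse (zeta s * rGamma ((1 - s) / 2) * of_real pi powr ((1 - s) / 2))) =
     norm (inverse (zeta (1 - s) * rGamma (s / 2) * of_real pi powr (s / 2)))"
    using zeta_functional_equation[OF s] by simp
  then have "norm (zeta_quotient s) * inverse (pi powr ((1 - Re s) / 2)) = norm (zeta_quotient (1 - s)) * inverse (pi powr (Re s / 2))"
    using zeta_quotient_eq[of s] zeta_quotient_eq[of "1 - s"] s assms
    by (simp add: norm_mult norm_inverse n Gamma_def mult_ac)
  then have "norm (zeta_quotient s) = norm (zeta_quotient (1 - s)) * (inverse (pi powr (Re s / 2)) * pi powr ((1 - Re s) / 2))"
    by (simp add: field_simps)
  also have "inverse (pi powr (Re s / 2)) * pi powr ((1 - Re s) / 2) = pi powr (- (Re s / 2) + (1 - Re s) / 2)"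
    by (simp only: powr_add powr_minus)
  also have "- (Re s / 2) + (1 - Re s) / 2 = 1/2 - Re s" by (simp add: field_simps)
  finally show ?thesis .
qed

context
  assumes wmh: weak_mertens_hypothesis
begin

text \<open>The cubes \<open>(3 + \<gamma>)\<^sup>3\<close> of distinct positive ordinates are separated by a constant, since the gaps are
  bounded below by a power of \<open>1 / \<gamma>\<close>. Rounding them numbers the zeros, which replaces a zero count.\<close>

lemma ordinate_index:
  obtains j :: "real \<Rightarrow> nat" and c :: real where "c > 0" "inj_on j {\<gamma> \<in> zero_ordinates. \<gamma> > 0}"
    "\<And>\<gamma>. \<gamma> > 0 \<Longrightarrow> 1 + real (j \<gamma>) \<le> c * (3 + \<gamma>) ^ 3"
proof -
  obtain c where c: "0 < c" "c \<le> 1"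
    "\<And>\<gamma> \<gamma>'. \<gamma> \<in> zero_ordinates \<Longrightarrow> \<gamma>' \<in> zero_ordinates \<Longrightarrow> \<gamma> \<noteq> \<gamma>' \<Longrightarrow> c / (3 + \<bar>\<gamma>\<bar>)\<^sup>2 \<le> \<bar>\<gamma> - \<gamma>'\<bar>"
    using zero_gap[OF wmh] by blast
  define h where "h = (\<lambda>\<gamma>::real. (3 + \<gamma>) ^ 3 / c)"
  define j where "j = (\<lambda>\<gamma>. nat \<lfloor>h \<gamma>\<rfloor>)"
  have h0: "h \<gamma> \<ge> 0" if "\<gamma> > 0" for \<gamma> using that c by (simp add: h_def)
  have less: "j \<gamma> < j \<gamma>'" if g: "\<gamma> \<in> zero_ordinates" "\<gamma>' \<in> zero_ordinates" "0 < \<gamma>" "\<gamma> < \<gamma>'" for \<gamma> \<gamma>'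
  proof -
    define A B where "A = 3 + \<gamma>" "B = \<gamma>' - \<gamma>"
    have AB: "A > 0" "B > 0" "3 + \<gamma>' = A + B" using g by (auto simp: A_B_def)
    have "c / A\<^sup>2 \<le> B" using c(3)[of \<gamma> \<gamma>'] g by (simp add: A_B_def)
    then have "c \<le> A\<^sup>2 * B" using AB by (simp add: field_simps)
    also have "\<dots> \<le> A\<^sup>2 * B + (2 * A\<^sup>2 * B + 3 * A * B\<^sup>2 + B ^ 3)" using AB by simp
    also have "\<dots> = (A + B) ^ 3 - A ^ 3" by (simp add: power2_eq_square power3_eq_cube algebra_simps)
    finally have "1 \<le> ((A + B) ^ 3 - A ^ 3) / c" using c by simp
    moreover have "h \<gamma>' = (A + B) ^ 3 / c" unfolding h_def AB(3) ..
    moreover have "h \<gamma> = A ^ 3 / c" by (simp add: h_def A_B_def)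
    ultimately have "h \<gamma> + 1 \<le> h \<gamma>'" by (simp add: diff_divide_distrib)
    then show ?thesis using h0[OF g(3)] unfolding j_def by linarith
  qed
  have "inj_on j {\<gamma> \<in> zero_ordinates. \<gamma> > 0}"
    by (rule linorder_inj_onI) (use less in fastforce)+
  moreover have "1 + real (j \<gamma>) \<le> (2 / c) * (3 + \<gamma>) ^ 3" if "\<gamma> > 0" for \<gamma>
  proof -
    have "(3::real) ^ 3 \<le> (3 + \<gamma>) ^ 3" using that by (intro power_mono) auto
    then have "1 \<le> (3 + \<gamma>) ^ 3" by simp
    also have "\<dots> \<le> h \<gamma>" using c that by (simp add: h_def pos_le_divide_eq mult_left_le)
    finally have "1 \<le> h \<gamma>" .
    moreover have "real (j \<gamma>) \<le> h \<gamma>" using h0[OF that] by (simp add: j_def)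
    ultimately have "1 + real (j \<gamma>) \<le> 2 * h \<gamma>" by linarith
    then show ?thesis by (simp add: h_def)
  qed
  ultimately show thesis using c that[of "2 / c" j] by simp
qed

lemma zero_ordinates_split:
  "zero_ordinates = {\<gamma> \<in> zero_ordinates. \<gamma> > 0} \<union> uminus ` {\<gamma> \<in> zero_ordinates. \<gamma> > 0}"
proof -
  have "\<gamma> \<in> uminus ` {\<gamma> \<in> zero_ordinates. \<gamma> > 0}" if "\<gamma> \<in> zero_ordinates" "\<not> \<gamma> > 0" for \<gamma>
    using that zero_notin_zero_ordinates by (intro image_eqI[of _ _ "- \<gamma>"]) (auto simp: not_less le_less)
  then show ?thesis by auto
qed

lemma finite_zero_ordinates: "finite {\<gamma> \<in> zero_ordinates. \<bar>\<gamma>\<bar> < T}"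
proof -
  obtain j :: "real \<Rightarrow> nat" and c where j: "c > 0" "inj_on j {\<gamma> \<in> zero_ordinates. \<gamma> > 0}"
    "\<And>\<gamma>. \<gamma> > 0 \<Longrightarrow> 1 + real (j \<gamma>) \<le> c * (3 + \<gamma>) ^ 3"
    by (rule ordinate_index, rule that)
  define P where "P = {\<gamma> \<in> zero_ordinates. \<gamma> > 0 \<and> \<gamma> < T}"
  have "j ` P \<subseteq> {..nat \<lfloor>c * (3 + T) ^ 3\<rfloor>}"
  proof safe
    fix \<gamma> assume g: "\<gamma> \<in> P"
    have "real (j \<gamma>) \<le> c * (3 + \<gamma>) ^ 3" using j(3)[of \<gamma>] g by (simp add: P_def)
    also have "\<dots> \<le> c * (3 + T) ^ 3" using g j(1) by (intro mult_left_mono power_mono) (auto simp: P_def)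
    finally show "j \<gamma> \<le> nat \<lfloor>c * (3 + T) ^ 3\<rfloor>" by linarith
  qed
  then have "finite (j ` P)" by (rule finite_subset) simp
  then have fP: "finite P" by (rule finite_imageD) (rule inj_on_subset[OF j(2)], auto simp: P_def)
  have "{\<gamma> \<in> zero_ordinates. \<bar>\<gamma>\<bar> < T} \<subseteq> P \<union> uminus ` P"
  proof
    fix \<gamma> assume g: "\<gamma> \<in> {\<gamma> \<in> zero_ordinates. \<bar>\<gamma>\<bar> < T}"
    then have "\<gamma> \<noteq> 0" using zero_notin_zero_ordinates by auto
    then consider "\<gamma> > 0" | "- \<gamma> > 0" by linarith
    then show "\<gamma> \<in> P \<union> uminus ` P"
    proof cases
      case 2
      then have "- \<gamma> \<in> P" using g by (simp add: P_def)
      then show ?thesis by force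
    qed (use g in \<open>auto simp: P_def\<close>)
  qed
  then show ?thesis by (rule finite_subset) (use fP in simp)
qed

lemma summable_on_zero_ordinates:
  assumes a: "a > 0"
  shows "(\<lambda>\<gamma>. (3 + \<bar>\<gamma>\<bar>) ^ m * exp (- a * \<bar>\<gamma>\<bar>)) summable_on zero_ordinates"
proof -
  obtain j :: "real \<Rightarrow> nat" and c where j: "c > 0" "inj_on j {\<gamma> \<in> zero_ordinates. \<gamma> > 0}"
    "\<And>\<gamma>. \<gamma> > 0 \<Longrightarrow> 1 + real (j \<gamma>) \<le> c * (3 + \<gamma>) ^ 3"
    by (rule ordinate_index, rule that)
  define P where "P = {\<gamma> \<in> zero_ordinates. \<gamma> > 0}"
  define f where "f = (\<lambda>\<gamma>::real. (3 + \<bar>\<gamma>\<bar>) ^ m * exp (- a * \<bar>\<gamma>\<bar>))"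
  \<comment> \<open>Six powers of 3 + \<gamma> pay for the square of the index bound; what remains
    is summable over the distinct indices.\<close>
  obtain D where D: "D > 0" "\<And>x. x \<ge> 0 \<Longrightarrow> (3 + x) ^ Suc (m + 5) * exp (- a * x) \<le> D"
    using power_exp_bound[OF a, of "m + 5"] by blast
  have "(\<lambda>n::nat. c\<^sup>2 * D / (1 + real n)\<^sup>2) summable_on j ` P"
    by (rule summable_on_subset_banach[OF summable_on_inverse_square]) simp
  then have "(\<lambda>\<gamma>. c\<^sup>2 * D / (1 + real (j \<gamma>))\<^sup>2) summable_on P"
    using summable_on_reindex[of j P "\<lambda>n::nat. c\<^sup>2 * D / (1 + real n)\<^sup>2"] j(2) by (simp add: P_def o_def)
  then have P: "f summable_on P"
  proof (rule summable_on_comparison_test)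
    fix \<gamma> assume g: "\<gamma> \<in> P"
    then have g0: "\<gamma> > 0" by (simp add: P_def)
    have "(1 + real (j \<gamma>))\<^sup>2 \<le> (c * (3 + \<gamma>) ^ 3)\<^sup>2" using j(3)[OF g0] by (intro power_mono) auto
    also have "\<dots> = c\<^sup>2 * (3 + \<gamma>) ^ 6" by (simp add: power_mult_distrib flip: power_mult)
    finally have "f \<gamma> * (1 + real (j \<gamma>))\<^sup>2 \<le> f \<gamma> * (c\<^sup>2 * (3 + \<gamma>) ^ 6)"
      by (rule mult_left_mono) (simp add: f_def)
    also have "\<dots> = c\<^sup>2 * ((3 + \<gamma>) ^ Suc (m + 5) * exp (- a * \<gamma>))"
      using g0 by (simp add: f_def power_add mult_ac numeral_eq_Suc)
    also have "\<dots> \<le> c\<^sup>2 * D" using g0 by (intro mult_left_mono D) auto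
    finally show "f \<gamma> \<le> c\<^sup>2 * D / (1 + real (j \<gamma>))\<^sup>2" by (simp add: pos_le_divide_eq)
    show "0 \<le> f \<gamma>" by (simp add: f_def)
  qed
  moreover have "f summable_on uminus ` P"
  proof -
    have "inj_on uminus P" by (simp add: inj_on_def)
    then show ?thesis using P summable_on_reindex[of uminus P f] by (simp add: f_def o_def)
  qed
  ultimately have "f summable_on P \<union> uminus ` P" by (rule summable_on_union)
  then show ?thesis using zero_ordinates_split by (simp add: P_def f_def)
qed

lemma zero_coeff_bound:
  obtains C where "C > 0" "\<And>\<gamma>. \<gamma> \<in> zero_ordinates \<Longrightarrow> norm (zero_coeff \<gamma>) \<le> C * ((3 + \<bar>\<gamma>\<bar>) * exp (- (1/4) * \<bar>\<gamma>\<bar>))"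
proof -
  obtain c where c: "c > 0" "\<And>\<gamma>. \<gamma> \<in> zero_ordinates \<Longrightarrow> c \<le> norm (deriv zeta_reg (Complex (1/2) \<gamma>))"
    using deriv_zeta_reg_lower_bound[OF wmh] by blast
  obtain C where C: "C > 0" "\<And>x y. x \<in> {1/8..2} \<Longrightarrow> norm (Gamma (Complex x y)) \<le> C * exp (- (1/2) * \<bar>y\<bar>)"
    using Gamma_strip_decay[of "1/8"] by auto
  have "norm (zero_coeff \<gamma>) \<le> (C / c) * ((3 + \<bar>\<gamma>\<bar>) * exp (- (1/4) * \<bar>\<gamma>\<bar>))" if g: "\<gamma> \<in> zero_ordinates" for \<gamma>
  proof -
    have "norm (Gamma (Complex (1/4) (- \<gamma>/2))) \<le> C * exp (- (1/4) * \<bar>\<gamma>\<bar>)"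
      using C(2)[of "1/4" "- \<gamma>/2"] by simp
    moreover have "norm (Complex (1/2) \<gamma> - 1) \<le> 3 + \<bar>\<gamma>\<bar>"
      using cmod_le[of "Complex (1/2) \<gamma> - 1"] by simp
    ultimately have "norm (zero_coeff \<gamma>) \<le> (C * exp (- (1/4) * \<bar>\<gamma>\<bar>)) * (3 + \<bar>\<gamma>\<bar>) / c"
      unfolding zero_coeff_eq[OF g] norm_mult norm_divide
      using c(1) c(2)[OF g] C(1) by (intro frac_le mult_mono) auto
    then show ?thesis by (simp add: mult_ac)
  qed
  then show thesis using that[of "C / c"] C c by simp
qed

text \<open>If n itself is close to an ordinate, then by \<open>zero_gap\<close> no other ordinate
  is within e of that one, and n + e/2 keeps its distance from all of them. Otherwise n will do.
  Since the ordinates are symmetric, the negative height is equally good.\<close>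

lemma good_heights:
  obtains c :: real and T :: "nat \<Rightarrow> real" where "0 < c" "c \<le> 1" "\<And>n. real n \<le> T n \<and> T n \<le> real n + 1"
    "\<And>n \<gamma>. \<gamma> \<in> zero_ordinates \<Longrightarrow> c / (5 + real n)\<^sup>2 \<le> \<bar>\<gamma> - T n\<bar> \<and> c / (5 + real n)\<^sup>2 \<le> \<bar>\<gamma> + T n\<bar>"
proof -
  obtain c where c: "0 < c" "c \<le> 1"
    "\<And>\<gamma> \<gamma>'. \<gamma> \<in> zero_ordinates \<Longrightarrow> \<gamma>' \<in> zero_ordinates \<Longrightarrow> \<gamma> \<noteq> \<gamma>' \<Longrightarrow> c / (3 + \<bar>\<gamma>\<bar>)\<^sup>2 \<le> \<bar>\<gamma> - \<gamma>'\<bar>"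
    using zero_gap[OF wmh] by blast
  have "\<exists>t. real n \<le> t \<and> t \<le> real n + 1 \<and> (\<forall>\<gamma>\<in>zero_ordinates. (c/8) / (5 + real n)\<^sup>2 \<le> \<bar>\<gamma> - t\<bar>)" for n
  proof (cases "\<forall>\<gamma>\<in>zero_ordinates. (c/8) / (5 + real n)\<^sup>2 \<le> \<bar>\<gamma> - real n\<bar>")
    case False
    define e where "e = c / (5 + real n)\<^sup>2"
    have "1 \<le> (5 + real n)\<^sup>2" by (rule one_le_power) simp
    then have "e \<le> 1 / 1" unfolding e_def using c by (intro frac_le) auto
    then have e: "0 < e" "e \<le> 1" using c by (auto simp: e_def)
    obtain \<gamma>0 where g0: "\<gamma>0 \<in> zero_ordinates" "\<bar>\<gamma>0 - real n\<bar> < e / 8"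
      using False by (auto simp: e_def not_le)
    have "\<bar>\<gamma>0\<bar> \<le> real n + 1" using g0 e by linarith
    then have "e \<le> c / (3 + \<bar>\<gamma>0\<bar>)\<^sup>2" unfolding e_def using c by (intro divide_left_mono power_mono mult_pos_pos) auto
    then have gap: "e \<le> \<bar>\<gamma>0 - \<gamma>\<bar>" if "\<gamma> \<in> zero_ordinates" "\<gamma> \<noteq> \<gamma>0" for \<gamma>
      using c(3)[OF g0(1) that(1)] that(2) by fastforce
    have A: "e / 8 \<le> \<bar>\<gamma> - (real n + e / 2)\<bar>" if "\<gamma> \<in> zero_ordinates" for \<gamma>
      using gap[OF that] g0(2) e by (cases "\<gamma> = \<gamma>0") linarith+
    have B: "(c/8) / (5 + real n)\<^sup>2 = e / 8" by (simp add: e_def)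
    have "real n \<le> real n + e / 2 \<and> real n + e / 2 \<le> real n + 1 \<and>
        (\<forall>\<gamma>\<in>zero_ordinates. (c/8) / (5 + real n)\<^sup>2 \<le> \<bar>\<gamma> - (real n + e / 2)\<bar>)"
      unfolding B using A e by simp
    then show ?thesis by blast
  qed (auto intro!: exI[of _ "real n"])
  then obtain T where T: "\<And>n. real n \<le> T n \<and> T n \<le> real n + 1 \<and> (\<forall>\<gamma>\<in>zero_ordinates. (c/8) / (5 + real n)\<^sup>2 \<le> \<bar>\<gamma> - T n\<bar>)"
    by metis
  show thesis
  proof (rule that[of "c / 8" T])
    fix n \<gamma> assume g: "\<gamma> \<in> zero_ordinates"
    then have "- \<gamma> \<in> zero_ordinates" by simp
    then have "(c/8) / (5 + real n)\<^sup>2 \<le> \<bar>- \<gamma> - T n\<bar>" using T[of n] by blast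
    moreover have "\<bar>- \<gamma> - T n\<bar> = \<bar>\<gamma> + T n\<bar>" by linarith
    ultimately show "(c/8) / (5 + real n)\<^sup>2 \<le> \<bar>\<gamma> - T n\<bar> \<and> (c/8) / (5 + real n)\<^sup>2 \<le> \<bar>\<gamma> + T n\<bar>"
      using T[of n] g by simp
  qed (use c T in auto)
qed

lemma zeta_quotient_holomorphic:
  "zeta_quotient holomorphic_on {s. 0 < Re s \<and> Re s < 1} - Complex (1/2) ` zero_ordinates"
proof -
  have "zeta_reg s \<noteq> 0" if s: "s \<in> {s. 0 < Re s \<and> Re s < 1} - Complex (1/2) ` zero_ordinates" for s
  proof (cases "Re s = 1/2")
    case True
    then have "s = Complex (1/2) (Im s)" by (simp add: complex_eq_iff)
    then show ?thesis using s by (auto simp: zero_ordinates_def)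
  next
    case False
    have "s \<noteq> 1" using s by auto
    then show ?thesis
      using False s zeta_reg_nonzero_right[OF wmh, of s] zeta_nonzero_left[OF wmh, of s] zeta_reg_eq[of s]
      by (cases "Re s < 1/2") auto
  qed
  moreover have "(1 - s) / 2 \<notin> \<int>\<^sub>\<le>\<^sub>0" if "s \<in> {s. 0 < Re s \<and> Re s < 1} - Complex (1/2) ` zero_ordinates" for s
    by (rule not_nonpos_Int_if_Re_pos) (use that in simp)
  ultimately show ?thesis
    unfolding zeta_quotient_def
    by (intro holomorphic_intros holomorphic_on_subset[OF zeta_reg_holomorphic]) auto
qed

text \<open>On the right, Gamma decays like exp(- |t| / 4), and half of this pays for the factor
  |s|. On the left the reflected bound applies, with a power of pi below 4.\<close>

lemma zeta_quotient_bound: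
  obtains C where "C > 0"
    "\<And>s. 1/4 \<le> Re s \<Longrightarrow> Re s \<le> 3/4 \<Longrightarrow> Re s \<noteq> 1/2 \<Longrightarrow> norm (zeta_quotient s) \<le> C * exp (- (1/8) * \<bar>Im s\<bar>) / \<bar>Re s - 1/2\<bar>"
proof -
  obtain K where K: "K > 0"
    "\<And>s. 1/2 < Re s \<Longrightarrow> Re s \<le> 3/2 \<Longrightarrow> norm (s - 1) * (Re s - 1/2) \<le> K * norm s * norm (zeta_reg s)"
    using zeta_reg_lower_bound[OF wmh] by blast
  obtain C where C: "C > 0" "\<And>x y. x \<in> {1/8..2} \<Longrightarrow> norm (Gamma (Complex x y)) \<le> C * exp (- (1/2) * \<bar>y\<bar>)"
    using Gamma_strip_decay[of "1/8"] by auto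
  have right: "norm (zeta_quotient s) \<le> 8 * C * K * exp (- (1/8) * \<bar>Im s\<bar>) / (Re s - 1/2)" if s: "1/2 < Re s" "Re s \<le> 3/4" for s
  proof -
    have nz: "norm (zeta_reg s) > 0" using zeta_reg_nonzero_right[OF wmh] s by simp
    have "(1 - s) / 2 = Complex ((1 - Re s) / 2) (- Im s / 2)" by (simp add: complex_eq_iff)
    then have 1: "norm (Gamma ((1 - s) / 2)) \<le> C * exp (- (1/4) * \<bar>Im s\<bar>)"
      using C(2)[of "(1 - Re s) / 2" "- Im s / 2"] s by simp
    have "norm (s - 1) * (Re s - 1/2) \<le> K * norm s * norm (zeta_reg s)" using K(2) s by simp
    then have 2: "norm (s - 1) / norm (zeta_reg s) \<le> K * norm s / (Re s - 1/2)"
      using nz s by (simp add: field_simps)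
    have "norm s \<le> 1 + \<bar>Im s\<bar>" using cmod_le[of s] s by linarith
    also have "\<dots> \<le> 8 * (1 + \<bar>Im s\<bar> / 8)" by simp
    also have "\<dots> \<le> 8 * exp (\<bar>Im s\<bar> / 8)" using exp_ge_add_one_self[of "\<bar>Im s\<bar> / 8"] by (intro mult_left_mono) auto
    finally have 3: "norm s \<le> 8 * exp (\<bar>Im s\<bar> / 8)" .
    have "norm (zeta_quotient s) = norm (Gamma ((1 - s) / 2)) * (norm (s - 1) / norm (zeta_reg s))"
      by (simp add: zeta_quotient_def norm_mult norm_divide)
    also have "\<dots> \<le> (C * exp (- (1/4) * \<bar>Im s\<bar>)) * (K * (8 * exp (\<bar>Im s\<bar> / 8)) / (Re s - 1/2))"
    proof (rule mult_mono[OF 1])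
      show "norm (s - 1) / norm (zeta_reg s) \<le> K * (8 * exp (\<bar>Im s\<bar> / 8)) / (Re s - 1/2)"
        using 2 3 K(1) s by (elim order_trans) (intro divide_right_mono mult_left_mono, auto)
    qed (use C in auto)
    also have "\<dots> = 8 * C * K * (exp (- (1/4) * \<bar>Im s\<bar>) * exp (\<bar>Im s\<bar> / 8)) / (Re s - 1/2)" by simp
    also have "exp (- (1/4) * \<bar>Im s\<bar>) * exp (\<bar>Im s\<bar> / 8) = exp (- (1/8) * \<bar>Im s\<bar>)"
      by (simp flip: exp_add)
    finally show ?thesis .
  qed
  have "norm (zeta_quotient s) \<le> 4 * (8 * C * K) * exp (- (1/8) * \<bar>Im s\<bar>) / \<bar>Re s - 1/2\<bar>"
    if s: "1/4 \<le> Re s" "Re s \<le> 3/4" "Re s \<noteq> 1/2" for s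
  proof (cases "Re s > 1/2")
    case True
    have "norm (zeta_quotient s) \<le> 8 * C * K * exp (- (1/8) * \<bar>Im s\<bar>) / (Re s - 1/2)" by (rule right[OF True s(2)])
    also have "\<dots> \<le> 4 * (8 * C * K) * exp (- (1/8) * \<bar>Im s\<bar>) / (Re s - 1/2)"
      using C K True by (intro divide_right_mono mult_right_mono) auto
    finally show ?thesis using True by simp
  next
    case False
    have "norm (zeta_quotient s) = norm (zeta_quotient (1 - s)) * pi powr (1/2 - Re s)"
      by (rule norm_zeta_quotient_reflect) (use s in auto)
    also have "\<dots> \<le> (8 * C * K * exp (- (1/8) * \<bar>Im (1 - s)\<bar>) / (Re (1 - s) - 1/2)) * 4"
    proof (rule mult_mono)
      show "norm (zeta_quotient (1 - s)) \<le> 8 * C * K * exp (- (1/8) * \<bar>Im (1 - s)\<bar>) / (Re (1 - s) - 1/2)"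
        by (rule right) (use False s in auto)
      have "pi powr (1/2 - Re s) \<le> pi powr 1" using s pi_gt3 by (intro powr_mono) auto
      then show "pi powr (1/2 - Re s) \<le> 4" using pi_less_4 by simp
    qed (use C K False s in auto)
    finally show ?thesis using False by simp
  qed
  then show thesis using that[of "4 * (8 * C * K)"] C K by simp
qed

end

section \<open>The explicit formula\<close>

text \<open>With x = exp u the exponential is x^s. The integral is taken over t, so the factor i of
  ds is absent.\<close>

definition vertical_int :: "real \<Rightarrow> real \<Rightarrow> complex" where
  "vertical_int u c = (LINT t|lborel. zeta_quotient (Complex c t) * exp (Complex c t * of_real u))"

context
  assumes wmh: weak_mertens_hypothesis
begin

text \<open>On the circle with centre \<open>s0\<close> and radius \<open>R\<close>, the factor \<open>(s - s0)\<^sup>2 + R\<^sup>2\<close> has modulus \<open>2 R \<bar>Re (s - s0)\<bar>\<close>.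
  It cancels the factor \<open>1 / \<bar>Re s - 1/2\<bar>\<close> in the bound for the quotient, and the maximum modulus
  principle then bounds the quotient across the critical line.\<close>

lemma zeta_quotient_horizontal:
  obtains C :: real and T :: "nat \<Rightarrow> real" where "C > 0" "\<And>n. real n \<le> T n" "\<And>n \<gamma>. \<gamma> \<in> zero_ordinates \<Longrightarrow> \<bar>\<gamma>\<bar> \<noteq> T n"
    "\<And>n x t. \<bar>t\<bar> = T n \<Longrightarrow> x \<in> {1/4..3/4} \<Longrightarrow> norm (zeta_quotient (Complex x t)) \<le> C * (5 + real n)\<^sup>2 * exp (- (real n / 8))"
proof -
  obtain C0 where C0: "C0 > 0" "\<And>s. 1/4 \<le> Re s \<Longrightarrow> Re s \<le> 3/4 \<Longrightarrow> Re s \<noteq> 1/2 \<Longrightarrow>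
      norm (zeta_quotient s) \<le> C0 * exp (- (1/8) * \<bar>Im s\<bar>) / \<bar>Re s - 1/2\<bar>"
    using zeta_quotient_bound[OF wmh] by blast
  obtain c and T :: "nat \<Rightarrow> real" where c: "0 < c" "c \<le> 1" and T: "\<And>n. real n \<le> T n \<and> T n \<le> real n + 1"
    and gap: "\<And>n \<gamma>. \<gamma> \<in> zero_ordinates \<Longrightarrow> c / (5 + real n)\<^sup>2 \<le> \<bar>\<gamma> - T n\<bar> \<and> c / (5 + real n)\<^sup>2 \<le> \<bar>\<gamma> + T n\<bar>"
    by (rule good_heights[OF wmh], rule that)
  define C where "C = 4 * C0 * exp (1/8) / c"
  have main: "norm (zeta_quotient (Complex x t)) \<le> C * (5 + real n)\<^sup>2 * exp (- (real n / 8))"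
    if t: "\<bar>t\<bar> = T n" and x: "x \<in> {1/4..3/4}" for n x t
  proof -
    define r where "r = c / (5 + real n)\<^sup>2"
    \<comment> \<open>At most half the distance from t to the nearest ordinate, so that the closed
      disc around \<open>s0\<close> contains no zero.\<close>
    define R where "R = r / 2"
    define s0 where "s0 = Complex (1/2) t"
    define B where "B = C0 * exp (1/8) * exp (- (real n / 8))"
    have "(5::real)\<^sup>2 \<le> (5 + real n)\<^sup>2" by (intro power_mono) auto
    then have "r \<le> 1 / 25" unfolding r_def using c by (intro frac_le) auto
    moreover have "r > 0" using c by (simp add: r_def)
    ultimately have R: "0 < R" "R < r" "R \<le> 1/8" by (auto simp: R_def)
    have decay: "C0 * exp (- (1/8) * \<bar>y\<bar>) \<le> B" if "\<bar>y - t\<bar> \<le> R" for y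
    proof -
      have "\<bar>y\<bar> \<ge> real n - 1" using that R t T[of n] by linarith
      then have "exp (- (1/8) * \<bar>y\<bar>) \<le> exp (1/8 + - (real n / 8))" by simp
      then show ?thesis unfolding B_def exp_add using C0(1) by (simp add: mult.assoc)
    qed
    have gapt: "r \<le> \<bar>\<gamma> - t\<bar>" if "\<gamma> \<in> zero_ordinates" for \<gamma>
      using gap[OF that, of n] t by (auto simp: r_def abs_if split: if_splits)
    have near: "\<bar>Re z - 1/2\<bar> \<le> R" "\<bar>Im z - t\<bar> \<le> R" if "z \<in> cball s0 R" for z
      using that abs_Re_le_cmod[of "z - s0"] abs_Im_le_cmod[of "z - s0"]
      by (auto simp: s0_def dist_norm norm_minus_commute)
    have hol: "zeta_quotient holomorphic_on cball s0 R"
    proof (rule holomorphic_on_subset[OF zeta_quotient_holomorphic[OF wmh]])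
      show "cball s0 R \<subseteq> {s. 0 < Re s \<and> Re s < 1} - Complex (1/2) ` zero_ordinates"
      proof
        fix z assume z: "z \<in> cball s0 R"
        have "z \<notin> Complex (1/2) ` zero_ordinates" using near(2)[OF z] gapt R by force
        moreover have "0 < Re z" "Re z < 1" using near(1)[OF z] R by (auto simp: abs_le_iff)
        ultimately show "z \<in> {s. 0 < Re s \<and> Re s < 1} - Complex (1/2) ` zero_ordinates" by simp
      qed
    qed
    define G where "G = (\<lambda>z. zeta_quotient z * ((z - s0)\<^sup>2 + of_real (R\<^sup>2)))"
    have holG: "G holomorphic_on cball s0 R" unfolding G_def by (intro holomorphic_intros hol)
    have bG: "norm (G z) \<le> 2 * R * B" if z: "z \<in> ball s0 R" for z
    proof (rule maximum_modulus_frontier[OF _ _ _ _ z])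
      show "G holomorphic_on interior (ball s0 R)"
        by (rule holomorphic_on_subset[OF holG]) (simp add: ball_subset_cball)
      show "continuous_on (closure (ball s0 R)) G"
        using holomorphic_on_imp_continuous_on[OF holG] R(1) by simp
      show "bounded (ball s0 R)" by simp
      fix z assume "z \<in> frontier (ball s0 R)"
      then have z: "norm (z - s0) = R" using R(1) by (simp add: dist_norm norm_minus_commute)
      define w where "w = z - s0"
      have zc: "z \<in> cball s0 R" using z by (simp add: dist_norm norm_minus_commute)
      have Rew: "Re w = Re z - 1/2" by (simp add: w_def s0_def)
      have "complex_of_real (R\<^sup>2) = w * cnj w" using complex_norm_square[of w] z by (simp add: w_def)
      then have "w\<^sup>2 + of_real (R\<^sup>2) = w * (w + cnj w)" by (simp add: power2_eq_square distrib_left)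
      also have "w + cnj w = of_real (2 * Re w)" by (rule complex_add_cnj)
      finally have nw: "norm (w\<^sup>2 + of_real (R\<^sup>2)) = 2 * R * \<bar>Re w\<bar>"
        using z by (simp add: norm_mult w_def[symmetric] abs_mult)
      \<comment> \<open>At the two points of the circle on the critical line the bound for the
        quotient is void, but there the second factor of \<open>G\<close> is 0.\<close>
      show "norm (G z) \<le> 2 * R * B"
      proof (cases "Re w = 0")
        case True
        then show ?thesis using nw R C0(1) unfolding G_def w_def[symmetric] norm_mult by (simp add: B_def)
      next
        case False
        have "norm (zeta_quotient z) \<le> C0 * exp (- (1/8) * \<bar>Im z\<bar>) / \<bar>Re z - 1/2\<bar>"
          by (rule C0(2)) (use near(1)[OF zc] R False Rew in \<open>auto simp: abs_le_iff\<close>)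
        also have "\<dots> \<le> B / \<bar>Re w\<bar>"
          unfolding Rew by (intro divide_right_mono decay near(2)[OF zc]) simp
        finally have "norm (zeta_quotient z) * (2 * R * \<bar>Re w\<bar>) \<le> B / \<bar>Re w\<bar> * (2 * R * \<bar>Re w\<bar>)"
          using R by (intro mult_right_mono) auto
        also have "\<dots> = 2 * R * B" using False by simp
        finally show ?thesis unfolding G_def w_def[symmetric] norm_mult nw .
      qed
    qed
    have B0: "B \<ge> 0" using C0(1) by (simp add: B_def)
    have "norm (zeta_quotient (Complex x t)) \<le> 2 * B / R"
    \<comment> \<open>On the horizontal diameter (z - s0)^2 + R^2 is real and at least R^2, so
      dividing 2 R B by it leaves at most 2 B / R. Outside the disc the bound for the quotient
      applies directly.\<close>
    proof (cases "\<bar>x - 1/2\<bar> < R")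
      case True
      have w: "Complex x t - s0 = of_real (x - 1/2)" by (simp add: s0_def complex_eq_iff)
      have "Complex x t \<in> ball s0 R"
        using True w by (simp add: dist_norm norm_minus_commute[of s0] del: of_real_diff)
      from bG[OF this] have 1: "norm (zeta_quotient (Complex x t)) * norm (complex_of_real ((x - 1/2)\<^sup>2 + R\<^sup>2)) \<le> 2 * R * B"
        unfolding G_def w norm_mult by simp
      have 2: "norm (complex_of_real ((x - 1/2)\<^sup>2 + R\<^sup>2)) = (x - 1/2)\<^sup>2 + R\<^sup>2"
        unfolding norm_of_real by simp
      have "norm (zeta_quotient (Complex x t)) * R\<^sup>2 \<le> norm (zeta_quotient (Complex x t)) * ((x - 1/2)\<^sup>2 + R\<^sup>2)"
        by (intro mult_left_mono) auto
      then have "norm (zeta_quotient (Complex x t)) * R\<^sup>2 \<le> 2 * R * B"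
        using 1 unfolding 2 by (rule order_trans)
      then show ?thesis using R by (simp add: power2_eq_square field_simps)
    next
      case False
      have "norm (zeta_quotient (Complex x t)) \<le> C0 * exp (- (1/8) * \<bar>t\<bar>) / \<bar>x - 1/2\<bar>"
        using C0(2)[of "Complex x t"] x False R by auto
      also have "\<dots> \<le> B / R" using False R B0 decay[of t] by (intro frac_le) auto
      also have "\<dots> \<le> 2 * B / R" using B0 R by (intro divide_right_mono) auto
      finally show ?thesis .
    qed
    also have "2 * B / R = C * (5 + real n)\<^sup>2 * exp (- (real n / 8))"
      using c by (simp add: B_def R_def r_def C_def)
    finally show ?thesis .
  qed
  show thesis
  proof (rule that[of C T])
    show "C > 0" using C0 c by (simp add: C_def)
    show "real n \<le> T n" for n using T by blast
    show "\<bar>\<gamma>\<bar> \<noteq> T n" if g: "\<gamma> \<in> zero_ordinates" for n \<gamma>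
    proof -
      have "c / (5 + real n)\<^sup>2 > 0" using c by simp
      then show ?thesis using gap[OF g, of n] by linarith
    qed
  qed (rule main)
qed

lemma vertical_bound:
  obtains C where "C > 0" "\<And>c t u. c \<in> {1/4, 3/4} \<Longrightarrow>
    norm (zeta_quotient (Complex c t) * exp (Complex c t * of_real u)) \<le> C * exp (c * u) * exp (- (1/8) * \<bar>t\<bar>)"
proof -
  obtain C where C: "C > 0" "\<And>s. 1/4 \<le> Re s \<Longrightarrow> Re s \<le> 3/4 \<Longrightarrow> Re s \<noteq> 1/2 \<Longrightarrow>
      norm (zeta_quotient s) \<le> C * exp (- (1/8) * \<bar>Im s\<bar>) / \<bar>Re s - 1/2\<bar>"
    using zeta_quotient_bound[OF wmh] by blast
  have "norm (zeta_quotient (Complex c t) * exp (Complex c t * of_real u)) \<le> (4 * C) * exp (c * u) * exp (- (1/8) * \<bar>t\<bar>)"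
    if c: "c \<in> {1/4, 3/4}" for c t u
  proof -
    have "norm (zeta_quotient (Complex c t)) \<le> C * exp (- (1/8) * \<bar>t\<bar>) / \<bar>c - 1/2\<bar>"
      using C(2)[of "Complex c t"] c by auto
    also have "\<bar>c - 1/2\<bar> = 1/4" using c by auto
    finally have "norm (zeta_quotient (Complex c t)) \<le> 4 * C * exp (- (1/8) * \<bar>t\<bar>)" by simp
    then have "norm (zeta_quotient (Complex c t)) * exp (c * u) \<le> 4 * C * exp (- (1/8) * \<bar>t\<bar>) * exp (c * u)"
      by (rule mult_right_mono) simp
    then show ?thesis by (simp add: norm_mult norm_exp_eq_Re mult_ac)
  qed
  then show thesis using that[of "4 * C"] C(1) by simp
qed

lemma vertical_integrable:
  assumes c: "c \<in> {1/4, 3/4}"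
  shows "integrable lborel (\<lambda>t. zeta_quotient (Complex c t) * exp (Complex c t * of_real u))"
proof -
  obtain C where C: "C > 0" "\<And>c t u. c \<in> {1/4, 3/4} \<Longrightarrow>
    norm (zeta_quotient (Complex c t) * exp (Complex c t * of_real u)) \<le> C * exp (c * u) * exp (- (1/8) * \<bar>t\<bar>)"
    using vertical_bound by blast
  show ?thesis
  proof (rule integrable_exp_decay[OF _ _ C(2)[OF c]])
    show "continuous_on UNIV (\<lambda>t. zeta_quotient (Complex c t) * exp (Complex c t * of_real u))"
      by (intro continuous_intros continuous_on_vertical_line[OF zeta_quotient_holomorphic[OF wmh]])
         (use c in auto)
  qed simp
qed

lemma vertical_int_bound:
  obtains C where "C > 0" "\<And>u. norm (vertical_int u (1/4)) \<le> C * exp (u / 4)"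
proof -
  obtain C where C: "C > 0" "\<And>c t u. c \<in> {1/4, 3/4} \<Longrightarrow>
    norm (zeta_quotient (Complex c t) * exp (Complex c t * of_real u)) \<le> C * exp (c * u) * exp (- (1/8) * \<bar>t\<bar>)"
    using vertical_bound by blast
  define J where "J = (LINT t|lborel. exp (- (1/8) * \<bar>t::real\<bar>))"
  have "norm (vertical_int u (1/4)) \<le> (C * (1 + \<bar>J\<bar>)) * exp (u / 4)" for u
  proof -
    have "norm (vertical_int u (1/4)) \<le> (LINT t|lborel. C * exp (1/4 * u) * exp (- (1/8) * \<bar>t\<bar>))"
      unfolding vertical_int_def
    proof (rule Bochner_Integration.integral_norm_bound_integral[OF vertical_integrable])
      show "integrable lborel (\<lambda>t. C * exp (1/4 * u) * exp (- (1/8) * \<bar>t\<bar>))"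
        by (intro integrable_mult_right integrable_exp_neg_abs) simp
      show "norm (zeta_quotient (Complex (1/4) t) * exp (Complex (1/4) t * of_real u)) \<le> C * exp (1/4 * u) * exp (- (1/8) * \<bar>t\<bar>)" for t
        by (rule C(2)) simp
    qed simp
    also have "\<dots> = C * exp (1/4 * u) * J" unfolding J_def by simp
    also have "\<dots> \<le> C * exp (1/4 * u) * (1 + \<bar>J\<bar>)" using C by (intro mult_left_mono) auto
    finally show ?thesis by (simp add: mult_ac)
  qed
  then show thesis using that[of "C * (1 + \<bar>J\<bar>)"] C(1) by (simp add: add_pos_nonneg)
qed

lemma residue_zeta_quotient:
  assumes g: "\<gamma> \<in> zero_ordinates"
  shows "residue (\<lambda>s. zeta_quotient s * exp (s * of_real u)) (Complex (1/2) \<gamma>) = zero_coeff \<gamma> * exp (Complex (1/2) \<gamma> * of_real u)"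
proof -
  obtain c where c: "0 < c" "c \<le> 1"
    "\<And>\<gamma> \<gamma>'. \<gamma> \<in> zero_ordinates \<Longrightarrow> \<gamma>' \<in> zero_ordinates \<Longrightarrow> \<gamma> \<noteq> \<gamma>' \<Longrightarrow> c / (3 + \<bar>\<gamma>\<bar>)\<^sup>2 \<le> \<bar>\<gamma> - \<gamma>'\<bar>"
    using zero_gap[OF wmh] by blast
  obtain k where k: "k > 0" "\<And>\<gamma>. \<gamma> \<in> zero_ordinates \<Longrightarrow> k \<le> norm (deriv zeta_reg (Complex (1/2) \<gamma>))"
    using deriv_zeta_reg_lower_bound[OF wmh] by blast
  define p where "p = Complex (1/2) \<gamma>"
  \<comment> \<open>At most the gap to the other ordinates, so that \<open>p\<close> is the only
    zero in the open disc.\<close>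
  define r where "r = min (1/4) (c / (3 + \<bar>\<gamma>\<bar>)\<^sup>2)"
  have r: "r > 0" "r \<le> 1/4" "r \<le> c / (3 + \<bar>\<gamma>\<bar>)\<^sup>2"
    unfolding r_def using c by (simp, intro min.cobounded1, intro min.cobounded2)
  have "zeta_quotient holomorphic_on ball p r - {p}"
  proof (rule holomorphic_on_subset[OF zeta_quotient_holomorphic[OF wmh]])
    show "ball p r - {p} \<subseteq> {s. 0 < Re s \<and> Re s < 1} - Complex (1/2) ` zero_ordinates"
    proof
      fix z assume z: "z \<in> ball p r - {p}"
      have near: "\<bar>Re z - 1/2\<bar> < r" "\<bar>Im z - \<gamma>\<bar> < r"
        using z abs_Re_le_cmod[of "z - p"] abs_Im_le_cmod[of "z - p"]
        by (auto simp: p_def dist_norm norm_minus_commute)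
      have "0 < Re z" "Re z < 1" using near(1) r by linarith+
      moreover have "z \<notin> Complex (1/2) ` zero_ordinates"
      proof
        assume "z \<in> Complex (1/2) ` zero_ordinates"
        then obtain \<gamma>' where g': "z = Complex (1/2) \<gamma>'" "\<gamma>' \<in> zero_ordinates" by blast
        then have "c / (3 + \<bar>\<gamma>\<bar>)\<^sup>2 \<le> \<bar>\<gamma> - \<gamma>'\<bar>" using z by (intro c(3) g) (auto simp: p_def)
        then show False using near(2) r g' by simp
      qed
      ultimately show "z \<in> {s. 0 < Re s \<and> Re s < 1} - Complex (1/2) ` zero_ordinates" by simp
    qed
  qed
  then have hol: "(\<lambda>s. zeta_quotient s * exp (s * of_real u)) holomorphic_on ball p r - {p}"
    by (intro holomorphic_intros)
  define D where "D = deriv zeta_reg p"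
  have D0: "D \<noteq> 0" using k(1) k(2)[OF g] by (auto simp: D_def p_def)
  have Z0: "zeta_reg p = 0" using g by (simp add: zero_ordinates_def p_def)
  have Re: "Re p > 0" by (simp add: p_def)
  have "(zeta_reg has_field_derivative D) (at p)"
    unfolding D_def by (rule holomorphic_derivI[OF zeta_reg_holomorphic]) (use Re in \<open>auto intro: open_halfspace_Re_gt\<close>)
  then have q: "((\<lambda>w. zeta_reg w / (w - p)) \<longlongrightarrow> D) (at p)"
    using Z0 by (simp add: has_field_derivative_iff)
  have "isCont (\<lambda>s. Gamma ((1 - s) / 2) * (s - 1) * exp (s * of_real u)) p"
  proof (intro continuous_intros)
    show "(1 - p) / 2 \<notin> \<int>\<^sub>\<le>\<^sub>0" by (rule not_nonpos_Int_if_Re_pos) (simp add: p_def)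
  qed simp_all
  then have "((\<lambda>s. Gamma ((1 - s) / 2) * (s - 1) * exp (s * of_real u)) \<longlongrightarrow> Gamma ((1 - p) / 2) * (p - 1) * exp (p * of_real u)) (at p)"
    by (simp add: isCont_def)
  from tendsto_divide[OF this q D0]
  have "((\<lambda>s. Gamma ((1 - s) / 2) * (s - 1) * exp (s * of_real u) / (zeta_reg s / (s - p))) \<longlongrightarrow>
      Gamma ((1 - p) / 2) * (p - 1) * exp (p * of_real u) / D) (at p)" .
  moreover have "Gamma ((1 - s) / 2) * (s - 1) * exp (s * of_real u) / (zeta_reg s / (s - p)) = zeta_quotient s * exp (s * of_real u) * (s - p)" for s
    by (simp add: zeta_quotient_def)
  moreover have "Gamma ((1 - p) / 2) * (p - 1) * exp (p * of_real u) / D = zero_coeff \<gamma> * exp (p * of_real u)"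
  proof -
    have "(1 - p) / 2 = Complex (1/4) (- \<gamma>/2)" by (simp add: p_def complex_eq_iff)
    then show ?thesis by (simp add: zero_coeff_eq[OF g] D_def p_def)
  qed
  ultimately have lim: "((\<lambda>s. zeta_quotient s * exp (s * of_real u) * (s - p)) \<longlongrightarrow> zero_coeff \<gamma> * exp (p * of_real u)) (at p)"
    by (simp only:)
  show ?thesis
    using residue_simple'[OF open_ball _ hol lim] r(1) by (simp add: p_def)
qed

text \<open>The weight makes room for the inverse gaps between ordinates; the mean square uses m =
  2.\<close>

lemma zero_coeff_abs_summable:
  "(\<lambda>\<gamma>. (3 + \<bar>\<gamma>\<bar>) ^ m * norm (zero_coeff \<gamma>)) summable_on zero_ordinates"
proof -
  obtain C where C: "C > 0" "\<And>\<gamma>. \<gamma> \<in> zero_ordinates \<Longrightarrow> norm (zero_coeff \<gamma>) \<le> C * ((3 + \<bar>\<gamma>\<bar>) * exp (- (1/4) * \<bar>\<gamma>\<bar>))"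
    using zero_coeff_bound[OF wmh] by blast
  have "(\<lambda>\<gamma>. C * ((3 + \<bar>\<gamma>\<bar>) ^ Suc m * exp (- (1/4) * \<bar>\<gamma>\<bar>))) summable_on zero_ordinates"
    by (intro summable_on_cmult_right summable_on_zero_ordinates[OF wmh]) simp
  then show ?thesis
  proof (rule summable_on_comparison_test)
    fix \<gamma> assume "\<gamma> \<in> zero_ordinates"
    from mult_left_mono[OF C(2)[OF this], of "(3 + \<bar>\<gamma>\<bar>) ^ m"]
    show "(3 + \<bar>\<gamma>\<bar>) ^ m * norm (zero_coeff \<gamma>) \<le> C * ((3 + \<bar>\<gamma>\<bar>) ^ Suc m * exp (- (1/4) * \<bar>\<gamma>\<bar>))"
      by (simp add: mult_ac)
  qed simp
qed

lemma zero_sum_summable: "(\<lambda>\<gamma>. zero_coeff \<gamma> * exp (Complex (1/2) \<gamma> * of_real u)) summable_on zero_ordinates"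
proof (rule abs_summable_summable)
  have "(\<lambda>\<gamma>. exp (u / 2) * norm (zero_coeff \<gamma>)) summable_on zero_ordinates"
    using zero_coeff_abs_summable[of 0] by (intro summable_on_cmult_right) simp
  then show "(\<lambda>\<gamma>. norm (zero_coeff \<gamma> * exp (Complex (1/2) \<gamma> * of_real u))) summable_on zero_ordinates"
    by (simp add: norm_mult norm_exp_eq_Re mult.commute)
qed

lemma contour_shift:
  "2 * of_real pi * (\<Sum>\<^sub>\<infinity>\<gamma>\<in>zero_ordinates. zero_coeff \<gamma> * exp (Complex (1/2) \<gamma> * of_real u)) = vertical_int u (3/4) - vertical_int u (1/4)"
proof -
  obtain C and T :: "nat \<Rightarrow> real" where C: "C > 0" and T: "\<And>n. real n \<le> T n" and TZ: "\<And>n \<gamma>. \<gamma> \<in> zero_ordinates \<Longrightarrow> \<bar>\<gamma>\<bar> \<noteq> T n"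
    and hor: "\<And>n x t. \<bar>t\<bar> = T n \<Longrightarrow> x \<in> {1/4..3/4} \<Longrightarrow> norm (zeta_quotient (Complex x t)) \<le> C * (5 + real n)\<^sup>2 * exp (- (real n / 8))"
    by (rule zeta_quotient_horizontal, rule that)
  define P where "P = Complex (1/2) ` zero_ordinates"
  define a where "a = (\<lambda>\<gamma>. zero_coeff \<gamma> * exp (Complex (1/2) \<gamma> * of_real u))"
  define f where "f = (\<lambda>s. zeta_quotient s * exp (s * of_real u))"
  define e where "e = (\<lambda>n. C * (5 + real n)\<^sup>2 * exp (- (real n / 8)) * exp \<bar>u\<bar>)"
  define F where "F = (\<lambda>n. {\<gamma> \<in> zero_ordinates. \<bar>\<gamma>\<bar> < T n})"
  have Tlim: "filterlim T at_top sequentially"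
    by (rule filterlim_at_top_mono[OF filterlim_real_sequentially]) (use T in auto)
  have Pset: "{p \<in> P. \<bar>Im p\<bar> < t} = Complex (1/2) ` {\<gamma> \<in> zero_ordinates. \<bar>\<gamma>\<bar> < t}" for t
    by (auto simp: P_def)
  have "(\<lambda>n. 2 * pi * (\<Sum>p\<in>{p \<in> P. \<bar>Im p\<bar> < T n}. residue f p)) \<longlonglongrightarrow>
     (LINT t|lborel. f (Complex (3/4) t)) - (LINT t|lborel. f (Complex (1/4) t))"
  proof (rule strip_residue_theorem[where \<eta> = "1/8" and e = e])
    show "f holomorphic_on {z. 1/4 - 1/8 < Re z \<and> Re z < 3/4 + 1/8} - P"
      unfolding f_def P_def
      by (intro holomorphic_intros holomorphic_on_subset[OF zeta_quotient_holomorphic[OF wmh]]) auto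
    show "finite {p \<in> P. \<bar>Im p\<bar> < t}" for t unfolding Pset by (intro finite_imageI finite_zero_ordinates[OF wmh])
    show "filterlim T at_top sequentially" by (rule Tlim)
    show "\<forall>\<^sub>F n in sequentially. \<forall>p\<in>P. \<bar>Im p\<bar> \<noteq> T n" using TZ by (auto simp: P_def)
    show "e \<longlonglongrightarrow> 0" unfolding e_def by real_asymp
    show "\<forall>\<^sub>F n in sequentially. \<forall>x\<in>{1/4..3/4}. norm (f (Complex x (T n))) \<le> e n \<and> norm (f (Complex x (- T n))) \<le> e n"
    proof (intro always_eventually allI ballI)
      fix n x assume x: "x \<in> {1/4..3/4::real}"
      have Tn: "T n \<ge> 0" using T[of n] by (rule order_trans[rotated]) simp
      have "norm (f (Complex x t)) \<le> e n" if t: "\<bar>t\<bar> = T n" for t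
      proof -
        have "x * u \<le> \<bar>x * u\<bar>" by simp
        also have "\<dots> \<le> 1 * \<bar>u\<bar>" unfolding abs_mult using x by (intro mult_right_mono) auto
        finally have "exp (x * u) \<le> exp \<bar>u\<bar>" by simp
        then show ?thesis
          unfolding f_def e_def norm_mult norm_exp_eq_Re using C by (intro mult_mono hor t x) auto
      qed
      then show "norm (f (Complex x (T n))) \<le> e n \<and> norm (f (Complex x (- T n))) \<le> e n" using Tn by simp
    qed
    show "integrable lborel (\<lambda>t. f (Complex (1/4) t))" "integrable lborel (\<lambda>t. f (Complex (3/4) t))"
      unfolding f_def by (rule vertical_integrable, simp)+
  qed (auto simp: P_def)
  moreover have "(\<Sum>p\<in>{p \<in> P. \<bar>Im p\<bar> < T n}. residue f p) = (\<Sum>\<gamma>\<in>F n. a \<gamma>)" for n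
    unfolding Pset F_def by (subst sum.reindex) (auto simp: inj_on_def f_def a_def residue_zeta_quotient intro!: sum.cong)
  ultimately have l1: "(\<lambda>n. 2 * of_real pi * (\<Sum>\<gamma>\<in>F n. a \<gamma>)) \<longlonglongrightarrow> vertical_int u (3/4) - vertical_int u (1/4)"
    by (simp add: vertical_int_def f_def)
  \<comment> \<open>The truncations \<open>F n\<close> eventually contain every finite set of
    ordinates, so the limit along the heights is the unordered sum.\<close>
  have "filterlim F (finite_subsets_at_top zero_ordinates) sequentially"
    unfolding filterlim_finite_subsets_at_top
  proof (intro allI impI)
    fix X assume X: "finite X \<and> X \<subseteq> zero_ordinates"
    have "\<forall>\<^sub>F n in sequentially. \<forall>\<gamma>\<in>X. \<bar>\<gamma>\<bar> < T n"
      using X Tlim by (intro eventually_ball_finite) (auto simp: filterlim_at_top_dense)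
    then show "\<forall>\<^sub>F n in sequentially. finite (F n) \<and> X \<subseteq> F n \<and> F n \<subseteq> zero_ordinates"
      by eventually_elim (use X finite_zero_ordinates[OF wmh] in \<open>auto simp: F_def\<close>)
  qed
  moreover have "(sum a \<longlongrightarrow> infsum a zero_ordinates) (finite_subsets_at_top zero_ordinates)"
    using has_sum_infsum[OF zero_sum_summable[of u]] by (simp add: has_sum_def a_def)
  ultimately have "(\<lambda>n. sum a (F n)) \<longlonglongrightarrow> infsum a zero_ordinates" by (rule filterlim_compose[rotated])
  then have "(\<lambda>n. 2 * of_real pi * (\<Sum>\<gamma>\<in>F n. a \<gamma>)) \<longlonglongrightarrow> 2 * of_real pi * infsum a zero_ordinates"
    by (intro tendsto_mult tendsto_const)
  from LIMSEQ_unique[OF this l1] show ?thesis by (simp add: a_def)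
qed

end

section \<open>F as an integral over the line Re s = 3/4\<close>

definition mellin_term :: "real \<Rightarrow> nat \<Rightarrow> complex \<Rightarrow> complex" where
  "mellin_term u n s = Gamma ((1 - s) / 2) * exp (s * of_real u) * of_nat n powr (- s)"

lemma Gamma_three_quarters_decay:
  obtains C where "C > 0" "\<And>t. norm (Gamma ((1 - Complex (3/4) t) / 2)) \<le> C * exp (- (1/4) * \<bar>t\<bar>)"
proof -
  obtain C where C: "C > 0" "\<And>x y. x \<in> {1/8..2} \<Longrightarrow> norm (Gamma (Complex x y)) \<le> C * exp (- (1/2) * \<bar>y\<bar>)"
    using Gamma_strip_decay[of "1/8"] by auto
  have "(1 - Complex (3/4) t) / 2 = Complex (1/8) (- t / 2)" for t by (simp add: complex_eq_iff)
  then have "norm (Gamma ((1 - Complex (3/4) t) / 2)) \<le> C * exp (- (1/4) * \<bar>t\<bar>)" for t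
    using C(2)[of "1/8" "- t / 2"] by simp
  then show thesis using that C(1) by blast
qed

lemma mellin_term_integrable:
  assumes "n \<ge> 1"
  shows "integrable lborel (\<lambda>t. mellin_term u n (Complex (3/4) t))"
proof -
  obtain C where C: "C > 0" "\<And>t. norm (Gamma ((1 - Complex (3/4) t) / 2)) \<le> C * exp (- (1/4) * \<bar>t\<bar>)"
    using Gamma_three_quarters_decay by blast
  show ?thesis
  proof (rule integrable_exp_decay[where c = "1/4"])
    have "mellin_term u n holomorphic_on {s. Re s < 1}"
      unfolding mellin_term_def
      by (intro holomorphic_intros) (use assms in \<open>auto intro!: not_nonpos_Int_if_Re_pos\<close>)
    then show "continuous_on UNIV (\<lambda>t. mellin_term u n (Complex (3/4) t))"
      by (rule continuous_on_vertical_line) simp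
    fix t
    have "norm (mellin_term u n (Complex (3/4) t)) = norm (Gamma ((1 - Complex (3/4) t) / 2)) * exp (3/4 * u) * real n powr (- (3/4))"
      using norm_of_nat_powr[OF assms, of "- Complex (3/4) t"] by (simp add: mellin_term_def norm_mult norm_exp_eq_Re)
    also have "\<dots> \<le> C * exp (- (1/4) * \<bar>t\<bar>) * exp (3/4 * u) * real n powr (- (3/4))"
      by (intro mult_right_mono C) auto
    finally show "norm (mellin_term u n (Complex (3/4) t)) \<le> C * exp (3/4 * u) * real n powr (- (3/4)) * exp (- (1/4) * \<bar>t\<bar>)"
      by (simp add: mult_ac)
  qed simp
qed

text \<open>The substitution v = - t / 2 turns (1 - s) / 2 into the variable of
  \<open>cahen_mellin\<close>, with l = 2 ln(x / n), so that exp l = (x / n)^2. The prefactor n / x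
  stems from the 1 in 1 - s.\<close>

lemma mellin_term_integral:
  assumes n: "n \<ge> 1" and x: "x > 0"
  shows "(LINT t|lborel. mellin_term (ln x) n (Complex (3/4) t)) = of_real (4 * pi * x * (exp (- ((x / real n)\<^sup>2)) / real n))"
proof -
  define L where "L = ln (real n)"
  define u where "u = ln x"
  define l where "l = 2 * (u - L)"
  define f where "f = (\<lambda>v. Gamma (Complex (1/8) v) * exp (- (Complex (1/8) v) * of_real l))"
  have fm: "f (0 + (- 1/2) * t) = of_real (real n / x) * mellin_term u n (Complex (3/4) t)" for t
  proof -
    define s where "s = Complex (3/4) t"
    have 1: "(1 - s) / 2 = Complex (1/8) (0 + (- 1/2) * t)" by (simp add: s_def complex_eq_iff)
    have p: "of_nat n powr (- s) = exp (- s * of_real L)"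
    proof -
      have "Ln (of_nat n) = of_real L" using n Ln_of_real[of "real n"] by (simp add: L_def)
      then show ?thesis using n by (simp add: powr_def)
    qed
    have "of_real (real n / x) = exp (complex_of_real (L - u))"
      using n x by (simp add: L_def u_def exp_of_real exp_diff del: of_real_diff)
    moreover have "- ((1 - s) / 2) * of_real l = of_real (L - u) + (s * of_real u + - s * of_real L)"
      by (simp add: l_def field_simps)
    ultimately have "exp (- ((1 - s) / 2) * of_real l) = of_real (real n / x) * (exp (s * of_real u) * of_nat n powr (- s))"
      by (simp only: exp_add p)
    then show ?thesis unfolding f_def mellin_term_def s_def[symmetric] 1[symmetric] by (simp only: mult_ac)
  qed
  have "2 * pi * exp (- exp l) = (LINT v|lborel. f v)" using cahen_mellin[of l] by (simp add: f_def)
  also have "(LINT v|lborel. f v) = \<bar>- 1/2\<bar> *\<^sub>R (LINT t|lborel. f (0 + (- 1/2) * t))"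
    by (rule lborel_integral_real_affine) simp
  also have "(LINT t|lborel. f (0 + (- 1/2) * t)) = of_real (real n / x) * (LINT t|lborel. mellin_term u n (Complex (3/4) t))"
    unfolding fm by simp
  finally have "of_real (real n / x) * (LINT t|lborel. mellin_term u n (Complex (3/4) t)) = of_real (4 * pi * exp (- exp l))"
    using x n by (simp add: scaleR_conv_of_real exp_of_real[symmetric] field_simps)
  then have "(LINT t|lborel. mellin_term u n (Complex (3/4) t)) = of_real (4 * pi * exp (- exp l)) * of_real (x / real n)"
    using n x by (simp add: field_simps)
  moreover have "exp l = (x / real n)\<^sup>2"
  proof -
    have "exp l = exp (u - L) * exp (u - L)" by (simp add: l_def flip: exp_add)
    also have "exp (u - L) = x / real n" using n x by (simp add: u_def L_def exp_diff)
    finally show ?thesis by (simp add: power2_eq_square)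
  qed
  ultimately show ?thesis by (simp add: u_def)
qed

context
  assumes wmh: weak_mertens_hypothesis
begin

text \<open>The series of moebius(n) n^(-s) is not known to converge absolutely on this line. Sum
  and integral are therefore interchanged in the Abel-summed series, and the result is summed back
  by parts to the series of F, at the price of a boundary term.\<close>

lemma gauss_F_vertical:
  assumes x: "x > 0"
  shows "complex_of_real (gauss_F x) = vertical_int (ln x) (3/4) / of_real (4 * pi * x)"
proof -
  define u where "u = ln x"
  define g where "g = (\<lambda>n t. mellin_term u n (Complex (3/4) t))"
  define h where "h = (\<lambda>n. exp (- ((x / real n)\<^sup>2)) / real n)"
  define m where "m = (\<lambda>n. mertens (real (Suc n)))"
  define D where "D = (\<lambda>k t. complex_of_real (m k) * (g (Suc k) t - g (Suc (Suc k)) t))"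
  obtain C where C: "C > 0" "\<And>t. norm (Gamma ((1 - Complex (3/4) t) / 2)) \<le> C * exp (- (1/4) * \<bar>t\<bar>)"
    using Gamma_three_quarters_decay by blast
  obtain K where K: "K > 0"
    "\<And>d. 0 < d \<Longrightarrow> d \<le> 1 \<Longrightarrow> summable (\<lambda>n. \<bar>mertens (real (Suc n))\<bar> * real (Suc n) powr (- (3/2) - d))"
    "\<And>d. 0 < d \<Longrightarrow> d \<le> 1 \<Longrightarrow> (\<Sum>n. \<bar>mertens (real (Suc n))\<bar> * real (Suc n) powr (- (3/2) - d)) \<le> K / d"
    using mertens_abs_series[OF wmh] by blast
  \<comment> \<open>The exponent - 7/4 is - Re s - 1 at Re s = 3/4, the case d = 1/4 of the
    majorant.\<close>
  define b where "b = (\<lambda>n. \<bar>m n\<bar> * real (Suc n) powr (- (7/4)))"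
  have sb: "summable b" using K(2)[of "1/4"] by (simp add: b_def m_def)
  define C' where "C' = 8 * C * exp (3/4 * u)"
  have gi: "integrable lborel (g (Suc n))" for n unfolding g_def by (rule mellin_term_integrable) simp
  have gv: "(LINT t|lborel. g (Suc n) t) = of_real (4 * pi * x * h (Suc n))" for n
    using mellin_term_integral[of "Suc n" x] x by (simp add: g_def u_def h_def)
  have Di: "integrable lborel (D k)" for k unfolding D_def by (intro integrable_mult_right Bochner_Integration.integrable_diff gi)
  have Dform: "D k t = Gamma ((1 - Complex (3/4) t) / 2) * exp (Complex (3/4) t * of_real u) *
      (of_real (mertens (real (Suc k))) * (of_nat (Suc k) powr (- Complex (3/4) t) - of_nat (Suc (Suc k)) powr (- Complex (3/4) t)))" for k t
    unfolding D_def g_def mellin_term_def m_def by (simp only: right_diff_distrib mult_ac)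
  have Db: "norm (D k t) \<le> b k * (C' * exp (- (1/8) * \<bar>t\<bar>))" for k t
  proof -
    define s where "s = Complex (3/4) t"
    have "norm s \<le> 1 + \<bar>t\<bar>" using cmod_le[of s] by (simp add: s_def)
    also have "\<dots> \<le> 8 * (1 + \<bar>t\<bar> / 8)" by simp
    also have "\<dots> \<le> 8 * exp (\<bar>t\<bar> / 8)" using exp_ge_add_one_self[of "\<bar>t\<bar> / 8"] by (intro mult_left_mono) auto
    finally have ns: "norm s \<le> 8 * exp (\<bar>t\<bar> / 8)" .
    define q where "q = of_real (mertens (real (Suc k))) * (of_nat (Suc k) powr (- s) - of_nat (Suc (Suc k)) powr (- s))"
    have "norm q \<le> norm s * b k"
      using norm_mertens_term_le[of s k] by (simp add: s_def q_def b_def m_def)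
    also have "\<dots> \<le> 8 * exp (\<bar>t\<bar> / 8) * b k" using ns by (intro mult_right_mono) (auto simp: b_def)
    finally have q: "norm q \<le> 8 * exp (\<bar>t\<bar> / 8) * b k" .
    have "norm (D k t) = norm (Gamma ((1 - s) / 2)) * exp (3/4 * u) * norm q"
      unfolding Dform s_def[symmetric] q_def[symmetric] norm_mult norm_exp_eq_Re by (simp add: s_def)
    also have "\<dots> \<le> (C * exp (- (1/4) * \<bar>t\<bar>)) * exp (3/4 * u) * (8 * exp (\<bar>t\<bar> / 8) * b k)"
    proof (rule mult_mono[OF _ q])
      show "norm (Gamma ((1 - s) / 2)) * exp (3/4 * u) \<le> (C * exp (- (1/4) * \<bar>t\<bar>)) * exp (3/4 * u)"
        unfolding s_def by (rule mult_right_mono[OF C(2)]) simp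
    qed (use C in auto)
    also have "\<dots> = b k * (C' * (exp (- (1/4) * \<bar>t\<bar>) * exp (\<bar>t\<bar> / 8)))" by (simp add: C'_def mult_ac)
    also have "exp (- (1/4) * \<bar>t\<bar>) * exp (\<bar>t\<bar> / 8) = exp (- (1/8) * \<bar>t\<bar>)" by (simp flip: exp_add)
    finally show ?thesis .
  qed
  have ei: "integrable lborel (\<lambda>t. C' * exp (- (1/8) * \<bar>t::real\<bar>))"
    by (intro integrable_mult_right integrable_exp_neg_abs) simp
  have ae: "AE t in lborel. summable (\<lambda>k. norm (D k t))"
  proof (rule AE_I2)
    fix t
    show "summable (\<lambda>k. norm (D k t))"
      by (rule summable_comparison_test'[OF summable_mult2[OF sb, of "C' * exp (- (1/8) * \<bar>t\<bar>)"]]) (use Db in simp)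
  qed
  define J where "J = (LINT t|lborel. C' * exp (- (1/8) * \<bar>t::real\<bar>))"
  have sI: "summable (\<lambda>k. LINT t|lborel. norm (D k t))"
  proof (rule summable_comparison_test'[OF summable_mult2[OF sb, of J]])
    fix k :: nat
    have "(LINT t|lborel. norm (D k t)) \<le> (LINT t|lborel. b k * (C' * exp (- (1/8) * \<bar>t\<bar>)))"
      by (intro integral_mono integrable_norm Di integrable_mult_right[OF ei] Db)
    then show "norm (LINT t|lborel. norm (D k t)) \<le> b k * J"
      by (simp add: J_def integral_nonneg_AE)
  qed
  have Dsum: "(\<Sum>k. D k t) = zeta_quotient (Complex (3/4) t) * exp (Complex (3/4) t * of_real u)" for t
  proof -
    define s where "s = Complex (3/4) t"
    define q where "q = (\<lambda>k. of_real (mertens (real (Suc k))) * (of_nat (Suc k) powr (- s) - of_nat (Suc (Suc k)) powr (- s)))"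
    have "norm (q k) \<le> norm s * b k" for k
      using norm_mertens_term_le[of s k] by (simp add: s_def q_def b_def m_def)
    then have "summable q" by (intro summable_comparison_test'[OF summable_mult[OF sb, of "norm s"]])
    moreover have "D k t = Gamma ((1 - s) / 2) * exp (s * of_real u) * q k" for k
      unfolding Dform s_def q_def ..
    ultimately have "(\<Sum>k. D k t) = Gamma ((1 - s) / 2) * exp (s * of_real u) * (\<Sum>k. q k)"
      by (simp only: suminf_mult)
    also have "(\<Sum>k. q k) = mertens_series s" by (simp add: mertens_series_def q_def)
    also have "mertens_series s = (s - 1) / zeta_reg s"
    proof -
      have s: "Re s > 1/2" by (simp add: s_def)
      show ?thesis using mertens_series_zeta_reg[OF wmh s] zeta_reg_nonzero_right[OF wmh s] by (simp add: field_simps)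
    qed
    finally show ?thesis by (simp add: zeta_quotient_def s_def)
  qed
  have "(\<lambda>k. LINT t|lborel. D k t) sums vertical_int u (3/4)"
    using sums_integral[OF Di ae sI] by (simp add: Dsum vertical_int_def)
  moreover have "(LINT t|lborel. D k t) = of_real (4 * pi * x) * (of_real (m k) * (of_real (h (Suc k)) - of_real (h (Suc (Suc k)))))" for k
    unfolding D_def using gi by (simp add: gv right_diff_distrib)
  ultimately have "(\<lambda>k. of_real (4 * pi * x) * (of_real (m k) * (of_real (h (Suc k)) - of_real (h (Suc (Suc k)))))) sums vertical_int u (3/4)"
    by simp
  from sums_divide[OF this, of "of_real (4 * pi * x)"]
  have 1: "(\<lambda>k. of_real (m k) * (complex_of_real (h (Suc k)) - of_real (h (Suc (Suc k))))) sums (vertical_int u (3/4) / of_real (4 * pi * x))"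
    using x by simp
  \<comment> \<open>The boundary term is at most |M(N)| / N, which is where M(N) = o(N)
    enters.\<close>
  have 2: "(\<lambda>N. complex_of_real (mertens (real N)) * of_real (h (Suc N))) \<longlonglongrightarrow> 0"
  proof (rule Lim_null_comparison)
    show "(\<lambda>N. \<bar>mertens (real N) / real N\<bar>) \<longlonglongrightarrow> 0"
      using mertens_over_n_tendsto_0[OF wmh] by (rule tendsto_rabs_zero)
    show "\<forall>\<^sub>F N in sequentially. norm (complex_of_real (mertens (real N)) * of_real (h (Suc N))) \<le> \<bar>mertens (real N) / real N\<bar>"
      using eventually_ge_at_top[of 1]
    proof eventually_elim
      case (elim N)
      have "h (Suc N) \<le> 1 / real N" unfolding h_def using elim by (intro frac_le) auto
      moreover have "0 \<le> h (Suc N)" by (simp add: h_def)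
      ultimately have "\<bar>mertens (real N)\<bar> * \<bar>h (Suc N)\<bar> \<le> \<bar>mertens (real N)\<bar> * (1 / real N)"
        by (intro mult_left_mono) auto
      then show ?case by (simp only: norm_mult norm_of_real abs_divide abs_of_nat times_divide_eq_right mult_1_right)
    qed
  qed
  have "(\<lambda>n. of_real (moebius (Suc n)) * complex_of_real (h (Suc n))) sums (vertical_int u (3/4) / of_real (4 * pi * x))"
    unfolding sums_def moebius_abel_summation[of "\<lambda>n. of_real (h n)"]
    using tendsto_add[OF 1[unfolded sums_def m_def] 2] by simp
  then have 3: "(\<lambda>n. complex_of_real (moebius (Suc n) * h (Suc n))) sums (vertical_int u (3/4) / of_real (4 * pi * x))"
    by simp
  have R: "(\<lambda>n. moebius (Suc n) * h (Suc n)) sums Re (vertical_int u (3/4) / of_real (4 * pi * x))"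
    using sums_Re[OF 3] by simp
  have e: "moebius (Suc n) * h (Suc n) = moebius (Suc n) / real (Suc n) * exp (- ((x / real (Suc n))\<^sup>2))" for n
    by (simp add: h_def)
  have F: "gauss_F x = Re (vertical_int u (3/4) / of_real (4 * pi * x))"
    unfolding gauss_F_def e[symmetric] using R by (rule sums_unique[symmetric])
  have "(\<lambda>n. complex_of_real (moebius (Suc n) * h (Suc n))) sums of_real (gauss_F x)"
    unfolding F by (rule sums_of_real[OF R])
  then show ?thesis
    using sums_unique2[OF 3] by (simp add: u_def)
qed

end

section \<open>The mean square\<close>

text \<open>The off-diagonal terms are controlled by the polynomial lower bound for the gaps between the
  frequencies, against which the coefficients decay fast enough.\<close>

lemma finite_mean_square:
  fixes c :: "real \<Rightarrow> complex"
  assumes F: "finite F" and d: "d > 0" and U: "U \<ge> 0"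
    and gap: "\<And>\<gamma> \<gamma>'. \<gamma> \<in> F \<Longrightarrow> \<gamma>' \<in> F \<Longrightarrow> \<gamma> \<noteq> \<gamma>' \<Longrightarrow> d / (3 + \<bar>\<gamma>\<bar>)\<^sup>2 \<le> \<bar>\<gamma> - \<gamma>'\<bar>"
    and W: "(\<Sum>\<gamma>\<in>F. (3 + \<bar>\<gamma>\<bar>)\<^sup>2 * norm (c \<gamma>)) \<le> W"
  shows "\<exists>I. ((\<lambda>u. (norm (\<Sum>\<gamma>\<in>F. c \<gamma> * exp (\<i> * of_real (\<gamma> * u))))\<^sup>2) has_integral I) {0..U} \<and>
    \<bar>I - U * (\<Sum>\<gamma>\<in>F. (norm (c \<gamma>))\<^sup>2)\<bar> \<le> 2 / d * W\<^sup>2"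
proof -
  define S where "S = (\<lambda>u. \<Sum>\<gamma>\<in>F. c \<gamma> * exp (\<i> * of_real (\<gamma> * u)))"
  define J where "J = (\<lambda>\<beta>::real. if \<beta> = 0 then of_real U else (exp (\<i> * of_real (\<beta> * U)) - 1) / (\<i> * of_real \<beta>))"
  define w where "w = (\<lambda>\<gamma>. (3 + \<bar>\<gamma>\<bar>)\<^sup>2 * norm (c \<gamma>))"
  have J: "((\<lambda>u. exp (\<i> * of_real (\<beta> * u))) has_integral J \<beta>) {0..U}" for \<beta>
  proof (cases "\<beta> = 0")
    case True
    then show ?thesis using has_integral_const_real[of "1::complex" 0 U] U by (simp add: J_def scaleR_conv_of_real)
  next
    case False
    have "((\<lambda>u. exp (\<i> * of_real (\<beta> * u))) has_integral
        (exp (\<i> * of_real (\<beta> * U)) / (\<i> * of_real \<beta>) - exp (\<i> * of_real (\<beta> * 0)) / (\<i> * of_real \<beta>))) {0..U}"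
    proof (rule fundamental_theorem_of_calculus[OF U])
      fix u assume "u \<in> {0..U}"
      have "((\<lambda>z. exp (\<i> * (of_real \<beta> * z)) / (\<i> * of_real \<beta>)) has_field_derivative exp (\<i> * (of_real \<beta> * of_real u))) (at (of_real u))"
        using False by (auto intro!: derivative_eq_intros simp: mult_ac)
      from has_vector_derivative_real_field[OF this]
      show "((\<lambda>u. exp (\<i> * of_real (\<beta> * u)) / (\<i> * of_real \<beta>)) has_vector_derivative exp (\<i> * of_real (\<beta> * u))) (at u within {0..U})"
        by (simp add: has_vector_derivative_at_within)
    qed
    then show ?thesis using False by (simp add: J_def diff_divide_distrib)
  qed
  have Sq: "of_real ((norm (S u))\<^sup>2) = (\<Sum>\<gamma>\<in>F. \<Sum>\<gamma>'\<in>F. c \<gamma> * cnj (c \<gamma>') * exp (\<i> * of_real ((\<gamma> - \<gamma>') * u)))" for u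
  proof -
    have e: "exp (\<i> * of_real (\<gamma> * u)) * cnj (exp (\<i> * of_real (\<gamma>' * u))) = exp (\<i> * of_real ((\<gamma> - \<gamma>') * u))" for \<gamma> \<gamma>'
      by (simp add: exp_cnj algebra_simps flip: exp_add)
    have "of_real ((norm (S u))\<^sup>2) = S u * cnj (S u)" by (rule complex_norm_square)
    also have "\<dots> = (\<Sum>\<gamma>\<in>F. \<Sum>\<gamma>'\<in>F. (c \<gamma> * exp (\<i> * of_real (\<gamma> * u))) * cnj (c \<gamma>' * exp (\<i> * of_real (\<gamma>' * u))))"
      unfolding S_def cnj_sum by (rule sum_product)
    also have "\<dots> = (\<Sum>\<gamma>\<in>F. \<Sum>\<gamma>'\<in>F. c \<gamma> * cnj (c \<gamma>') * exp (\<i> * of_real ((\<gamma> - \<gamma>') * u)))"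
    proof (intro sum.cong refl)
      fix \<gamma> \<gamma>'
      show "c \<gamma> * exp (\<i> * of_real (\<gamma> * u)) * cnj (c \<gamma>' * exp (\<i> * of_real (\<gamma>' * u))) =
          c \<gamma> * cnj (c \<gamma>') * exp (\<i> * of_real ((\<gamma> - \<gamma>') * u))"
        unfolding e[symmetric] complex_cnj_mult by (simp only: mult_ac)
    qed
    finally show ?thesis .
  qed
  define I where "I = (\<Sum>\<gamma>\<in>F. \<Sum>\<gamma>'\<in>F. c \<gamma> * cnj (c \<gamma>') * J (\<gamma> - \<gamma>'))"
  have "((\<lambda>u. complex_of_real ((norm (S u))\<^sup>2)) has_integral I) {0..U}"
    unfolding Sq I_def by (intro has_integral_sum F has_integral_mult_right J)
  from has_integral_linear[OF this bounded_linear_Re]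
  have int: "((\<lambda>u. (norm (S u))\<^sup>2) has_integral Re I) {0..U}" by (simp add: o_def)
  \<comment> \<open>With the diagonal removed, every entry is bounded independently of U.\<close>
  define I' where "I' = (\<lambda>\<gamma> \<gamma>'. c \<gamma> * cnj (c \<gamma>') * J (\<gamma> - \<gamma>') - (if \<gamma> = \<gamma>' then of_real (U * (norm (c \<gamma>))\<^sup>2) else 0))"
  have I'b: "norm (I' \<gamma> \<gamma>') \<le> 2 / d * (w \<gamma> * w \<gamma>')" if g: "\<gamma> \<in> F" "\<gamma>' \<in> F" for \<gamma> \<gamma>'
  proof (cases "\<gamma> = \<gamma>'")
    case True
    have "c \<gamma> * cnj (c \<gamma>) * of_real U = of_real (U * (norm (c \<gamma>))\<^sup>2)"
      using complex_norm_square[of "c \<gamma>"] by (simp add: mult.commute)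
    then have "I' \<gamma> \<gamma>' = 0" using True by (simp add: I'_def J_def)
    then show ?thesis using d by (simp add: w_def)
  next
    case False
    define \<beta> where "\<beta> = \<gamma> - \<gamma>'"
    have b: "\<beta> \<noteq> 0" using False by (simp add: \<beta>_def)
    have db: "d / (3 + \<bar>\<gamma>\<bar>)\<^sup>2 \<le> \<bar>\<beta>\<bar>" using gap[OF g False] by (simp add: \<beta>_def)
    have "norm (exp (\<i> * of_real (\<beta> * U)) - 1) \<le> 2"
      using norm_triangle_ineq4[of "exp (\<i> * of_real (\<beta> * U))" 1] by (simp add: norm_exp_eq_Re)
    then have "norm (J \<beta>) \<le> 2 / (d / (3 + \<bar>\<gamma>\<bar>)\<^sup>2)"
      unfolding J_def using b db d by (simp only: if_False norm_divide) (intro frac_le, auto simp: norm_mult)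
    also have "\<dots> = 2 / d * (3 + \<bar>\<gamma>\<bar>)\<^sup>2" by simp
    \<comment> \<open>The gap bound weighs only the first index; a factor of at least 1 is added for
      the second, so that the double sum factors into a square.\<close>
    also have "\<dots> \<le> 2 / d * ((3 + \<bar>\<gamma>\<bar>)\<^sup>2 * (3 + \<bar>\<gamma>'\<bar>)\<^sup>2)"
    proof -
      have "1 \<le> (3 + \<bar>\<gamma>'\<bar>)\<^sup>2" by (rule one_le_power) simp
      then have "(3 + \<bar>\<gamma>\<bar>)\<^sup>2 * 1 \<le> (3 + \<bar>\<gamma>\<bar>)\<^sup>2 * (3 + \<bar>\<gamma>'\<bar>)\<^sup>2" by (rule mult_left_mono) simp
      then show ?thesis using d by (intro mult_left_mono) auto
    qed
    finally have "norm (c \<gamma>) * norm (c \<gamma>') * norm (J \<beta>) \<le> norm (c \<gamma>) * norm (c \<gamma>') * (2 / d * ((3 + \<bar>\<gamma>\<bar>)\<^sup>2 * (3 + \<bar>\<gamma>'\<bar>)\<^sup>2))"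
      by (rule mult_left_mono) simp
    then have "norm (c \<gamma> * cnj (c \<gamma>') * J \<beta>) \<le> 2 / d * (w \<gamma> * w \<gamma>')"
      by (simp add: norm_mult w_def mult_ac)
    then show ?thesis using False by (simp add: I'_def \<beta>_def)
  qed
  have w0: "0 \<le> (\<Sum>\<gamma>\<in>F. w \<gamma>)" by (intro sum_nonneg) (simp add: w_def)
  have "(\<Sum>\<gamma>\<in>F. \<Sum>\<gamma>'\<in>F. I' \<gamma> \<gamma>') = I - (\<Sum>\<gamma>\<in>F. \<Sum>\<gamma>'\<in>F. if \<gamma> = \<gamma>' then of_real (U * (norm (c \<gamma>))\<^sup>2) else 0)"
    by (simp only: I'_def I_def sum_subtractf)
  also have "(\<Sum>\<gamma>\<in>F. \<Sum>\<gamma>'\<in>F. if \<gamma> = \<gamma>' then of_real (U * (norm (c \<gamma>))\<^sup>2) else 0) = complex_of_real (U * (\<Sum>\<gamma>\<in>F. (norm (c \<gamma>))\<^sup>2))"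
    using F by (simp add: sum_distrib_left)
  finally have "norm (I - complex_of_real (U * (\<Sum>\<gamma>\<in>F. (norm (c \<gamma>))\<^sup>2))) = norm (\<Sum>\<gamma>\<in>F. \<Sum>\<gamma>'\<in>F. I' \<gamma> \<gamma>')" by simp
  also have "\<dots> \<le> (\<Sum>\<gamma>\<in>F. \<Sum>\<gamma>'\<in>F. 2 / d * (w \<gamma> * w \<gamma>'))"
    by (intro order_trans[OF norm_sum] sum_mono I'b)
  also have "\<dots> = 2 / d * ((\<Sum>\<gamma>\<in>F. w \<gamma>) * (\<Sum>\<gamma>\<in>F. w \<gamma>))"
    unfolding sum_product by (simp only: sum_distrib_left)
  also have "\<dots> \<le> 2 / d * (W * W)"
    using W w0 d by (intro mult_left_mono mult_mono) (auto simp: w_def)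
  finally have "norm (I - complex_of_real (U * (\<Sum>\<gamma>\<in>F. (norm (c \<gamma>))\<^sup>2))) \<le> 2 / d * W\<^sup>2"
    by (simp add: power2_eq_square)
  moreover have "\<bar>Re I - U * (\<Sum>\<gamma>\<in>F. (norm (c \<gamma>))\<^sup>2)\<bar> \<le> norm (I - complex_of_real (U * (\<Sum>\<gamma>\<in>F. (norm (c \<gamma>))\<^sup>2)))"
    using abs_Re_le_cmod[of "I - complex_of_real (U * (\<Sum>\<gamma>\<in>F. (norm (c \<gamma>))\<^sup>2))"] by simp
  ultimately show ?thesis using int unfolding S_def by (intro exI[of _ "Re I"]) simp
qed

lemma norm_sq_diff_le:
  fixes z w :: complex
  assumes "norm z \<le> B" "norm w \<le> B"
  shows "\<bar>(norm z)\<^sup>2 - (norm w)\<^sup>2\<bar> \<le> 2 * B * norm (z - w)"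
proof -
  have "\<bar>(norm z)\<^sup>2 - (norm w)\<^sup>2\<bar> = \<bar>norm z - norm w\<bar> * (norm z + norm w)"
    unfolding power2_eq_square square_diff_square_factored by (simp add: abs_mult mult.commute)
  also have "\<dots> \<le> norm (z - w) * (2 * B)"
    using assms norm_triangle_ineq3[of z w] by (intro mult_mono) auto
  finally show ?thesis by (simp add: mult_ac)
qed

text \<open>For fixed U, passing to a finite partial sum changes the integral by at most U times 2 B
  times the tail, which tends to 0 along the finite subsets. The error from
  \<open>finite_mean_square\<close> depends neither on the subset nor on U, and so survives the
  limit unchanged.\<close>

lemma mean_square_almost_periodic:
  fixes c :: "real \<Rightarrow> complex" and Z :: "real set"
  defines "S \<equiv> \<lambda>u. \<Sum>\<^sub>\<infinity>\<gamma>\<in>Z. c \<gamma> * exp (\<i> * of_real (\<gamma> * u))"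
  assumes d: "d > 0" and U: "U \<ge> 0"
    and gap: "\<And>\<gamma> \<gamma>'. \<gamma> \<in> Z \<Longrightarrow> \<gamma>' \<in> Z \<Longrightarrow> \<gamma> \<noteq> \<gamma>' \<Longrightarrow> d / (3 + \<bar>\<gamma>\<bar>)\<^sup>2 \<le> \<bar>\<gamma> - \<gamma>'\<bar>"
    and sm: "(\<lambda>\<gamma>. (3 + \<bar>\<gamma>\<bar>)\<^sup>2 * norm (c \<gamma>)) summable_on Z"
    and cont: "continuous_on {0..U} S"
  shows "\<bar>integral {0..U} (\<lambda>u. (norm (S u))\<^sup>2) - U * (\<Sum>\<^sub>\<infinity>\<gamma>\<in>Z. (norm (c \<gamma>))\<^sup>2)\<bar> \<le> 2 / d * (\<Sum>\<^sub>\<infinity>\<gamma>\<in>Z. (3 + \<bar>\<gamma>\<bar>)\<^sup>2 * norm (c \<gamma>))\<^sup>2"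
    and "(\<lambda>\<gamma>. (norm (c \<gamma>))\<^sup>2) summable_on Z" and "\<And>u. norm (S u) \<le> (\<Sum>\<^sub>\<infinity>\<gamma>\<in>Z. norm (c \<gamma>))"
proof -
  define W where "W = (\<Sum>\<^sub>\<infinity>\<gamma>\<in>Z. (3 + \<bar>\<gamma>\<bar>)\<^sup>2 * norm (c \<gamma>))"
  define B where "B = (\<Sum>\<^sub>\<infinity>\<gamma>\<in>Z. norm (c \<gamma>))"
  have sc: "(\<lambda>\<gamma>. norm (c \<gamma>)) summable_on Z"
  proof (rule summable_on_comparison_test[OF sm])
    fix \<gamma> :: real
    have "1 \<le> (3 + \<bar>\<gamma>\<bar>)\<^sup>2" by (rule one_le_power) simp
    from mult_right_mono[OF this, of "norm (c \<gamma>)"] show "norm (c \<gamma>) \<le> (3 + \<bar>\<gamma>\<bar>)\<^sup>2 * norm (c \<gamma>)" by simp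
  qed simp
  have B0: "B \<ge> 0" unfolding B_def by (rule infsum_nonneg) simp
  have cB: "norm (c \<gamma>) \<le> B" if "\<gamma> \<in> Z" for \<gamma>
    using finite_sum_le_infsum[OF sc, of "{\<gamma>}"] that by (simp add: B_def)
  show sq: "(\<lambda>\<gamma>. (norm (c \<gamma>))\<^sup>2) summable_on Z"
  proof (rule summable_on_comparison_test[OF summable_on_cmult_right[OF sc, of B]])
    fix \<gamma> assume "\<gamma> \<in> Z"
    from mult_right_mono[OF cB[OF this], of "norm (c \<gamma>)"] show "(norm (c \<gamma>))\<^sup>2 \<le> B * norm (c \<gamma>)"
      by (simp add: power2_eq_square)
  qed simp
  define a where "a = (\<lambda>u \<gamma>. c \<gamma> * exp (\<i> * of_real (\<gamma> * u)))"
  have na: "norm (a u \<gamma>) = norm (c \<gamma>)" for u \<gamma> by (simp add: a_def norm_mult norm_exp_eq_Re)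
  have sa: "a u summable_on A" if "A \<subseteq> Z" for u A
    by (rule abs_summable_summable) (use summable_on_subset_banach[OF sc that] in \<open>simp add: na\<close>)
  have nS: "norm (infsum (a u) A) \<le> infsum (\<lambda>\<gamma>. norm (c \<gamma>)) A" if "A \<subseteq> Z" for u A
    using norm_infsum_bound[of "a u" A] summable_on_subset_banach[OF sc that] by (simp add: na)
  show SB: "norm (S u) \<le> (\<Sum>\<^sub>\<infinity>\<gamma>\<in>Z. norm (c \<gamma>))" for u
    using nS[of Z u] by (simp add: S_def a_def)
  define I where "I = integral {0..U} (\<lambda>u. (norm (S u))\<^sup>2)"
  have SI: "((\<lambda>u. (norm (S u))\<^sup>2) has_integral I) {0..U}"
    unfolding I_def by (intro integrable_integral integrable_continuous_real continuous_intros cont)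
  have fin: "\<bar>I - U * (\<Sum>\<gamma>\<in>F. (norm (c \<gamma>))\<^sup>2)\<bar> \<le> 2 / d * W\<^sup>2 + U * (2 * B * (B - (\<Sum>\<gamma>\<in>F. norm (c \<gamma>))))"
    if F: "finite F" "F \<subseteq> Z" for F
  proof -
    define SF where "SF = (\<lambda>u. \<Sum>\<gamma>\<in>F. a u \<gamma>)"
    define \<tau> where "\<tau> = B - (\<Sum>\<gamma>\<in>F. norm (c \<gamma>))"
    have WF: "(\<Sum>\<gamma>\<in>F. (3 + \<bar>\<gamma>\<bar>)\<^sup>2 * norm (c \<gamma>)) \<le> W"
      unfolding W_def by (rule finite_sum_le_infsum[OF sm F]) simp
    obtain IF where IF: "((\<lambda>u. (norm (SF u))\<^sup>2) has_integral IF) {0..U}"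
      "\<bar>IF - U * (\<Sum>\<gamma>\<in>F. (norm (c \<gamma>))\<^sup>2)\<bar> \<le> 2 / d * W\<^sup>2"
      using finite_mean_square[OF F(1) d U gap WF] F(2) unfolding SF_def a_def by blast
    have diff: "norm (S u - SF u) \<le> \<tau>" for u
    proof -
      have "S u = infsum (a u) (Z - F) + infsum (a u) F"
      proof -
        have "(Z - F) \<inter> F = {}" "Z - F \<union> F = Z" using F(2) by blast+
        then show ?thesis
          using infsum_Un_disjoint[of "a u" "Z - F" F] sa[of "Z - F" u] sa[OF F(2), of u]
          by (simp add: S_def a_def)
      qed
      then have "S u - SF u = infsum (a u) (Z - F)" using F by (simp add: SF_def)
      then have "norm (S u - SF u) \<le> infsum (\<lambda>\<gamma>. norm (c \<gamma>)) (Z - F)" using nS[of "Z - F" u] by simp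
      also have "\<dots> = \<tau>"
        using infsum_Diff[OF sc summable_on_subset_banach[OF sc F(2)] F(2)] F by (simp add: \<tau>_def B_def)
      finally show ?thesis .
    qed
    have SFB: "norm (SF u) \<le> B" for u
    proof -
      have "norm (SF u) \<le> (\<Sum>\<gamma>\<in>F. norm (c \<gamma>))" unfolding SF_def using norm_sum[of "a u" F] by (simp add: na)
      also have "\<dots> \<le> B" unfolding B_def by (rule finite_sum_le_infsum[OF sc F]) simp
      finally show ?thesis .
    qed
    have "norm (I - IF) \<le> 2 * B * \<tau> * measure lborel (cbox 0 U)"
    proof (rule has_integral_bound)
      show "((\<lambda>u. (norm (S u))\<^sup>2 - (norm (SF u))\<^sup>2) has_integral I - IF) (cbox 0 U)"
        using has_integral_diff[OF SI IF(1)] by simp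
      have "\<tau> \<ge> 0" using diff[of 0] norm_ge_zero order_trans by blast
      then show "0 \<le> 2 * B * \<tau>" using B0 by simp
      fix u
      have "\<bar>(norm (S u))\<^sup>2 - (norm (SF u))\<^sup>2\<bar> \<le> 2 * B * norm (S u - SF u)"
        by (rule norm_sq_diff_le) (use SB SFB in \<open>auto simp: B_def\<close>)
      also have "\<dots> \<le> 2 * B * \<tau>" using diff B0 by (intro mult_left_mono) auto
      finally show "norm ((norm (S u))\<^sup>2 - (norm (SF u))\<^sup>2) \<le> 2 * B * \<tau>" by simp
    qed
    then have "\<bar>I - IF\<bar> \<le> U * (2 * B * \<tau>)" using U by (simp add: mult.commute)
    then show ?thesis using IF(2) unfolding \<tau>_def by linarith
  qed
  have l1: "((\<lambda>F. \<Sum>\<gamma>\<in>F. (norm (c \<gamma>))\<^sup>2) \<longlongrightarrow> (\<Sum>\<^sub>\<infinity>\<gamma>\<in>Z. (norm (c \<gamma>))\<^sup>2)) (finite_subsets_at_top Z)"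
    using has_sum_infsum[OF sq] by (simp add: has_sum_def)
  have l2: "((\<lambda>F. \<Sum>\<gamma>\<in>F. norm (c \<gamma>)) \<longlongrightarrow> B) (finite_subsets_at_top Z)"
    using has_sum_infsum[OF sc] by (simp add: has_sum_def B_def)
  have "\<bar>I - U * (\<Sum>\<^sub>\<infinity>\<gamma>\<in>Z. (norm (c \<gamma>))\<^sup>2)\<bar> \<le> 2 / d * W\<^sup>2 + U * (2 * B * (B - B))"
  proof (rule tendsto_le)
    show "((\<lambda>F. 2 / d * W\<^sup>2 + U * (2 * B * (B - (\<Sum>\<gamma>\<in>F. norm (c \<gamma>))))) \<longlongrightarrow> 2 / d * W\<^sup>2 + U * (2 * B * (B - B))) (finite_subsets_at_top Z)"
      by (intro tendsto_intros l2)
    show "((\<lambda>F. \<bar>I - U * (\<Sum>\<gamma>\<in>F. (norm (c \<gamma>))\<^sup>2)\<bar>) \<longlongrightarrow> \<bar>I - U * (\<Sum>\<^sub>\<infinity>\<gamma>\<in>Z. (norm (c \<gamma>))\<^sup>2)\<bar>) (finite_subsets_at_top Z)"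
      by (intro tendsto_intros l1)
    show "\<forall>\<^sub>F F in finite_subsets_at_top Z. \<bar>I - U * (\<Sum>\<gamma>\<in>F. (norm (c \<gamma>))\<^sup>2)\<bar> \<le> 2 / d * W\<^sup>2 + U * (2 * B * (B - (\<Sum>\<gamma>\<in>F. norm (c \<gamma>))))"
      by (rule eventually_finite_subsets_at_top_weakI) (rule fin)
  qed simp
  then show "\<bar>integral {0..U} (\<lambda>u. (norm (S u))\<^sup>2) - U * (\<Sum>\<^sub>\<infinity>\<gamma>\<in>Z. (norm (c \<gamma>))\<^sup>2)\<bar> \<le> 2 / d * (\<Sum>\<^sub>\<infinity>\<gamma>\<in>Z. (3 + \<bar>\<gamma>\<bar>)\<^sup>2 * norm (c \<gamma>))\<^sup>2"
    by (simp add: I_def W_def)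
qed

text \<open>The sum over the zeros and F are both expressed through vertical integrals, so this
  gives their continuity and hence the integrability of their squares.\<close>

lemma continuous_vertical_int:
  assumes wmh: weak_mertens_hypothesis and c: "c \<in> {1/4, 3/4}"
  shows "continuous_on UNIV (\<lambda>u. vertical_int u c)"
  unfolding continuous_on_sequentially
proof (intro allI ballI impI)
  fix x :: "nat \<Rightarrow> real" and a assume "(\<forall>n. x n \<in> UNIV) \<and> x \<longlonglongrightarrow> a"
  then have x: "x \<longlonglongrightarrow> a" by simp
  obtain C where C: "C > 0" "\<And>c t u. c \<in> {1/4, 3/4} \<Longrightarrow>
    norm (zeta_quotient (Complex c t) * exp (Complex c t * of_real u)) \<le> C * exp (c * u) * exp (- (1/8) * \<bar>t\<bar>)"
    using vertical_bound[OF wmh] by blast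
  obtain K where K: "\<And>n. norm (x n) \<le> K"
    using convergent_imp_Bseq[OF convergentI[OF x]] by (auto simp: Bseq_def)
  have "(\<lambda>n. vertical_int (x n) c) \<longlonglongrightarrow> vertical_int a c"
    unfolding vertical_int_def
  proof (rule integral_dominated_convergence[where w = "\<lambda>t. C * exp K * exp (- (1/8) * \<bar>t\<bar>)"])
    show "(\<lambda>t. zeta_quotient (Complex c t) * exp (Complex c t * of_real a)) \<in> borel_measurable lborel"
      by (rule borel_measurable_integrable[OF vertical_integrable[OF wmh c]])
    show "(\<lambda>t. zeta_quotient (Complex c t) * exp (Complex c t * of_real (x n))) \<in> borel_measurable lborel" for n
      by (rule borel_measurable_integrable[OF vertical_integrable[OF wmh c]])
    show "integrable lborel (\<lambda>t. C * exp K * exp (- (1/8) * \<bar>t\<bar>))"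
      by (intro integrable_mult_right integrable_exp_neg_abs) simp
    show "AE t in lborel. (\<lambda>n. zeta_quotient (Complex c t) * exp (Complex c t * of_real (x n))) \<longlonglongrightarrow>
        zeta_quotient (Complex c t) * exp (Complex c t * of_real a)"
      by (intro AE_I2 tendsto_intros x)
    show "AE t in lborel. norm (zeta_quotient (Complex c t) * exp (Complex c t * of_real (x n))) \<le> C * exp K * exp (- (1/8) * \<bar>t\<bar>)" for n
    proof (rule AE_I2)
      fix t
      have "c * x n \<le> \<bar>c * x n\<bar>" by simp
      also have "\<dots> \<le> 1 * K" unfolding abs_mult using K[of n] c by (intro mult_mono) auto
      finally have "C * exp (c * x n) * exp (- (1/8) * \<bar>t\<bar>) \<le> C * exp K * exp (- (1/8) * \<bar>t\<bar>)"
        using C(1) by (intro mult_right_mono mult_left_mono) auto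
      then show "norm (zeta_quotient (Complex c t) * exp (Complex c t * of_real (x n))) \<le> C * exp K * exp (- (1/8) * \<bar>t\<bar>)"
        using C(2)[OF c, of t "x n"] by linarith
    qed
  qed
  then show "((\<lambda>u. vertical_int u c) \<circ> x) \<longlonglongrightarrow> vertical_int a c" by (simp add: o_def)
qed

text \<open>Summability is part of the claim because the infinite sum of a non-summable family is 0
  by convention; it guarantees that A is a genuine sum.\<close>

theorem theorem4:
  assumes "weak_mertens_hypothesis"
  shows "(\<lambda>\<gamma>. (cmod (zero_coeff \<gamma>))\<^sup>2) summable_on positive_ordinates \<and>
    (\<lambda>X. integral {1..X} (\<lambda>x. (gauss_F x)\<^sup>2) - mean_square_const * ln X) \<in> O[at_top](\<lambda>_. 1)"
proof -
  note wmh = assms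
  \<comment> \<open>The shift formula carries 2 pi and the formula for F carries 4 pi x, whence the
    factor 1/2.\<close>
  define c where "c = (\<lambda>\<gamma>. zero_coeff \<gamma> / 2)"
  define S where "S = (\<lambda>u. \<Sum>\<^sub>\<infinity>\<gamma>\<in>zero_ordinates. c \<gamma> * exp (\<i> * of_real (\<gamma> * u)))"
  \<comment> \<open>The contribution of the line Re s = 1/4 to x^(1/2) F(x); it is O(exp(- u /
    4)).\<close>
  define r where "r = (\<lambda>u. vertical_int u (1/4) / of_real (4 * pi * exp (u / 2)))"
  define P where "P = {\<gamma> \<in> zero_ordinates. \<gamma> > 0}"
  obtain d where d: "0 < d" "d \<le> 1"
    and gap: "\<And>\<gamma> \<gamma>'. \<gamma> \<in> zero_ordinates \<Longrightarrow> \<gamma>' \<in> zero_ordinates \<Longrightarrow> \<gamma> \<noteq> \<gamma>' \<Longrightarrow> d / (3 + \<bar>\<gamma>\<bar>)\<^sup>2 \<le> \<bar>\<gamma> - \<gamma>'\<bar>"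
    using zero_gap[OF wmh] by blast
  have sm: "(\<lambda>\<gamma>. (3 + \<bar>\<gamma>\<bar>)\<^sup>2 * norm (c \<gamma>)) summable_on zero_ordinates"
    using summable_on_cmult_right[OF zero_coeff_abs_summable[OF wmh, of 2], of "1/2"]
    by (simp add: c_def norm_divide)
  have S_eq: "S u = (vertical_int u (3/4) - vertical_int u (1/4)) / of_real (4 * pi * exp (u / 2))" for u
  proof -
    have e: "zero_coeff \<gamma> * exp (Complex (1/2) \<gamma> * of_real u) = (2 * of_real (exp (u / 2))) * (c \<gamma> * exp (\<i> * of_real (\<gamma> * u)))" for \<gamma>
    proof -
      have "Complex (1/2) \<gamma> * of_real u = of_real (u / 2) + \<i> * of_real (\<gamma> * u)" by (simp add: complex_eq_iff)
      then have "exp (Complex (1/2) \<gamma> * of_real u) = of_real (exp (u / 2)) * exp (\<i> * of_real (\<gamma> * u))"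
        by (simp only: exp_add exp_of_real)
      then show ?thesis by (simp add: c_def)
    qed
    have "vertical_int u (3/4) - vertical_int u (1/4) = 2 * of_real pi * ((2 * of_real (exp (u / 2))) * S u)"
      unfolding contour_shift[OF wmh, of u, symmetric] e infsum_cmult_right' S_def ..
    then show ?thesis by (simp add: field_simps)
  qed
  have contV: "continuous_on A (\<lambda>u. vertical_int u c)" if "c \<in> {1/4, 3/4}" for c and A :: "real set"
    by (rule continuous_on_subset[OF continuous_vertical_int[OF wmh that]]) simp
  have contS: "continuous_on A S" for A
    unfolding S_eq[abs_def] by (intro continuous_intros contV) auto
  have contr: "continuous_on A r" for A
    unfolding r_def by (intro continuous_intros contV) auto
  define B where "B = (\<Sum>\<^sub>\<infinity>\<gamma>\<in>zero_ordinates. norm (c \<gamma>))"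
  define K0 where "K0 = 2 / d * (\<Sum>\<^sub>\<infinity>\<gamma>\<in>zero_ordinates. (3 + \<bar>\<gamma>\<bar>)\<^sup>2 * norm (c \<gamma>))\<^sup>2"
  have mean: "\<bar>integral {0..U} (\<lambda>u. (norm (S u))\<^sup>2) - U * (\<Sum>\<^sub>\<infinity>\<gamma>\<in>zero_ordinates. (norm (c \<gamma>))\<^sup>2)\<bar> \<le> K0"
    and sq: "(\<lambda>\<gamma>. (norm (c \<gamma>))\<^sup>2) summable_on zero_ordinates" and SB: "norm (S u) \<le> B" if "U \<ge> 0" for U u
    using mean_square_almost_periodic[OF d(1) that gap sm] contS unfolding S_def K0_def B_def by blast+
  obtain C where C: "C > 0" "\<And>u. norm (vertical_int u (1/4)) \<le> C * exp (u / 4)"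
    using vertical_int_bound[OF wmh] by blast
  have rb: "norm (r u) \<le> C * exp (- (u / 4))" for u
  proof -
    have "norm (r u) = norm (vertical_int u (1/4)) / (4 * pi * exp (u / 2))"
      unfolding r_def norm_divide norm_of_real by simp
    also have "\<dots> \<le> (C * exp (u / 4)) / (1 * exp (u / 2))"
      using C pi_gt3 by (intro frac_le mult_right_mono) auto
    also have "\<dots> = C * exp (- (u / 4))" by (simp add: exp_diff[symmetric] times_divide_eq_right[symmetric] del: times_divide_eq_right)
    finally show ?thesis .
  qed
  \<comment> \<open>The factor exp u is the Jacobian of x = exp u. Absorbed into the square, it
    turns the integrand into that of an almost periodic function plus a small remainder.\<close>
  have F: "exp u * (gauss_F (exp u))\<^sup>2 = (norm (S u + r u))\<^sup>2" for u
  proof -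
    have "S u + r u = vertical_int u (3/4) / of_real (4 * pi * exp (u / 2))"
      unfolding S_eq r_def by (simp only: add_divide_distrib[symmetric] diff_add_cancel)
    moreover define G where "G = gauss_F (exp u)"
    moreover have "vertical_int u (3/4) = of_real G * of_real (4 * pi * exp u)"
      using gauss_F_vertical[OF wmh, of "exp u"] by (simp add: G_def)
    moreover have "exp u = exp (u / 2) * exp (u / 2)" by (simp flip: exp_add)
    ultimately have "S u + r u = of_real (G * exp (u / 2))" by simp
    then have "(norm (S u + r u))\<^sup>2 = G\<^sup>2 * (exp (u / 2) * exp (u / 2))"
      by (simp only: norm_of_real power2_abs power_mult_distrib power2_eq_square[of "exp (u / 2)"])
    then show ?thesis by (simp add: G_def flip: exp_add)
  qed
  have contF: "continuous_on {1..X} (\<lambda>x. (gauss_F x)\<^sup>2)" for X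
  proof -
    have "continuous_on {1..X} (\<lambda>x. Re (vertical_int (ln x) (3/4) / of_real (4 * pi * x)))"
      by (intro continuous_intros continuous_on_compose2[OF contV[of "3/4" UNIV]]) auto
    moreover have "gauss_F x = Re (vertical_int (ln x) (3/4) / of_real (4 * pi * x))" if "x \<in> {1..X}" for x
      using gauss_F_vertical[OF wmh, of x] that by (metis Re_complex_of_real atLeastAtMost_iff less_le_trans zero_less_one)
    ultimately have "continuous_on {1..X} gauss_F"
      using continuous_on_cong[OF refl, of "{1..X}" gauss_F "\<lambda>x. Re (vertical_int (ln x) (3/4) / of_real (4 * pi * x))"] by blast
    then show ?thesis by (intro continuous_intros)
  qed
  have "B \<ge> 0" unfolding B_def by (rule infsum_nonneg) simp
  \<comment> \<open>The last factor 4 is the integral of exp(- u / 4) over u >= 0.\<close>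
  define K1 where "K1 = 2 * (B + C) * C * 4"
  have bound: "\<bar>integral {1..X} (\<lambda>x. (gauss_F x)\<^sup>2) - ln X * (\<Sum>\<^sub>\<infinity>\<gamma>\<in>zero_ordinates. (norm (c \<gamma>))\<^sup>2)\<bar> \<le> K1 + K0"
    if X: "X \<ge> 1" for X
  proof -
    define U where "U = ln X"
    have U: "U \<ge> 0" "exp U = X" using X by (auto simp: U_def)
    have "((\<lambda>u. exp u *\<^sub>R (gauss_F (exp u))\<^sup>2) has_integral integral {exp 0..exp U} (\<lambda>x. (gauss_F x)\<^sup>2)) {0..U}"
    proof (rule has_integral_substitution[where c = 1 and d = X])
      show "exp ` {0..U} \<subseteq> {1..X}" using U by (auto simp flip: U(2))
      show "(exp has_field_derivative exp u) (at u within {0..U})" for u :: real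
        by (rule has_field_derivative_at_within[OF DERIV_exp])
    qed (use U contF in auto)
    then have I1: "((\<lambda>u. (norm (S u + r u))\<^sup>2) has_integral integral {1..X} (\<lambda>x. (gauss_F x)\<^sup>2)) {0..U}"
      by (simp add: F U(2))
    have "((\<lambda>u. (norm (S u))\<^sup>2) has_integral integral {0..U} (\<lambda>u. (norm (S u))\<^sup>2)) {0..U}"
      by (intro integrable_integral integrable_continuous_real continuous_intros contS)
    from has_integral_diff[OF I1 this]
    have I2: "((\<lambda>u. (norm (S u + r u))\<^sup>2 - (norm (S u))\<^sup>2) has_integral
        integral {1..X} (\<lambda>x. (gauss_F x)\<^sup>2) - integral {0..U} (\<lambda>u. (norm (S u))\<^sup>2)) {0..U}" .
    have I3: "((\<lambda>u. 2 * (B + C) * (C * exp (- (u / 4)))) has_integral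
        (- (2 * (B + C) * C * 4) * exp (- (U / 4)) - - (2 * (B + C) * C * 4) * exp (- (0 / 4)))) {0..U}"
    proof (rule fundamental_theorem_of_calculus[OF U(1)])
      fix u
      show "((\<lambda>u. - (2 * (B + C) * C * 4) * exp (- (u / 4))) has_vector_derivative 2 * (B + C) * (C * exp (- (u / 4)))) (at u within {0..U})"
        unfolding has_real_derivative_iff_has_vector_derivative[symmetric]
        by (auto intro!: derivative_eq_intros)
    qed
    have "norm (integral {1..X} (\<lambda>x. (gauss_F x)\<^sup>2) - integral {0..U} (\<lambda>u. (norm (S u))\<^sup>2)) \<le>
       integral {0..U} (\<lambda>u. 2 * (B + C) * (C * exp (- (u / 4))))"
      unfolding integral_unique[OF I2, symmetric]
    proof (rule Henstock_Kurzweil_Integration.integral_norm_bound_integral)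
      fix u assume u: "u \<in> {0..U}"
      have "norm (r u) \<le> C * 1" using rb[of u] u C(1) by (elim order_trans) (intro mult_left_mono, auto)
      then have "norm (S u + r u) \<le> B + C" using norm_triangle_ineq[of "S u" "r u"] SB[of 0 u] by simp
      moreover have "norm (S u) \<le> B + C" using SB[of 0 u] C(1) by simp
      ultimately have "\<bar>(norm (S u + r u))\<^sup>2 - (norm (S u))\<^sup>2\<bar> \<le> 2 * (B + C) * norm (S u + r u - S u)"
        by (rule norm_sq_diff_le)
      also have "\<dots> \<le> 2 * (B + C) * (C * exp (- (u / 4)))"
        using rb[of u] \<open>B \<ge> 0\<close> C(1) by (intro mult_left_mono) auto
      finally show "norm ((norm (S u + r u))\<^sup>2 - (norm (S u))\<^sup>2) \<le> 2 * (B + C) * (C * exp (- (u / 4)))" by simp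
    qed (use I2 I3 in \<open>auto simp: integrable_on_def\<close>)
    also have "\<dots> \<le> K1"
      unfolding integral_unique[OF I3] K1_def using \<open>B \<ge> 0\<close> C(1) by simp
    finally show ?thesis using mean[OF U(1)] unfolding U_def by simp
  qed
  have sq4: "(\<lambda>\<gamma>. (norm (zero_coeff \<gamma>))\<^sup>2) summable_on zero_ordinates"
    using summable_on_cmult_right[OF sq[of 0], of 4] by (simp add: c_def norm_divide power_divide)
  have sP: "(\<lambda>\<gamma>. (norm (zero_coeff \<gamma>))\<^sup>2) summable_on P"
    by (rule summable_on_subset_banach[OF sq4]) (auto simp: P_def)
  \<comment> \<open>The factor 1/4 from the halved coefficients and the factor 2 from the two signs
    of the ordinates combine to the 1/2 in A.\<close>
  have const: "(\<Sum>\<^sub>\<infinity>\<gamma>\<in>zero_ordinates. (norm (c \<gamma>))\<^sup>2) = mean_square_const"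
  proof -
    have inj: "inj_on uminus P" by (simp add: inj_on_def)
    have un: "infsum (\<lambda>\<gamma>. (norm (zero_coeff \<gamma>))\<^sup>2) (uminus ` P) = infsum (\<lambda>\<gamma>. (norm (zero_coeff \<gamma>))\<^sup>2) P"
      unfolding infsum_reindex[OF inj] o_def
      by (rule infsum_cong) (simp add: norm_zero_coeff_uminus P_def)
    have sN: "(\<lambda>\<gamma>. (norm (zero_coeff \<gamma>))\<^sup>2) summable_on uminus ` P"
      by (rule summable_on_subset_banach[OF sq4]) (auto simp: P_def)
    have "(\<Sum>\<^sub>\<infinity>\<gamma>\<in>zero_ordinates. (norm (c \<gamma>))\<^sup>2) = (\<Sum>\<^sub>\<infinity>\<gamma>\<in>zero_ordinates. 1/4 * (norm (zero_coeff \<gamma>))\<^sup>2)"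
      by (simp add: c_def norm_divide power_divide)
    also have "\<dots> = 1/4 * (\<Sum>\<^sub>\<infinity>\<gamma>\<in>P \<union> uminus ` P. (norm (zero_coeff \<gamma>))\<^sup>2)"
      unfolding infsum_cmult_right' using zero_ordinates_split[OF wmh] by (simp add: P_def)
    also have "(\<Sum>\<^sub>\<infinity>\<gamma>\<in>P \<union> uminus ` P. (norm (zero_coeff \<gamma>))\<^sup>2) = 2 * (\<Sum>\<^sub>\<infinity>\<gamma>\<in>P. (norm (zero_coeff \<gamma>))\<^sup>2)"
    proof -
      have "P \<inter> uminus ` P = {}" by (auto simp: P_def)
      from infsum_Un_disjoint[OF sP sN this] show ?thesis by (simp add: un)
    qed
    finally show ?thesis
      by (simp add: mean_square_const_def positive_ordinates_eq[OF wmh] P_def)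
  qed
  have "(\<lambda>X. integral {1..X} (\<lambda>x. (gauss_F x)\<^sup>2) - mean_square_const * ln X) \<in> O[at_top](\<lambda>_. 1)"
  proof (rule bigoI[where c = "K1 + K0"])
    show "\<forall>\<^sub>F X in at_top. norm (integral {1..X} (\<lambda>x. (gauss_F x)\<^sup>2) - mean_square_const * ln X) \<le> (K1 + K0) * norm (1::real)"
      using eventually_ge_at_top[of 1]
      by eventually_elim (use bound in \<open>simp add: const mult.commute\<close>)
  qed
  then show ?thesis using sP by (simp add: positive_ordinates_eq[OF wmh] P_def)
qed

end
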